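(* Let $L>0$, $\delta\in(0,L/2)$, $q\in(0,\infty)$, and let $N\ge2$ be an integer. Define $$\rho(\lambda,\delta):=\frac{e^{2\lambda\delta}+e^{\lambda L}}{e^{2\lambda\delta+\lambda L}+1},\qquad\lambda\ge0.$$ Consider the parallel Schwarz method (PSM) and the optimized Schwarz method (OSM, with parameter $p>0$) described in the context, for the Laplace problem on a chain of $N$ rectangular subdomains with external boundary conditions of type (DD), (DR), (DN), (RR), (NR) or (NN) at the bottom and top. Then the contraction factors (in the $L^2$ norm) of PSM and OSM are bounded, for the respective external conditions, by - (DD): $\rho_{\rm DD}(\delta):=\rho(\pi^2,\delta)$, - (DR): $\rho_{\rm DR}(\delta,q):=\rho(\mu_1(q)^2,\delta)$, - (DN): $\rho_{\rm DN}(\delta):=\rho(\pi^2/4,\delta)$, - (RR): $\rho_{\rm RR}(\delta,q):=\rho(\tau_1(q)^2,\delta)$, - (NR): $\rho_{\rm NR}(\delta,q):=\rho(\nu_1(q)^2,\delta)$, - (NN): $\rho_{\rm NN}(\delta):=\rho(0,\delta)=1$, where $\mu_1(q)$ is the root of $q\sin(x)+x\cos(x)$ in $(\pi/2,\pi)$, $\tau_1(q)$ is the root of $2qx\cos(x)+(q^2-x^2)\sin(x)$ in $(0,\pi)$, and $\nu_1(q)$ is the root of $x\sin(x)-q\cos(x)$ in $(0,\pi/2)$. Moreover, for any $\delta>0$, $$\rho_{\rm DD}(\delta)<\rho_{\rm DR}(\delta,q)<\rho_{\rm DN}(\delta)<\rho_{\rm NR}(\delta,q)<\rho_{\rm NN}(\delta)=1,$$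 $$\rho_{\rm DD}(\delta)<\rho_{\rm RR}(\delta,q)<\rho_{\rm NN}(\delta)=1.$$
   Context: Geometry: $a_1=0$, $a_j=a_{j-1}+L$ for $j=2,\dots,N+1$, and $b_j=a_{j+1}+2\delta$ for $j=0,\dots,N$. Subdomains are $\Omega_j=(a_j,b_j)\times(0,1)$, $j=1,\dots,N$, and $\Omega=\bigcup_j\Omega_j=(a_1,b_N)\times(0,1)$. Problem: $-\Delta u=f$ in $\Omega$, $u(a_1,y)=u(b_N,y)=0$ for $y\in(0,1)$, and $\mathcal B_b(u)(x)=\mathcal B_t(u)(x)=0$ for $x\in(a_1,b_N)$. The bottom operator $\mathcal B_b$ is one of: Dirichlet $u(x,0)$, Neumann $\partial_yu(x,0)$, Robin $q\,u(x,0)-\partial_yu(x,0)$. The top operator $\mathcal B_t$ is one of: Dirichlet $u(x,1)$, Neumann $\partial_yu(x,1)$, Robin $q\,u(x,1)+\partial_yu(x,1)$. In the labels (DD), (DR), (DN), (RR), (NR), (NN), the first letter gives the type of the bottom condition and the second letter that of the top condition (D Dirichlet, R Robin, N Neumann). Schwarz methods: given iterates $u_j^{n-1}$, $j=1,\dots,N$, the new iterate $u_j^n$ solves $-\Delta u_j^n=f|_{\Omega_j}$ in $\Omega_j$, $\mathcal B_b(u_j^n)(x)=\mathcal B_t(u_j^n)(x)=0$ for $x\in(a_j,b_j)$, $\mathcal T_\ell(u_j^n)(a_j)=\mathcal T_\ell(u_{j-1}^{n-1})(a_j)$ and $\mathcal T_r(u_j^n)(b_j)=\mathcal T_r(u_{j+1}^{n-1})(b_j)$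 (as functions of $y\in(0,1)$), except that for $j=1$ the condition at $a_1$ is replaced by $u_1^n(a_1,y)=0$ and for $j=N$ the condition at $b_N$ is replaced by $u_N^n(b_N,y)=0$. For the PSM, $\mathcal T_\ell(v)(x)=\mathcal T_r(v)(x)=v(x,\cdot)$. For the OSM with parameter $p>0$, $\mathcal T_\ell(v)(x)=p\,v(x,\cdot)-\partial_xv(x,\cdot)$ and $\mathcal T_r(v)(x)=p\,v(x,\cdot)+\partial_xv(x,\cdot)$. Fourier form: let $(\varphi_k)_k$ be the $L^2(0,1)$-orthonormal basis of eigenfunctions, with eigenvalues $\lambda_k\ge0$, of $-\varphi''=\lambda\varphi$ on $(0,1)$ with the boundary conditions at $y=0$ and $y=1$ corresponding to $\mathcal B_b$ and $\mathcal B_t$. Expanding $u_j^n(x,y)=\sum_k\widehat u_j^n(x,\lambda_k)\varphi_k(y)$, each coefficient satisfies the one-dimensional Schwarz iteration $-\partial_{xx}\widehat u_j^n+\lambda_k\widehat u_j^n=\widehat f_j$ in $(a_j,b_j)$ with the same transmission conditions and the same homogeneous Dirichlet conditions at $a_1$ and $b_N$. Contraction factors: for the $k$-th Fourier component, the contraction factor is the spectral radius of the Schwarz iteration matrix of this one-dimensional iteration, i.e. of the linear map that, for zero right-hand side (the error equation), sends the transmission data imposed at step $n$ to those imposed at step $n+1$. The contraction factor in the $L^2$ norm is the factor by which the error of the full two-dimensional iteration, measured in the $L^2$ norm, contracts; it is obtained from the Fourier components by Parseval's identity, taking the maximum over all admissible frequencies $\lambda_k$.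
   Formalization: The formula for ρ(λ,δ) is corrected by replacing λ with √λ in all exponents; as printed the bound fails, e.g. for PSM, N=2, L=1, δ=1/10, (DD), where the factor is at least about 0.53 but the printed bound is about 0.14. *)

theory Defs
  imports "HOL-Analysis.Analysis" "Jordan_Normal_Form.Spectral_Radius"
begin

definition left_end :: "real \<Rightarrow> nat \<Rightarrow> real" where
  "left_end L j = (real j - 1) * L"

definition right_end :: "real \<Rightarrow> real \<Rightarrow> nat \<Rightarrow> real" where
  "right_end L d j = left_end L (j + 1) + 2 * d"

datatype bc = Dirichlet | Neumann | Robin

datatype schwarz_method = PSM | OSM real

text \<open>One-sided at the end points of the interval, two-sided inside.\<close>

definition deriv_on :: "real \<Rightarrow> real \<Rightarrow> (real \<Rightarrow> real) \<Rightarrow> real \<Rightarrow> real" where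
  "deriv_on a b w x = vector_derivative w (at x within {a..b})"

text \<open>The operators act on slices of the two-dimensional functions: the external ones on
  \<open>y \<mapsto> u(x,y)\<close>, the transmission operators on \<open>x \<mapsto> u(x,y)\<close>. Functions are total,
  only their values on the closed (sub)domains are constrained.\<close>

fun bottom_op :: "real \<Rightarrow> bc \<Rightarrow> (real \<Rightarrow> real) \<Rightarrow> real" where
  "bottom_op q Dirichlet w = w 0"
| "bottom_op q Neumann w = deriv_on 0 1 w 0"
| "bottom_op q Robin w = q * w 0 - deriv_on 0 1 w 0"

fun top_op :: "real \<Rightarrow> bc \<Rightarrow> (real \<Rightarrow> real) \<Rightarrow> real" where
  "top_op q Dirichlet w = w 1"
| "top_op q Neumann w = deriv_on 0 1 w 1"
| "top_op q Robin w = q * w 1 + deriv_on 0 1 w 1"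

fun trans_left :: "schwarz_method \<Rightarrow> real \<Rightarrow> real \<Rightarrow> (real \<Rightarrow> real) \<Rightarrow> real \<Rightarrow> real" where
  "trans_left PSM a b w x = w x"
| "trans_left (OSM p) a b w x = p * w x - deriv_on a b w x"

fun trans_right :: "schwarz_method \<Rightarrow> real \<Rightarrow> real \<Rightarrow> (real \<Rightarrow> real) \<Rightarrow> real \<Rightarrow> real" where
  "trans_right PSM a b w x = w x"
| "trans_right (OSM p) a b w x = p * w x + deriv_on a b w x"

text \<open>Condition imposed on subdomain \<open>j\<close> at its left and right end, and the datum it receives
  from the neighbouring slices \<open>W\<close> of the previous iterate. The outer ends of the chain carry
  a homogeneous Dirichlet condition.\<close>

definition left_cond :: "schwarz_method \<Rightarrow> real \<Rightarrow> real \<Rightarrow> nat \<Rightarrow> (real \<Rightarrow> real) \<Rightarrow> real" where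
  "left_cond m L d j w =
     (if j = 1 then w (left_end L j)
      else trans_left m (left_end L j) (right_end L d j) w (left_end L j))"

definition right_cond ::
  "schwarz_method \<Rightarrow> real \<Rightarrow> real \<Rightarrow> nat \<Rightarrow> nat \<Rightarrow> (real \<Rightarrow> real) \<Rightarrow> real" where
  "right_cond m L d N j w =
     (if j = N then w (right_end L d j)
      else trans_right m (left_end L j) (right_end L d j) w (right_end L d j))"

definition left_datum ::
  "schwarz_method \<Rightarrow> real \<Rightarrow> real \<Rightarrow> nat \<Rightarrow> (nat \<Rightarrow> real \<Rightarrow> real) \<Rightarrow> real" where
  "left_datum m L d j W =
     (if j = 1 then 0
      else trans_left m (left_end L (j - 1)) (right_end L d (j - 1)) (W (j - 1)) (left_end L j))"

definition right_datum ::
  "schwarz_method \<Rightarrow> real \<Rightarrow> real \<Rightarrow> nat \<Rightarrow> nat \<Rightarrow> (nat \<Rightarrow> real \<Rightarrow> real) \<Rightarrow> real" where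
  "right_datum m L d N j W =
     (if j = N then 0
      else trans_right m (left_end L (j + 1)) (right_end L d (j + 1)) (W (j + 1))
             (right_end L d j))"

text \<open>\<open>w'' = c w\<close> in \<open>(a,b)\<close>, with \<open>w\<close> continuously differentiable up to the end points.\<close>

definition solves_ode :: "real \<Rightarrow> real \<Rightarrow> real \<Rightarrow> (real \<Rightarrow> real) \<Rightarrow> bool" where
  "solves_ode c a b w \<longleftrightarrow>
     (\<exists>w'. continuous_on {a..b} w' \<and>
        (\<forall>x\<in>{a..b}. (w has_real_derivative w' x) (at x within {a..b})) \<and>
        (\<forall>x\<in>{a<..<b}. (w' has_real_derivative c * w x) (at x)))"

text \<open>\<open>\<phi>\<close> is an orthonormal basis of \<open>L\<^sup>2(0,1)\<close>, the expansion of every square integrable function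
  converging to it in the mean, and consists of eigenfunctions of \<open>-\<phi>'' = \<lambda> \<phi>\<close>.\<close>

definition eigenbasis ::
  "real \<Rightarrow> bc \<Rightarrow> bc \<Rightarrow> (nat \<Rightarrow> real \<Rightarrow> real) \<Rightarrow> (nat \<Rightarrow> real) \<Rightarrow> bool" where
  "eigenbasis q bb bt \<phi> ev \<longleftrightarrow>
     (\<forall>k. solves_ode (- ev k) 0 1 (\<phi> k) \<and> bottom_op q bb (\<phi> k) = 0 \<and> top_op q bt (\<phi> k) = 0) \<and>
     (\<forall>i k. (LINT y:{0<..<1}|lborel. \<phi> i y * \<phi> k y) = (if i = k then 1 else 0)) \<and>
     (\<forall>f. f \<in> borel_measurable borel \<and> set_integrable lborel {0<..<1} (\<lambda>y. (f y)\<^sup>2) \<longrightarrow>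
        (\<lambda>n. LINT y:{0<..<1}|lborel.
               (f y - (\<Sum>k<n. (LINT t:{0<..<1}|lborel. f t * \<phi> k t) * \<phi> k y))\<^sup>2)
          \<longlonglongrightarrow> 0)"

text \<open>One-dimensional error iteration. The \<open>2(N-1)\<close> interface data are numbered so that
  \<open>i < N - 1\<close> is the datum at the left end of subdomain \<open>i + 2\<close> and \<open>N - 1 + i\<close> is the datum at
  the right end of subdomain \<open>i + 1\<close>.\<close>

definition left_entry :: "(nat \<Rightarrow> real) \<Rightarrow> nat \<Rightarrow> real" where
  "left_entry g j = (if j = 1 then 0 else g (j - 2))"

definition right_entry :: "nat \<Rightarrow> (nat \<Rightarrow> real) \<Rightarrow> nat \<Rightarrow> real" where
  "right_entry N g j = (if j = N then 0 else g (N - 1 + (j - 1)))"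

text \<open>The local problem has exactly one solution on the closed subinterval for every
  \<open>\<lambda> \<ge> 0\<close>; the choice operator only picks its values outside.\<close>

definition local_solution ::
  "schwarz_method \<Rightarrow> real \<Rightarrow> real \<Rightarrow> nat \<Rightarrow> real \<Rightarrow> (nat \<Rightarrow> real) \<Rightarrow> nat \<Rightarrow> real \<Rightarrow> real" where
  "local_solution m L d N lam g j =
     (SOME w. solves_ode lam (left_end L j) (right_end L d j) w \<and>
              left_cond m L d j w = left_entry g j \<and>
              right_cond m L d N j w = right_entry N g j)"

definition iteration_matrix ::
  "schwarz_method \<Rightarrow> real \<Rightarrow> real \<Rightarrow> nat \<Rightarrow> real \<Rightarrow> real mat" where
  "iteration_matrix m L d N lam =
     Matrix.mat (2 * (N - 1)) (2 * (N - 1)) (\<lambda>(i, l).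
       let W = local_solution m L d N lam (\<lambda>i'. if i' = l then 1 else 0)
       in if i < N - 1 then left_datum m L d (i + 2) W
          else right_datum m L d N (i - (N - 1) + 1) W)"

definition frequency_factor ::
  "schwarz_method \<Rightarrow> real \<Rightarrow> real \<Rightarrow> nat \<Rightarrow> real \<Rightarrow> real" where
  "frequency_factor m L d N lam =
     spectral_radius (map_mat complex_of_real (iteration_matrix m L d N lam))"

text \<open>Classical regularity on \<open>(a,b) \<times> (0,1)\<close>: first derivatives up to the boundary (needed for
  the boundary and transmission operators), second derivatives in the interior.\<close>

definition C1_rect :: "real \<Rightarrow> real \<Rightarrow> (real \<Rightarrow> real \<Rightarrow> real) \<Rightarrow> bool" where
  "C1_rect a b u \<longleftrightarrow>
     continuous_on ({a..b} \<times> {0..1}) (\<lambda>(x, y). u x y) \<and>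
     (\<exists>ux uy. continuous_on ({a..b} \<times> {0..1}) (\<lambda>(x, y). ux x y) \<and>
        continuous_on ({a..b} \<times> {0..1}) (\<lambda>(x, y). uy x y) \<and>
        (\<forall>x\<in>{a..b}. \<forall>y\<in>{0..1}.
           ((\<lambda>t. u t y) has_real_derivative ux x y) (at x within {a..b}) \<and>
           ((\<lambda>t. u x t) has_real_derivative uy x y) (at y within {0..1})))"

definition solves_poisson ::
  "real \<Rightarrow> real \<Rightarrow> (real \<Rightarrow> real \<Rightarrow> real) \<Rightarrow> (real \<Rightarrow> real \<Rightarrow> real) \<Rightarrow> bool" where
  "solves_poisson a b f u \<longleftrightarrow>
     (\<exists>ux uy uxx uyy.
        continuous_on ({a<..<b} \<times> {0<..<1}) (\<lambda>(x, y). uxx x y) \<and>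
        continuous_on ({a<..<b} \<times> {0<..<1}) (\<lambda>(x, y). uyy x y) \<and>
        (\<forall>x\<in>{a<..<b}. \<forall>y\<in>{0<..<1}.
           ((\<lambda>t. u t y) has_real_derivative ux x y) (at x) \<and>
           ((\<lambda>t. ux t y) has_real_derivative uxx x y) (at x) \<and>
           ((\<lambda>t. u x t) has_real_derivative uy x y) (at y) \<and>
           ((\<lambda>t. uy x t) has_real_derivative uyy x y) (at y) \<and>
           - (uxx x y + uyy x y) = f x y))"

definition solves_strip ::
  "real \<Rightarrow> bc \<Rightarrow> bc \<Rightarrow> real \<Rightarrow> real \<Rightarrow> (real \<Rightarrow> real \<Rightarrow> real) \<Rightarrow> (real \<Rightarrow> real \<Rightarrow> real) \<Rightarrow> bool" where
  "solves_strip q bb bt a b f u \<longleftrightarrow>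
     C1_rect a b u \<and> solves_poisson a b f u \<and>
     (\<forall>x\<in>{a<..<b}. bottom_op q bb (u x) = 0 \<and> top_op q bt (u x) = 0)"

definition exact_solution ::
  "real \<Rightarrow> real \<Rightarrow> nat \<Rightarrow> real \<Rightarrow> bc \<Rightarrow> bc \<Rightarrow> (real \<Rightarrow> real \<Rightarrow> real) \<Rightarrow> (real \<Rightarrow> real \<Rightarrow> real) \<Rightarrow> bool"
  where
  "exact_solution L d N q bb bt f u \<longleftrightarrow>
     solves_strip q bb bt (left_end L 1) (right_end L d N) f u \<and>
     (\<forall>y\<in>{0<..<1}. u (left_end L 1) y = 0 \<and> u (right_end L d N) y = 0)"

definition schwarz_iterates ::
  "schwarz_method \<Rightarrow> real \<Rightarrow> real \<Rightarrow> nat \<Rightarrow> real \<Rightarrow> bc \<Rightarrow> bc \<Rightarrow> (real \<Rightarrow> real \<Rightarrow> real) \<Rightarrow>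
     (nat \<Rightarrow> nat \<Rightarrow> real \<Rightarrow> real \<Rightarrow> real) \<Rightarrow> bool" where
  "schwarz_iterates m L d N q bb bt f U \<longleftrightarrow>
     (\<forall>j\<in>{1..N}. C1_rect (left_end L j) (right_end L d j) (U 0 j)) \<and>
     (\<forall>n. \<forall>j\<in>{1..N}.
        solves_strip q bb bt (left_end L j) (right_end L d j) f (U (Suc n) j) \<and>
        (\<forall>y\<in>{0<..<1}.
           left_cond m L d j (\<lambda>x. U (Suc n) j x y) = left_datum m L d j (\<lambda>i x. U n i x y) \<and>
           right_cond m L d N j (\<lambda>x. U (Suc n) j x y) = right_datum m L d N j (\<lambda>i x. U n i x y)))"

definition error_norm ::
  "real \<Rightarrow> real \<Rightarrow> nat \<Rightarrow> (real \<Rightarrow> real \<Rightarrow> real) \<Rightarrow> (nat \<Rightarrow> real \<Rightarrow> real \<Rightarrow> real) \<Rightarrow> real" where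
  "error_norm L d N u V =
     sqrt (\<Sum>j=1..N. LINT z:{left_end L j<..<right_end L d j} \<times> {0<..<1}|lborel.
             (V j (fst z) (snd z) - u (fst z) (snd z))\<^sup>2)"

text \<open>Worst asymptotic factor per step by which the \<open>L\<^sup>2\<close> error contracts, over all right-hand
  sides and all initial guesses.\<close>

definition L2_contraction_factor ::
  "schwarz_method \<Rightarrow> real \<Rightarrow> real \<Rightarrow> nat \<Rightarrow> real \<Rightarrow> bc \<Rightarrow> bc \<Rightarrow> ereal" where
  "L2_contraction_factor m L d N q bb bt =
     Sup {limsup (\<lambda>n. ereal (root n (error_norm L d N u (U n)))) | f u U.
            exact_solution L d N q bb bt f u \<and> schwarz_iterates m L d N q bb bt f U}"

text \<open>The argument \<open>lam\<close> is an eigenvalue of \<open>-\<phi>'' = \<lambda> \<phi>\<close>, so the local solutions behave like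
  \<open>exp (\<plusminus> sqrt \<lambda> x)\<close> and \<open>sqrt \<lambda>\<close> is what enters the exponents. With \<open>\<lambda>\<close> itself in the
  exponents the bounds below would fail: for PSM, \<open>N = 2\<close>, \<open>L = 1\<close>, \<open>\<delta> = 1/10\<close>, Dirichlet
  conditions and \<open>\<lambda> = pi\<^sup>2\<close> the factor is \<open>sinh pi / sinh (6 pi / 5) \<approx> 0.53\<close>, but
  \<open>(exp (2 \<lambda> \<delta>) + exp (\<lambda> L)) / (exp (2 \<lambda> \<delta> + \<lambda> L) + 1) \<approx> 0.14\<close>.\<close>

definition rho :: "real \<Rightarrow> real \<Rightarrow> real \<Rightarrow> real" where
  "rho L lam d =
     (exp (2 * sqrt lam * d) + exp (sqrt lam * L)) / (exp (2 * sqrt lam * d + sqrt lam * L) + 1)"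

definition is_mu1 :: "real \<Rightarrow> real \<Rightarrow> bool" where
  "is_mu1 q x \<longleftrightarrow> x \<in> {pi / 2<..<pi} \<and> q * sin x + x * cos x = 0"

definition is_tau1 :: "real \<Rightarrow> real \<Rightarrow> bool" where
  "is_tau1 q x \<longleftrightarrow> x \<in> {0<..<pi} \<and> 2 * q * x * cos x + (q\<^sup>2 - x\<^sup>2) * sin x = 0"

definition is_nu1 :: "real \<Rightarrow> real \<Rightarrow> bool" where
  "is_nu1 q x \<longleftrightarrow> x \<in> {0<..<pi / 2} \<and> x * sin x - q * cos x = 0"

definition mu1 :: "real \<Rightarrow> real" where "mu1 q = (THE x. is_mu1 q x)"
definition tau1 :: "real \<Rightarrow> real" where "tau1 q = (THE x. is_tau1 q x)"
definition nu1 :: "real \<Rightarrow> real" where "nu1 q = (THE x. is_nu1 q x)"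

definition rho_DD :: "real \<Rightarrow> real \<Rightarrow> real" where "rho_DD L d = rho L (pi\<^sup>2) d"
definition rho_DR :: "real \<Rightarrow> real \<Rightarrow> real \<Rightarrow> real" where "rho_DR L d q = rho L ((mu1 q)\<^sup>2) d"
definition rho_DN :: "real \<Rightarrow> real \<Rightarrow> real" where "rho_DN L d = rho L (pi\<^sup>2 / 4) d"
definition rho_RR :: "real \<Rightarrow> real \<Rightarrow> real \<Rightarrow> real" where "rho_RR L d q = rho L ((tau1 q)\<^sup>2) d"
definition rho_NR :: "real \<Rightarrow> real \<Rightarrow> real \<Rightarrow> real" where "rho_NR L d q = rho L ((nu1 q)\<^sup>2) d"
definition rho_NN :: "real \<Rightarrow> real \<Rightarrow> real" where "rho_NN L d = rho L 0 d"

end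

(*
  The local solutions are combinations of Ch c x = cosh (sqrt c x) and Sh c x, the odd solution
  with slope 1 at 0. With h half the length of a subdomain and h - t = 2 d its overlap, splitting
  a local solution into its even and odd part about the midpoint shows that, in the maximum norm,
  the interface data shrink in every step by at least the factor Ch c t / Ch c h, which is rho;
  the two end subdomains do no worse. This is
  a row sum bound for the iteration matrix, hence bounds its spectral radius, and it holds
  uniformly for all frequencies c above the smallest eigenvalue because rho decreases in c. The
  smallest eigenvalue is bounded from below by comparison with a Riccati equation. The Fourier
  coefficients of the two-dimensional error satisfy the one-dimensional error iteration, so
  Bessel's inequality for the initial data and Parseval's identity for the error transfer the
  bound to the L2 norm.
*)
theory Submission
  imports Defs "HOL-Real_Asymp.Real_Asymp"
begin

section \<open>The local problem on one subdomain\<close>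

text \<open>A bound on each spectral radius would not settle the L2 claim: infinitely many
  frequencies occur, and the constants between powers of a matrix and powers of its spectral radius
  could grow with the frequency. Therefore everything rests on the maximum norm of the interface
  data, in which a single step already contracts and no constant depends on the frequency. Why rho:
  for PSM the even part of a local solution shrinks exactly by \<open>Ch c t / Ch c h\<close> and
  the odd part by \<open>Sh c t / Sh c h\<close>, which is smaller. In OSM the derivative enters the
  outgoing datum with the sign opposite to the one in the imposed condition; the triangle inequality
  discards this gain, so that one bound serves PSM and OSM for every p > 0. The initial guess is
  only C1 and satisfies no equation; it enters through its interface data alone, and the decay of
  the error starts with the first iterate.\<close>

definition Ch :: "real \<Rightarrow> real \<Rightarrow> real" where
  "Ch c x = cosh (sqrt c * x)"

text \<open>At \<open>c = 0\<close> the quotient is replaced by its limit, so that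
  \<open>Ch c\<close> and \<open>Sh c\<close> remain a fundamental system; 0 is an eigenvalue for
  Neumann conditions on both sides, and the estimates must include it.\<close>

definition Sh :: "real \<Rightarrow> real \<Rightarrow> real" where
  "Sh c x = (if c = 0 then x else sinh (sqrt c * x) / sqrt c)"

lemma Ch_0 [simp]: "Ch c 0 = 1" and Sh_0 [simp]: "Sh c 0 = 0"
  by (auto simp: Ch_def Sh_def)

lemma Ch_minus [simp]: "Ch c (- x) = Ch c x" and Sh_minus [simp]: "Sh c (- x) = - Sh c x"
  by (auto simp: Ch_def Sh_def)

lemma Ch_pos [simp]: "Ch c x > 0"
  by (auto simp: Ch_def)

lemma Sh_pos: "c \<ge> 0 \<Longrightarrow> x > 0 \<Longrightarrow> Sh c x > 0"
  by (auto simp: Sh_def)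

lemma Sh_nonneg: "c \<ge> 0 \<Longrightarrow> x \<ge> 0 \<Longrightarrow> Sh c x \<ge> 0"
  using Sh_pos[of c x] by (cases "x = 0") auto

lemma Ch_add: "c \<ge> 0 \<Longrightarrow> Ch c (x + y) = Ch c x * Ch c y + c * Sh c x * Sh c y"
  by (auto simp: Ch_def Sh_def distrib_left cosh_add field_simps)

lemma Sh_add: "c \<ge> 0 \<Longrightarrow> Sh c (x + y) = Sh c x * Ch c y + Ch c x * Sh c y"
  by (auto simp: Ch_def Sh_def distrib_left sinh_add field_simps)

text \<open>The addition theorem at \<open>x + (- x) = 0\<close>; the left-hand side is the
  Wronskian of the fundamental system.\<close>

lemma Ch_Sh_square: "c \<ge> 0 \<Longrightarrow> (Ch c x)\<^sup>2 - c * (Sh c x)\<^sup>2 = 1"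
  using Ch_add[of c x "- x"] by (simp add: power2_eq_square)

lemma DERIV_Sh: "c \<ge> 0 \<Longrightarrow> (Sh c has_real_derivative Ch c x) (at x within A)"
proof (cases "c = 0")
  case True
  then have "Sh c = (\<lambda>x. x)" by (auto simp: Sh_def)
  then show ?thesis using True by (auto simp: Ch_def)
next
  case False
  assume "c \<ge> 0"
  then show ?thesis using False
    unfolding Sh_def[abs_def] Ch_def by (auto intro!: derivative_eq_intros simp: mult.assoc)
qed

lemma DERIV_Ch: "c \<ge> 0 \<Longrightarrow> (Ch c has_real_derivative c * Sh c x) (at x within A)"
proof -
  assume "c \<ge> 0"
  then have "c * Sh c x = sinh (sqrt c * x) * sqrt c"
    by (auto simp: Sh_def field_simps simp flip: real_sqrt_mult)
  then show ?thesis
    unfolding Ch_def[abs_def] by (auto intro!: derivative_eq_intros)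
qed

lemma DERIV_Ch_chain [derivative_intros]:
  "c \<ge> 0 \<Longrightarrow> (f has_real_derivative f') (at x within A) \<Longrightarrow>
    ((\<lambda>x. Ch c (f x)) has_real_derivative (c * Sh c (f x)) * f') (at x within A)"
  by (rule DERIV_chain2[OF DERIV_Ch])

lemma DERIV_Sh_chain [derivative_intros]:
  "c \<ge> 0 \<Longrightarrow> (f has_real_derivative f') (at x within A) \<Longrightarrow>
    ((\<lambda>x. Sh c (f x)) has_real_derivative Ch c (f x) * f') (at x within A)"
  by (rule DERIV_chain2[OF DERIV_Sh])

lemma continuous_on_Ch [continuous_intros]:
  "continuous_on A f \<Longrightarrow> continuous_on A (\<lambda>x. Ch c (f x))"
  unfolding Ch_def by (intro continuous_intros)

lemma continuous_on_Sh [continuous_intros]: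
  "c \<ge> 0 \<Longrightarrow> continuous_on A f \<Longrightarrow> continuous_on A (\<lambda>x. Sh c (f x))"
  unfolding Sh_def by (cases "c = 0") (auto intro!: continuous_intros)

lemma Sh_mono:
  assumes "c \<ge> 0" "x \<le> y"
  shows "Sh c x \<le> Sh c y"
proof (rule DERIV_nonneg_imp_nondecreasing[OF assms(2)])
  show "\<exists>s. (Sh c has_real_derivative s) (at z) \<and> 0 \<le> s" for z
    using DERIV_Sh[OF assms(1), of z UNIV] less_imp_le[OF Ch_pos[of c z]] by blast
qed

lemma Ch_mono: "c \<ge> 0 \<Longrightarrow> \<bar>x\<bar> \<le> \<bar>y\<bar> \<Longrightarrow> Ch c x \<le> Ch c y"
proof -
  assume c: "c \<ge> 0" and le: "\<bar>x\<bar> \<le> \<bar>y\<bar>"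
  have "cosh \<bar>sqrt c * x\<bar> \<le> cosh \<bar>sqrt c * y\<bar>"
    by (subst cosh_real_nonneg_le_iff) (auto simp: abs_mult le c mult_left_mono)
  then show ?thesis by (simp add: Ch_def)
qed

lemma abs_Sh_le: "c \<ge> 0 \<Longrightarrow> \<bar>x\<bar> \<le> y \<Longrightarrow> \<bar>Sh c x\<bar> \<le> Sh c y"
  using Sh_mono[of c x y] Sh_mono[of c "-x" y] by (auto simp: abs_le_iff)

text \<open>The difference of the two sides is \<open>Sh c (h - t)\<close>. For
  \<open>h > 0\<close>, division by \<open>Sh c h * Ch c h\<close> shows that from \<open>h\<close>
  to \<open>t\<close> the odd solution decays at least as much as the even one.\<close>

lemma Sh_Ch_cross_le:
  assumes "c \<ge> 0" "t \<le> h"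
  shows "Sh c t * Ch c h \<le> Ch c t * Sh c h"
  using Sh_nonneg[of c "h - t"] Sh_add[of c h "- t"] assms by (simp add: mult.commute)

section \<open>Solutions of w'' = c w together with their derivatives\<close>

definition ode_pair :: "real \<Rightarrow> real \<Rightarrow> real \<Rightarrow> (real \<Rightarrow> real) \<Rightarrow> (real \<Rightarrow> real) \<Rightarrow> bool" where
  "ode_pair c a b w w' \<longleftrightarrow> continuous_on {a..b} w' \<and>
     (\<forall>x\<in>{a..b}. (w has_real_derivative w' x) (at x within {a..b})) \<and>
     (\<forall>x\<in>{a<..<b}. (w' has_real_derivative c * w x) (at x))"

lemma solves_ode_iff: "solves_ode c a b w \<longleftrightarrow> (\<exists>w'. ode_pair c a b w w')"
  by (simp add: solves_ode_def ode_pair_def)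

lemma ode_pair_continuous: "ode_pair c a b w w' \<Longrightarrow> continuous_on {a..b} w"
  by (auto simp: ode_pair_def intro: DERIV_continuous_on)

lemma ode_pair_DERIV:
  assumes "ode_pair c a b w w'" "x \<in> {a<..<b}"
  shows "(w has_real_derivative w' x) (at x)"
proof -
  have "(w has_real_derivative w' x) (at x within {a..b})"
    using assms by (auto simp: ode_pair_def)
  then show ?thesis
    using assms(2) by (metis at_within_Icc_at greaterThanLessThan_iff)
qed

lemma ode_pair_sum:
  assumes "\<And>l. l \<in> I \<Longrightarrow> ode_pair c a b (w l) (w' l)"
  shows "ode_pair c a b (\<lambda>x. \<Sum>l\<in>I. g l * w l x) (\<lambda>x. \<Sum>l\<in>I. g l * w' l x)"
  unfolding ode_pair_def
proof (intro conjI ballI)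
  show "continuous_on {a..b} (\<lambda>x. \<Sum>l\<in>I. g l * w' l x)"
    using assms by (intro continuous_on_sum continuous_on_mult continuous_on_const) (auto simp: ode_pair_def)
  show "((\<lambda>x. \<Sum>l\<in>I. g l * w l x) has_real_derivative (\<Sum>l\<in>I. g l * w' l x)) (at x within {a..b})"
    if "x \<in> {a..b}" for x
    using assms that by (intro DERIV_sum DERIV_cmult) (auto simp: ode_pair_def)
  have "c * (\<Sum>l\<in>I. g l * w l x) = (\<Sum>l\<in>I. g l * (c * w l x))" for x
    by (simp add: sum_distrib_left mult.left_commute)
  then show "((\<lambda>x. \<Sum>l\<in>I. g l * w' l x) has_real_derivative c * (\<Sum>l\<in>I. g l * w l x)) (at x)"
    if "x \<in> {a<..<b}" for x
    using assms that by (simp only:) (intro DERIV_sum DERIV_cmult; auto simp: ode_pair_def)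
qed

lemma ode_pair_Ch_Sh:
  assumes "c \<ge> 0"
  shows "ode_pair c a b (\<lambda>x. A * Ch c (x - m) + B * Sh c (x - m))
    (\<lambda>x. A * (c * Sh c (x - m)) + B * Ch c (x - m))"
  unfolding ode_pair_def
proof (intro conjI ballI)
  show "continuous_on {a..b} (\<lambda>x. A * (c * Sh c (x - m)) + B * Ch c (x - m))"
    using assms by (intro continuous_intros)
  have 1: "((\<lambda>x. x - m) has_real_derivative 1) (at x within S)" for x S
    by (auto intro!: derivative_eq_intros)
  show "((\<lambda>x. A * Ch c (x - m) + B * Sh c (x - m)) has_real_derivative
      A * (c * Sh c (x - m)) + B * Ch c (x - m)) (at x within {a..b})" for x
    using DERIV_add[OF DERIV_cmult[OF DERIV_Ch_chain[OF assms 1]]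
        DERIV_cmult[OF DERIV_Sh_chain[OF assms 1]]] by simp
  show "((\<lambda>x. A * (c * Sh c (x - m)) + B * Ch c (x - m)) has_real_derivative
      c * (A * Ch c (x - m) + B * Sh c (x - m))) (at x)" for x
    using DERIV_add[OF DERIV_cmult[OF DERIV_cmult[OF DERIV_Sh_chain[OF assms 1]]]
        DERIV_cmult[OF DERIV_Ch_chain[OF assms 1]]]
    by (simp add: distrib_left mult_ac)
qed

text \<open>The functions \<open>p\<close> and \<open>r\<close> of the proof are Wronskians of
  \<open>w\<close> with \<open>Sh c (x - m)\<close> and \<open>Ch c (x - m)\<close>. They are
  constant because both factors solve the same equation, and so they are the coefficients. The
  centre \<open>m\<close> is free: the midpoint suits an interior subdomain, an end point suits a
  solution vanishing there.\<close>

lemma ode_pair_formula: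
  assumes ode: "ode_pair c a b w w'" and "c \<ge> 0" "a < b"
  obtains A B where "\<And>x. x \<in> {a..b} \<Longrightarrow> w x = A * Ch c (x - m) + B * Sh c (x - m)"
    and "\<And>x. x \<in> {a..b} \<Longrightarrow> w' x = A * (c * Sh c (x - m)) + B * Ch c (x - m)"
proof -
  note cw = ode_pair_continuous[OF ode]
  have cw': "continuous_on {a..b} w'" using ode by (simp add: ode_pair_def)
  define p where "p x = w x * Ch c (x - m) - w' x * Sh c (x - m)" for x
  define r where "r x = w' x * Ch c (x - m) - w x * (c * Sh c (x - m))" for x
  have dw: "(w has_real_derivative w' x) (at x)" if "x \<in> {a<..<b}" for x
    by (rule ode_pair_DERIV[OF ode that])
  have dw': "(w' has_real_derivative c * w x) (at x)" if "x \<in> {a<..<b}" for x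
    using ode that by (simp add: ode_pair_def)
  have p: "p x = p a" if "x \<in> {a..b}" for x
  proof (rule DERIV_isconst2[OF \<open>a < b\<close>, of p])
    show "continuous_on {a..b} p"
      unfolding p_def using cw cw' \<open>c \<ge> 0\<close> by (intro continuous_intros) auto
    show "(p has_real_derivative 0) (at y)" if "a < y" "y < b" for y
      unfolding p_def using that dw[of y] dw'[of y] \<open>c \<ge> 0\<close>
      by (auto intro!: derivative_eq_intros simp: algebra_simps)
  qed (use that in auto)
  have r: "r x = r a" if "x \<in> {a..b}" for x
  proof (rule DERIV_isconst2[OF \<open>a < b\<close>, of r])
    show "continuous_on {a..b} r"
      unfolding r_def using cw cw' \<open>c \<ge> 0\<close> by (intro continuous_intros) auto
    show "(r has_real_derivative 0) (at y)" if "a < y" "y < b" for y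
      unfolding r_def using that dw[of y] dw'[of y] \<open>c \<ge> 0\<close>
      by (auto intro!: derivative_eq_intros simp: algebra_simps)
  qed (use that in auto)
  have w: "w x = p x * Ch c (x - m) + r x * Sh c (x - m)" for x
  proof -
    have "p x * Ch c (x - m) + r x * Sh c (x - m) = w x * ((Ch c (x - m))\<^sup>2 - c * (Sh c (x - m))\<^sup>2)"
      unfolding p_def r_def by (simp add: algebra_simps power2_eq_square)
    then show ?thesis using Ch_Sh_square[OF \<open>c \<ge> 0\<close>] by simp
  qed
  have w': "w' x = p x * (c * Sh c (x - m)) + r x * Ch c (x - m)" for x
  proof -
    have "p x * (c * Sh c (x - m)) + r x * Ch c (x - m) = w' x * ((Ch c (x - m))\<^sup>2 - c * (Sh c (x - m))\<^sup>2)"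
      unfolding p_def r_def by (simp add: algebra_simps power2_eq_square)
    then show ?thesis using Ch_Sh_square[OF \<open>c \<ge> 0\<close>] by simp
  qed
  show ?thesis
  proof (rule that)
    show "w x = p a * Ch c (x - m) + r a * Sh c (x - m)" if "x \<in> {a..b}" for x
      using w[of x] p[OF that] r[OF that] by simp
    show "w' x = p a * (c * Sh c (x - m)) + r a * Ch c (x - m)" if "x \<in> {a..b}" for x
      using w'[of x] p[OF that] r[OF that] by simp
  qed
qed

lemma deriv_on_eq:
  assumes "(w has_real_derivative w') (at x within {a..b})" "a < b" "x \<in> {a..b}"
  shows "deriv_on a b w x = w'"
  unfolding deriv_on_def
  by (rule vector_derivative_within_closed_interval)
     (use assms in \<open>auto simp: has_real_derivative_iff_has_vector_derivative\<close>)

text \<open>Coefficients P and K of the common form \<open>P w - K w'\<close> (left) and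
  \<open>P w + K w'\<close> (right) of the transmission operators. The estimates depend only on P >
  0 and K >= 0 and so treat both methods at once.\<close>

fun trans_val :: "schwarz_method \<Rightarrow> real" where
  "trans_val PSM = 1" | "trans_val (OSM p) = p"

fun trans_der :: "schwarz_method \<Rightarrow> real" where
  "trans_der PSM = 0" | "trans_der (OSM p) = 1"

lemma trans_der_nonneg: "trans_der m \<ge> 0"
  by (cases m) auto

lemma trans_eq:
  assumes "(w has_real_derivative w') (at x within {a..b})" "a < b" "x \<in> {a..b}"
  shows "trans_left m a b w x = trans_val m * w x - trans_der m * w'"
    and "trans_right m a b w x = trans_val m * w x + trans_der m * w'"
  using deriv_on_eq[OF assms] by (cases m; simp)+

text \<open>Pulling \<open>exp (sqrt c * (L / 2 + d))\<close> out of numerator and denominator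
  leaves the two values of cosh. Half the length of a subdomain is \<open>L / 2 + d\<close>, and
  \<open>L / 2 - d\<close> is the distance from its midpoint to the points where its neighbours
  end.\<close>

lemma rho_eq: "rho L c d = Ch c (L / 2 - d) / Ch c (L / 2 + d)"
proof -
  define s where "s = sqrt c"
  have e: "exp (2 * s * d) + exp (s * L) = exp (s * (L/2 + d)) * (2 * cosh (s * (L / 2 - d)))"
    by (simp add: cosh_field_def distrib_left exp_add[symmetric])
      (simp add: algebra_simps exp_add[symmetric])
  have f: "exp (2 * s * d + s * L) + 1 = exp (s * (L/2 + d)) * (2 * cosh (s * (L / 2 + d)))"
    by (simp add: cosh_field_def distrib_left exp_add[symmetric])
      (simp add: algebra_simps exp_add[symmetric])
  show ?thesis
    unfolding rho_def Ch_def s_def[symmetric] e f by simp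
qed

lemma rho_pos: "rho L c d > 0"
  by (simp add: rho_eq)

section \<open>Decay of the data across one subdomain\<close>

lemma abs_ratio_le:
  fixes x y :: real
  assumes "\<bar>x\<bar> \<le> r * y" "y > 0"
  shows "\<bar>z * x\<bar> \<le> r * \<bar>z * y\<bar>"
  using mult_left_mono[OF assms(1), of "\<bar>z\<bar>"] assms(2) by (simp add: abs_mult mult_ac)

text \<open>With the origin at the midpoint, \<open>E\<close> and \<open>F\<close> are what the
  imposed operators make of the even and the odd solution at the ends, \<open>e\<close> and
  \<open>f\<close> what the neighbours read off at distance \<open>t\<close> from the midpoint.
  Everything reduces to comparing \<open>e\<close> with \<open>E\<close> and \<open>f\<close> with
  \<open>F\<close>. The pointwise bound holds because \<open>E\<close> and \<open>F\<close> dominate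
  \<open>P\<close> times the two solutions; its factor 2 is harmless, as constants vanish under the
  n-th root.\<close>

lemma interior_estimate:
  assumes ode: "ode_pair c a b w w'" and c: "c \<ge> 0" and h: "0 \<le> t" "t < h" "b = a + 2 * h"
    and P: "P > 0" "K \<ge> 0"
    and l: "\<bar>P * w a - K * w' a\<bar> \<le> M" and r: "\<bar>P * w b + K * w' b\<bar> \<le> M"
  shows "\<bar>P * w (b - (h - t)) - K * w' (b - (h - t))\<bar> \<le> Ch c t / Ch c h * M"
    and "\<bar>P * w (a + (h - t)) + K * w' (a + (h - t))\<bar> \<le> Ch c t / Ch c h * M"
    and "x \<in> {a..b} \<Longrightarrow> \<bar>w x\<bar> \<le> 2 * M / P"
proof -
  have "a < b" using h by simp
  define \<rho> where "\<rho> = Ch c t / Ch c h"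
  obtain A B where w: "\<And>x. x \<in> {a..b} \<Longrightarrow> w x = A * Ch c (x - (a + h)) + B * Sh c (x - (a + h))"
    and w': "\<And>x. x \<in> {a..b} \<Longrightarrow> w' x = A * (c * Sh c (x - (a + h))) + B * Ch c (x - (a + h))"
    using ode_pair_formula[OF ode c \<open>a < b\<close>, of "a + h"] by metis
  have Sh: "Sh c h > 0" "Sh c t \<ge> 0" using Sh_pos Sh_nonneg c h by auto
  have \<rho>: "\<rho> * Ch c h = Ch c t" "Sh c t \<le> \<rho> * Sh c h" "\<rho> > 0"
    using Sh_Ch_cross_le[OF c less_imp_le[OF h(2)]] by (auto simp: \<rho>_def pos_le_divide_eq less_imp_neq[OF Ch_pos, symmetric])
  define E where "E = P * Ch c h + K * (c * Sh c h)"
  define F where "F = P * Sh c h + K * Ch c h"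
  define e where "e = P * Ch c t - K * (c * Sh c t)"
  define f where "f = P * Sh c t - K * Ch c t"
  have "E > 0" "F > 0" unfolding E_def F_def using P c Sh less_imp_le[OF Ch_pos] by (auto intro!: add_pos_nonneg)
  have PE: "P * Ch c h \<le> E" and PF: "P * Sh c h \<le> F"
    unfolding E_def F_def using P c Sh less_imp_le[OF Ch_pos] by auto
  \<comment> \<open>Once the two terms are added in absolute value, each is at most \<rho> times its
    counterpart in \<open>E\<close>: the \<open>Ch\<close> term exactly by the choice of \<rho>, the
    \<open>Sh\<close> term by \<open>Sh_Ch_cross_le\<close>.\<close>
  have "\<bar>e\<bar> \<le> P * Ch c t + K * (c * Sh c t)"
    unfolding e_def using P c Sh less_imp_le[OF Ch_pos[of c t]] by (auto simp: abs_le_iff)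
  also have "\<dots> \<le> \<rho> * E"
    using mult_left_mono[OF \<rho>(2), of "K * c"] P c by (simp add: E_def \<rho>(1)[symmetric] algebra_simps)
  finally have e: "\<bar>e\<bar> \<le> \<rho> * E" .
  have "\<bar>f\<bar> \<le> P * Sh c t + K * Ch c t"
    unfolding f_def using P c Sh less_imp_le[OF Ch_pos[of c t]] by (auto simp: abs_le_iff)
  also have "\<dots> \<le> \<rho> * F"
    using mult_left_mono[OF \<rho>(2), of P] P c by (simp add: F_def \<rho>(1)[symmetric] algebra_simps)
  finally have f: "\<bar>f\<bar> \<le> \<rho> * F" .
  have "w a = A * Ch c h - B * Sh c h" "w' a = B * Ch c h - A * (c * Sh c h)"
    using w[of a] w'[of a] h by simp_all
  note wa = this
  have Pa: "P * w a - K * w' a = A * E - B * F"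
    unfolding E_def F_def wa by (simp add: algebra_simps)
  have "w b = A * Ch c h + B * Sh c h" "w' b = A * (c * Sh c h) + B * Ch c h"
    using w[of b] w'[of b] h by simp_all
  note wb = this
  have Pb: "P * w b + K * w' b = A * E + B * F"
    unfolding E_def F_def wb by (simp add: algebra_simps)
  \<comment> \<open>\<open>|X| + |Y|\<close> is the larger one of \<open>|X - Y|\<close> and
    \<open>|X + Y|\<close>, so splitting into parts loses nothing against the maximum of the two
    data.\<close>
  from l r have AB: "\<bar>A * E\<bar> + \<bar>B * F\<bar> \<le> M" unfolding Pa Pb by linarith
  have "P * w (b - (h - t)) - K * w' (b - (h - t)) = A * e + B * f"
  proof -
    have "b - (h - t) - (a + h) = t" "b - (h - t) \<in> {a..b}" using h by auto
    then show ?thesis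
      by (simp only: w w' e_def f_def) (simp add: algebra_simps)
  qed
  moreover have "P * w (a + (h - t)) + K * w' (a + (h - t)) = A * e - B * f"
  proof -
    have "a + (h - t) - (a + h) = - t" "a + (h - t) \<in> {a..b}" using h by auto
    then show ?thesis
      by (simp only: w w' e_def f_def) (simp add: algebra_simps)
  qed
  moreover have "\<bar>A * e\<bar> + \<bar>B * f\<bar> \<le> \<rho> * \<bar>A * E\<bar> + \<rho> * \<bar>B * F\<bar>"
    using abs_ratio_le[OF e \<open>E > 0\<close>, of A] abs_ratio_le[OF f \<open>F > 0\<close>, of B] by simp
  moreover have "\<rho> * \<bar>A * E\<bar> + \<rho> * \<bar>B * F\<bar> \<le> \<rho> * M"
    using AB \<rho>(3) by (simp add: distrib_left[symmetric])
  ultimately show "\<bar>P * w (b - (h - t)) - K * w' (b - (h - t))\<bar> \<le> Ch c t / Ch c h * M"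
    and "\<bar>P * w (a + (h - t)) + K * w' (a + (h - t))\<bar> \<le> Ch c t / Ch c h * M"
    unfolding \<rho>_def[symmetric] by linarith+
  show "\<bar>w x\<bar> \<le> 2 * M / P" if x: "x \<in> {a..b}"
  proof -
    have "\<bar>x - (a + h)\<bar> \<le> h" using x h by auto
    then have "Ch c (x - (a + h)) \<le> Ch c h" "\<bar>Sh c (x - (a + h))\<bar> \<le> Sh c h"
      using Ch_mono[OF c, of "x - (a + h)" h] abs_Sh_le[OF c] by auto
    then have 1: "P * \<bar>Ch c (x - (a + h))\<bar> \<le> E" "P * \<bar>Sh c (x - (a + h))\<bar> \<le> F"
      using PE PF P by (smt (verit) Ch_pos mult_left_mono)+
    have "P * \<bar>w x\<bar> \<le> \<bar>A\<bar> * (P * \<bar>Ch c (x - (a + h))\<bar>) + \<bar>B\<bar> * (P * \<bar>Sh c (x - (a + h))\<bar>)"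
      unfolding w[OF x] using P abs_triangle_ineq[of "A * Ch c (x - (a + h))" "B * Sh c (x - (a + h))"]
      by (simp add: abs_mult distrib_left[symmetric] mult_ac)
    also have "\<dots> \<le> \<bar>A\<bar> * E + \<bar>B\<bar> * F"
      using 1 by (intro add_mono mult_left_mono) auto
    also have "\<dots> = \<bar>A * E\<bar> + \<bar>B * F\<bar>" using \<open>E > 0\<close> \<open>F > 0\<close> by (simp add: abs_mult)
    also have "\<dots> \<le> 2 * M" using AB by linarith
    finally show ?thesis using P by (simp add: field_simps)
  qed
qed

text \<open>The homogeneous condition leaves a multiple of \<open>Sh c (x - a)\<close>, so an
  expansion about \<open>a\<close> replaces the splitting about the midpoint. The neighbour reads at
  distance \<open>t + h\<close> from \<open>a\<close> in a subdomain of length \<open>h + h\<close>,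
  and the quotients of \<open>Sh\<close> and of \<open>Ch\<close> at these two distances are both at
  most \<rho>.\<close>

lemma left_end_estimate:
  assumes ode: "ode_pair c a b w w'" and c: "c \<ge> 0" and h: "0 \<le> t" "t < h" "b = a + 2 * h"
    and P: "P > 0" "K \<ge> 0"
    and l: "w a = 0" and r: "\<bar>P * w b + K * w' b\<bar> \<le> M"
  shows "\<bar>P * w (b - (h - t)) - K * w' (b - (h - t))\<bar> \<le> Ch c t / Ch c h * M"
    and "x \<in> {a..b} \<Longrightarrow> \<bar>w x\<bar> \<le> 2 * M / P"
proof -
  have "a < b" using h by simp
  define \<rho> where "\<rho> = Ch c t / Ch c h"
  obtain A B where w: "\<And>x. x \<in> {a..b} \<Longrightarrow> w x = A * Ch c (x - a) + B * Sh c (x - a)"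
    and w': "\<And>x. x \<in> {a..b} \<Longrightarrow> w' x = A * (c * Sh c (x - a)) + B * Ch c (x - a)"
    using ode_pair_formula[OF ode c \<open>a < b\<close>, of a] by metis
  have A: "A = 0" using w[of a] l \<open>a < b\<close> by simp
  have Sh: "Sh c h > 0" "Sh c t \<ge> 0" using Sh_pos Sh_nonneg c h by auto
  have \<rho>: "\<rho> > 0" by (simp add: \<rho>_def)
  have cr: "Sh c t * Ch c h \<le> Ch c t * Sh c h"
    using Sh_Ch_cross_le[OF c less_imp_le[OF h(2)]] .
  \<comment> \<open>By the addition theorem the difference of the two sides is \<open>Ch c h\<close>
    times the difference in \<open>cr\<close>; in the analogous claim for \<open>Ch\<close> below,
    the factor is \<open>c * Sh c h\<close>.\<close>
  have "Sh c (t + h) * Ch c h \<le> Ch c t * Sh c (h + h)"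
    using mult_right_mono[OF cr less_imp_le[OF Ch_pos[of c h]]] unfolding Sh_add[OF c]
    by (simp only: ring_distribs mult_ac)
  then have s: "Sh c (t + h) \<le> \<rho> * Sh c (h + h)"
    by (simp add: \<rho>_def pos_le_divide_eq)
  have "Ch c (t + h) * Ch c h \<le> Ch c t * Ch c (h + h)"
  proof -
    have "c * Sh c h * (Sh c t * Ch c h) \<le> c * Sh c h * (Ch c t * Sh c h)"
      using cr c Sh by (intro mult_left_mono) auto
    then show ?thesis
      unfolding Ch_add[OF c] by (simp only: ring_distribs mult_ac)
  qed
  then have k: "Ch c (t + h) \<le> \<rho> * Ch c (h + h)"
    by (simp add: \<rho>_def pos_le_divide_eq)
  have Sh2: "Sh c (h + h) > 0" "Sh c (t + h) \<ge> 0" using Sh_pos Sh_nonneg c h by auto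
  define F where "F = P * Sh c (h + h) + K * Ch c (h + h)"
  define f where "f = P * Sh c (t + h) - K * Ch c (t + h)"
  have "F > 0" unfolding F_def using P c Sh2 less_imp_le[OF Ch_pos] by (auto intro!: add_pos_nonneg)
  have PF: "P * Sh c (h + h) \<le> F"
    unfolding F_def using P less_imp_le[OF Ch_pos] by auto
  have "\<bar>f\<bar> \<le> P * Sh c (t + h) + K * Ch c (t + h)"
    unfolding f_def using P c Sh2 less_imp_le[OF Ch_pos[of c "t + h"]] by (auto simp: abs_le_iff)
  also have "\<dots> \<le> P * (\<rho> * Sh c (h + h)) + K * (\<rho> * Ch c (h + h))"
    using P by (intro add_mono mult_left_mono s k) auto
  also have "\<dots> = \<rho> * F" by (simp add: F_def algebra_simps)
  finally have f: "\<bar>f\<bar> \<le> \<rho> * F" .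
  have "P * w b + K * w' b = B * F"
  proof -
    have "b - a = h + h" using h by simp
    then show ?thesis
      using w[of b] w'[of b] \<open>a < b\<close> A by (simp add: F_def algebra_simps)
  qed
  with r have B: "\<bar>B * F\<bar> \<le> M" by simp
  have "P * w (b - (h - t)) - K * w' (b - (h - t)) = B * f"
  proof -
    have "b - (h - t) - a = t + h" "b - (h - t) \<in> {a..b}" using h by auto
    then show ?thesis
      using w[of "b - (h - t)"] w'[of "b - (h - t)"] A by (simp add: f_def algebra_simps)
  qed
  then have "\<bar>P * w (b - (h - t)) - K * w' (b - (h - t))\<bar> \<le> \<rho> * \<bar>B * F\<bar>"
    using abs_ratio_le[OF f \<open>F > 0\<close>, of B] by simp
  also have "\<dots> \<le> \<rho> * M" using B \<rho> by simp
  finally show "\<bar>P * w (b - (h - t)) - K * w' (b - (h - t))\<bar> \<le> Ch c t / Ch c h * M"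
    unfolding \<rho>_def .
  show "\<bar>w x\<bar> \<le> 2 * M / P" if x: "x \<in> {a..b}"
  proof -
    have "\<bar>x - a\<bar> \<le> h + h" using x h by auto
    then have "P * \<bar>Sh c (x - a)\<bar> \<le> F"
      using PF P abs_Sh_le[OF c] by (smt (verit) mult_left_mono)
    then have "\<bar>B\<bar> * (P * \<bar>Sh c (x - a)\<bar>) \<le> \<bar>B\<bar> * F" by (intro mult_left_mono) auto
    also have "\<dots> = \<bar>B * F\<bar>" using \<open>F > 0\<close> by (simp add: abs_mult)
    also have "\<dots> \<le> 2 * M" using B by linarith
    finally show ?thesis using P A unfolding w[OF x] by (simp add: abs_mult field_simps)
  qed
qed

lemma ode_pair_reflect:
  assumes "ode_pair c a b w w'"
  shows "ode_pair c (- b) (- a) (\<lambda>x. w (- x)) (\<lambda>x. - w' (- x))"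
proof -
  have im: "uminus ` {- b..- a} = {a..b}" by simp
  have "((\<lambda>x. w (- x)) has_real_derivative - w' (- x)) (at x within {- b..- a})"
    if "x \<in> {- b..- a}" for x
  proof -
    have "(w has_real_derivative w' (- x)) (at (- x) within uminus ` {- b..- a})"
      using assms that unfolding ode_pair_def im by auto
    moreover have "(uminus has_real_derivative - 1) (at x within {- b..- a})"
      using DERIV_minus[OF DERIV_ident] by blast
    ultimately show ?thesis
      using DERIV_image_chain[of w "w' (- x)" uminus x "{- b..- a}" "-1"] by (simp add: o_def)
  qed
  moreover have "((\<lambda>x. - w' (- x)) has_real_derivative c * w (- x)) (at x)"
    if "x \<in> {- b<..<- a}" for x
  proof -
    have "(w' has_real_derivative c * w (- x)) (at (- x))"
      using assms that unfolding ode_pair_def by auto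
    moreover have "(uminus has_real_derivative - 1) (at x)"
      using DERIV_minus[OF DERIV_ident] by blast
    ultimately have "((\<lambda>x. w' (- x)) has_real_derivative c * w (- x) * - 1) (at x)"
      using DERIV_chain2[of w' "c * w (- x)" uminus x "-1" UNIV] by blast
    from DERIV_minus[OF this] show ?thesis by simp
  qed
  moreover have "continuous_on {- b..- a} (\<lambda>x. - w' (- x))"
    using assms unfolding ode_pair_def
    by (intro continuous_intros continuous_on_compose2[of "{a..b}" w' _ uminus]) auto
  ultimately show ?thesis unfolding ode_pair_def by blast
qed

text \<open>Mirror image of the left end: under reflection the derivative changes sign, which
  exchanges the left and the right operator.\<close>

lemma right_end_estimate:
  assumes ode: "ode_pair c a b w w'" and c: "c \<ge> 0" and h: "0 \<le> t" "t < h" "b = a + 2 * h"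
    and P: "P > 0" "K \<ge> 0"
    and l: "\<bar>P * w a - K * w' a\<bar> \<le> M" and r: "w b = 0"
  shows "\<bar>P * w (a + (h - t)) + K * w' (a + (h - t))\<bar> \<le> Ch c t / Ch c h * M"
    and "x \<in> {a..b} \<Longrightarrow> \<bar>w x\<bar> \<le> 2 * M / P"
proof -
  have 1: "- a = - b + 2 * h" using h by simp
  have 2: "\<bar>P * w (- (- a)) + K * (- w' (- (- a)))\<bar> \<le> M" "w (- (- b)) = 0"
    using l r by simp_all
  note est = left_end_estimate[OF ode_pair_reflect[OF ode] c h(1,2) 1 P 2(2,1)]
  have 3: "- (- a - (h - t)) = a + (h - t)" by simp
  show "\<bar>P * w (a + (h - t)) + K * w' (a + (h - t))\<bar> \<le> Ch c t / Ch c h * M"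
    using est(1) unfolding 3 by simp
  show "\<bar>w x\<bar> \<le> 2 * M / P" if "x \<in> {a..b}"
    using est(2)[of "- x"] that by simp
qed

section \<open>Roots, monotonicity and eigenvalue bounds\<close>

lemma cosh_quotient_strict_antimono:
  fixes s t h :: real
  assumes "0 \<le> t" "t < h" "0 \<le> s" "s < s'"
  shows "cosh (s' * t) / cosh (s' * h) < cosh (s * t) / cosh (s * h)"
proof (rule DERIV_neg_imp_decreasing_open[OF \<open>s < s'\<close>])
  fix x assume x: "s < x" "x < s'"
  \<comment> \<open>The derivative of the quotient has the sign of
    \<open>t tanh (x t) - h tanh (x h)\<close>; the positive sinh gives
    \<open>tanh (x t) < tanh (x h)\<close> in a form without division.\<close>
  have "0 < sinh (x * h - x * t)" using assms x by simp
  then have "sinh (x * t) * cosh (x * h) < sinh (x * h) * cosh (x * t)"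
    by (simp add: sinh_diff mult.commute)
  then have "t * (sinh (x * t) * cosh (x * h)) \<le> t * (sinh (x * h) * cosh (x * t))"
    using assms by (intro mult_left_mono) auto
  also have "\<dots> < h * (sinh (x * h) * cosh (x * t))"
    using assms x by (intro mult_strict_right_mono) auto
  finally have "sinh (x * t) * t * cosh (x * h) - cosh (x * t) * (sinh (x * h) * h) < 0"
    by (simp add: mult_ac)
  then have "(sinh (x * t) * t * cosh (x * h) - cosh (x * t) * (sinh (x * h) * h))
      / (cosh (x * h) * cosh (x * h)) < 0"
    by (intro divide_neg_pos) auto
  moreover have "((\<lambda>x. cosh (x * t) / cosh (x * h)) has_real_derivative
     (sinh (x * t) * t * cosh (x * h) - cosh (x * t) * (sinh (x * h) * h))
      / (cosh (x * h) * cosh (x * h))) (at x)"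
    by (auto intro!: derivative_eq_intros)
  ultimately show "\<exists>y. ((\<lambda>x. cosh (x * t) / cosh (x * h)) has_real_derivative y) (at x) \<and> y < 0"
    by blast
qed (auto intro!: continuous_intros)

lemma rho_strict_antimono:
  assumes "L > 0" "d > 0" "0 \<le> c" "c < c'"
  shows "rho L c' d < rho L c d"
proof -
  \<comment> \<open>The ordering is claimed for all positive \<open>d\<close>, also beyond
    \<open>L / 2\<close>, where \<open>L / 2 - d\<close> is negative; cosh is even, and
    \<open>|L / 2 - d| < L / 2 + d\<close> still holds.\<close>
  have e: "cosh (s * (L / 2 - d)) = cosh (s * \<bar>L / 2 - d\<bar>)" for s
    using cosh_minus[of "s * (L / 2 - d)"] by (cases "L / 2 - d \<ge> 0") (auto simp: algebra_simps)
  show ?thesis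
    unfolding rho_eq Ch_def e
    using cosh_quotient_strict_antimono[of "\<bar>L / 2 - d\<bar>" "L / 2 + d" "sqrt c" "sqrt c'"] assms
    by auto
qed

lemma rho_antimono:
  "L > 0 \<Longrightarrow> d > 0 \<Longrightarrow> 0 \<le> c \<Longrightarrow> c \<le> c' \<Longrightarrow> rho L c' d \<le> rho L c d"
  using rho_strict_antimono[of L d c c'] by (cases "c = c'") auto

section \<open>The roots mu1, nu1 and tau1\<close>

lemma ex1_root:
  fixes f :: "real \<Rightarrow> real"
  assumes "a < b" and cont: "continuous_on {a..b} f"
    and der: "\<And>x. a < x \<Longrightarrow> x < b \<Longrightarrow> (f has_real_derivative f' x) (at x)"
    and pos: "\<And>x. a < x \<Longrightarrow> x < b \<Longrightarrow> f' x > 0"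
    and "f a < 0" "f b > 0"
  shows "\<exists>!x. x \<in> {a<..<b} \<and> f x = 0"
proof -
  obtain x where x: "a \<le> x" "x \<le> b" "f x = 0"
    using IVT'[of f a 0 b] assms by auto
  have mono: "f y < f z" if "a \<le> y" "y < z" "z \<le> b" for y z
    using that der pos
    by (intro DERIV_pos_imp_increasing_open[of y z f]) (force intro: continuous_on_subset[OF cont])+
  have "x \<noteq> a" "x \<noteq> b" using x assms by auto
  with x show ?thesis
    using mono by (intro ex1I[of _ x]) (auto, smt (verit))
qed

text \<open>The sign is reversed to obtain an increasing function, as \<open>ex1_root\<close>
  requires. The same monotonicity tells in \<open>eigenvalue_DR\<close> on which side of the root an
  angle lies.\<close>

lemma DR_function:
  assumes "q > 0"
  shows "continuous_on A (\<lambda>x. - (q * sin x + x * cos x))"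
    and "((\<lambda>x. - (q * sin x + x * cos x)) has_real_derivative x * sin x - (q + 1) * cos x) (at x)"
    and "pi / 2 < x \<Longrightarrow> x < pi \<Longrightarrow> x * sin x - (q + 1) * cos x > 0"
proof -
  show "continuous_on A (\<lambda>x. - (q * sin x + x * cos x))"
    by (intro continuous_intros)
  show "((\<lambda>x. - (q * sin x + x * cos x)) has_real_derivative x * sin x - (q + 1) * cos x) (at x)"
    by (auto intro!: derivative_eq_intros simp: algebra_simps)
  assume x: "pi / 2 < x" "x < pi"
  have "sin x > 0" using x by (intro sin_gt_zero) auto
  moreover have "cos x < 0"
    using x cos_gt_zero_pi[of "pi - x"] by (simp add: cos_diff)
  ultimately have "x * sin x > 0" "(q + 1) * cos x < 0" using x assms
    by (auto simp: mult_pos_neg intro!: mult_pos_pos less_trans[OF _ x(1)])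
  then show "x * sin x - (q + 1) * cos x > 0" by linarith
qed

lemma ex1_mu1:
  assumes "q > 0"
  shows "\<exists>!x. is_mu1 q x"
proof -
  have "\<exists>!x. x \<in> {pi / 2<..<pi} \<and> - (q * sin x + x * cos x) = 0"
    by (rule ex1_root[OF _ DR_function(1,2,3)[OF assms]]) (use assms in auto)
  then show ?thesis by (simp only: is_mu1_def neg_equal_0_iff_equal)
qed

lemma ex1_nu1: "q > 0 \<Longrightarrow> \<exists>!x. is_nu1 q x"
  unfolding is_nu1_def
proof (rule ex1_root)
  assume q: "q > 0"
  show "((\<lambda>x. x * sin x - q * cos x) has_real_derivative sin x + x * cos x + q * sin x) (at x)" for x
    by (auto intro!: derivative_eq_intros simp: algebra_simps)
  show "sin x + x * cos x + q * sin x > 0" if "0 < x" "x < pi / 2" for x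
    using that q sin_gt_zero[of x] cos_gt_zero[of x] by (auto intro!: add_pos_pos)
qed (auto intro!: continuous_intros)

text \<open>With \<open>x = 2 t\<close> the equation factors into
  \<open>2 (q cos t - x sin t) (q sin t + x cos t)\<close>, the conditions for eigenfunctions
  symmetric and antisymmetric about \<open>y = 1/2\<close>. The second factor is positive here, so
  the root belongs to a symmetric eigenfunction. That is a Neumann-Robin problem on half the
  interval, and rescaling to length 1 turns \<open>q\<close> into \<open>q / 2\<close>.\<close>

lemma is_tau1_iff: "q > 0 \<Longrightarrow> is_tau1 q x \<longleftrightarrow> is_nu1 (q / 2) (x / 2)"
proof (cases "0 < x \<and> x < pi")
  case True
  assume q: "q > 0"
  define t where "t = x / 2"
  have t: "sin t > 0" "cos t > 0" and x: "x = 2 * t"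
    using True sin_gt_zero[of t] cos_gt_zero[of t] by (auto simp: t_def)
  have "2 * q * x * cos x + (q\<^sup>2 - x\<^sup>2) * sin x = 2 * (q * cos t - x * sin t) * (q * sin t + x * cos t)"
    unfolding x cos_double sin_double by (simp add: algebra_simps power2_eq_square)
  moreover have "q * sin t + x * cos t > 0"
    using t True q by (auto intro!: add_pos_pos)
  ultimately show ?thesis using True
    by (auto simp: is_tau1_def is_nu1_def t_def[symmetric] x)
next
  case False
  then show ?thesis by (auto simp: is_tau1_def is_nu1_def)
qed

lemma ex1_tau1:
  assumes "q > 0"
  shows "\<exists>!x. is_tau1 q x"
proof -
  obtain t where t: "is_nu1 (q / 2) t" "\<And>s. is_nu1 (q / 2) s \<Longrightarrow> s = t"
    using ex1_nu1[of "q / 2"] assms by auto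
  show ?thesis
  proof (rule ex1I)
    show "is_tau1 q (2 * t)" using t(1) assms by (simp add: is_tau1_iff)
    fix x assume "is_tau1 q x"
    then have "is_nu1 (q / 2) (x / 2)" using assms by (simp add: is_tau1_iff)
    from t(2)[OF this] show "x = 2 * t" by simp
  qed
qed

lemma mu1: "q > 0 \<Longrightarrow> is_mu1 q (mu1 q)"
  unfolding mu1_def by (rule theI'[OF ex1_mu1])

lemma nu1: "q > 0 \<Longrightarrow> is_nu1 q (nu1 q)"
  unfolding nu1_def by (rule theI'[OF ex1_nu1])

lemma tau1: "q > 0 \<Longrightarrow> is_tau1 q (tau1 q)"
  unfolding tau1_def by (rule theI'[OF ex1_tau1])

text \<open>With \<open>z y = - \<theta> * tan (\<theta> * y - \<eta>)\<close>, a solution of the Riccati equation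
  \<open>z' + z\<^sup>2 = - \<theta>\<^sup>2\<close>, the derivative of \<open>\<phi> \<phi>' - z \<phi>\<^sup>2\<close> is
  \<open>(\<phi>' - z \<phi>)\<^sup>2 + (\<theta>\<^sup>2 - e) \<phi>\<^sup>2\<close>.\<close>

lemma eigenvalue_ge_Riccati:
  assumes ode: "ode_pair (- e) 0 1 \<phi> \<phi>'" and y0: "y0 \<in> {0<..<1}" "\<phi> y0 \<noteq> 0"
    and th: "0 \<le> \<theta>" "\<eta> < pi / 2" "\<theta> - \<eta> < pi / 2"
    and bd: "\<phi> 1 * \<phi>' 1 + \<theta> * tan (\<theta> - \<eta>) * (\<phi> 1)\<^sup>2 \<le> \<phi> 0 * \<phi>' 0 - \<theta> * tan \<eta> * (\<phi> 0)\<^sup>2"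
  shows "\<theta>\<^sup>2 \<le> e"
proof (rule ccontr)
  assume "\<not> \<theta>\<^sup>2 \<le> e"
  then have e: "\<theta>\<^sup>2 - e > 0" by simp
  define F where "F y = \<phi> y * \<phi>' y + \<theta> * tan (\<theta> * y - \<eta>) * (\<phi> y)\<^sup>2" for y
  define F' where "F' y = (\<phi>' y + \<theta> * tan (\<theta> * y - \<eta>) * \<phi> y)\<^sup>2 + (\<theta>\<^sup>2 - e) * (\<phi> y)\<^sup>2" for y
  have cos: "cos (\<theta> * y - \<eta>) > 0" if "y \<in> {0..1}" for y
  proof (rule cos_gt_zero_pi)
    have "0 \<le> \<theta> * y" "\<theta> * y \<le> \<theta>" using that th by (auto simp: mult_left_le)
    then show "- (pi / 2) < \<theta> * y - \<eta>" "\<theta> * y - \<eta> < pi / 2" using th by linarith+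
  qed
  have cont: "continuous_on {0..1} F"
    unfolding F_def using cos ode ode_pair_continuous[OF ode]
    by (intro continuous_intros) (force simp: ode_pair_def)+
  have der: "(F has_real_derivative F' y) (at y)" if "y \<in> {0<..<1}" for y
  proof -
    have d: "(\<phi> has_real_derivative \<phi>' y) (at y)" "(\<phi>' has_real_derivative - e * \<phi> y) (at y)"
      using ode_pair_DERIV[OF ode that] ode that by (auto simp: ode_pair_def)
    have c: "cos (\<theta> * y - \<eta>) > 0" using cos that by auto
    have t: "((\<lambda>y. tan (\<theta> * y - \<eta>)) has_real_derivative (1 + (tan (\<theta> * y - \<eta>))\<^sup>2) * \<theta>) (at y)"
      using c by (auto intro!: derivative_eq_intros simp: tan_sec power_inverse)
    show ?thesis
      unfolding F_def F'_def
      using DERIV_add[OF DERIV_mult[OF d] DERIV_mult[OF DERIV_cmult[OF t, of \<theta>] DERIV_power[OF d(1), of 2]]]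
      by (rule DERIV_cong) (simp add: power2_eq_square algebra_simps)
  qed
  have nn: "F' y \<ge> 0" for y unfolding F'_def using e by auto
  have mono: "F y \<le> F z" if "0 \<le> y" "y \<le> z" "z \<le> 1" for y z
  proof (rule DERIV_nonneg_imp_increasing_open[OF that(2)])
    show "continuous_on {y..z} F" using that by (intro continuous_on_subset[OF cont]) auto
    show "\<exists>l. (F has_real_derivative l) (at x) \<and> 0 \<le> l" if "y < x" "x < z" for x
      using der[of x] nn[of x] that \<open>0 \<le> y\<close> \<open>z \<le> 1\<close> by auto
  qed
  \<comment> \<open>\<open>F\<close> is nondecreasing and, because \<phi> does not vanish at
    \<open>y0\<close>, grows strictly there; this contradicts \<open>bd\<close>, which says
    \<open>F 1 \<le> F 0\<close>.\<close>
  have "F' y0 > 0" unfolding F'_def using e y0 by (intro add_nonneg_pos) auto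
  from DERIV_pos_inc_right[OF der[OF y0(1)] this] obtain s where
    s: "s > 0" "\<And>h. 0 < h \<Longrightarrow> h < s \<Longrightarrow> F y0 < F (y0 + h)" by auto
  define h where "h = min (s / 2) (1 - y0)"
  have h: "0 < h" "h < s" "y0 + h \<le> 1" using s(1) y0 by (auto simp: h_def min_def)
  have "F 0 \<le> F y0" "F (y0 + h) \<le> F 1" using mono y0 h by auto
  moreover have "F 1 \<le> F 0" using bd by (simp add: F_def)
  ultimately show False using s(2)[OF h(1,2)] by linarith
qed

text \<open>With a Dirichlet condition the extremal angle would put a pole of the tangent on the
  boundary, so the comparison is made for every smaller \<theta> and then passed to the
  limit.\<close>

lemma square_le_limit:
  assumes "\<And>\<theta>. 0 < \<theta> \<Longrightarrow> \<theta> < B \<Longrightarrow> \<theta>\<^sup>2 \<le> e" and "(B::real) > 0"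
  shows "B\<^sup>2 \<le> e"
proof (rule ccontr)
  assume *: "\<not> B\<^sup>2 \<le> e"
  have "max 0 e < B\<^sup>2" using * assms(2) by auto
  then have "sqrt (max 0 e) < B"
    using assms(2) by (simp add: real_less_lsqrt)
  then obtain \<theta> where \<theta>: "sqrt (max 0 e) < \<theta>" "\<theta> < B" using dense by blast
  moreover have "sqrt (max 0 e) \<ge> 0" by simp
  ultimately have "\<theta> > 0" by linarith
  then have "max 0 e < \<theta>\<^sup>2" using \<theta>(1) by (metis real_sqrt_less_iff real_sqrt_abs abs_of_pos)
  with assms(1)[OF \<open>\<theta> > 0\<close> \<theta>(2)] show False by auto
qed

section \<open>The smallest eigenvalue for each pair of external conditions\<close>

lemma eigenbasis_eigenfunction:
  assumes "eigenbasis q bb bt \<phi> ev"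
  obtains \<phi>' y0 where "ode_pair (- ev k) 0 1 (\<phi> k) \<phi>'" "y0 \<in> {0<..<1}" "\<phi> k y0 \<noteq> 0"
    "bottom_op q bb (\<phi> k) = 0" "top_op q bt (\<phi> k) = 0"
    "deriv_on 0 1 (\<phi> k) 0 = \<phi>' 0" "deriv_on 0 1 (\<phi> k) 1 = \<phi>' 1"
proof -
  from assms obtain \<phi>' where ode: "ode_pair (- ev k) 0 1 (\<phi> k) \<phi>'"
    and bc: "bottom_op q bb (\<phi> k) = 0" "top_op q bt (\<phi> k) = 0"
    unfolding eigenbasis_def solves_ode_iff by metis
  \<comment> \<open>The norm is 1, so the eigenfunction cannot vanish throughout the open interval;
    the Riccati comparison needs such a point.\<close>
  have "(LINT y:{0<..<1}|lborel. \<phi> k y * \<phi> k y) = 1"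
    using assms unfolding eigenbasis_def by auto
  moreover have "(LINT y:{0<..<1}|lborel. \<phi> k y * \<phi> k y) = 0" if "\<And>y. y \<in> {0<..<1} \<Longrightarrow> \<phi> k y = 0"
    using that set_lebesgue_integral_cong[of "{0<..<1}" lborel "\<lambda>y. \<phi> k y * \<phi> k y" "\<lambda>y. 0"]
    by (auto simp: set_lebesgue_integral_def)
  ultimately obtain y0 where y0: "y0 \<in> {0<..<1}" "\<phi> k y0 \<noteq> 0" by fastforce
  have "deriv_on 0 1 (\<phi> k) 0 = \<phi>' 0" "deriv_on 0 1 (\<phi> k) 1 = \<phi>' 1"
    using ode by (auto intro!: deriv_on_eq simp: ode_pair_def)
  with ode bc y0 show ?thesis by (intro that) auto
qed

text \<open>The tangent in \<open>eigenvalue_ge_Riccati\<close> comes from the comparison function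
  \<open>cos (\<theta> y - \<eta>)\<close>, whose phase \<eta> is adapted to the conditions here and
  below: \<open>\<theta> / 2\<close> centres the cosine for (DD) and (RR), \<theta> moves its
  maximum to a Neumann condition at the top, 0 to one at the bottom.\<close>

lemma eigenvalue_DD:
  assumes "eigenbasis q Dirichlet Dirichlet \<phi> ev"
  shows "pi\<^sup>2 \<le> ev k"
proof (rule square_le_limit)
  fix \<theta> assume \<theta>: "0 < \<theta>" "\<theta> < pi"
  obtain \<phi>' y0 where *: "ode_pair (- ev k) 0 1 (\<phi> k) \<phi>'" "y0 \<in> {0<..<1}" "\<phi> k y0 \<noteq> 0"
    "bottom_op q Dirichlet (\<phi> k) = 0" "top_op q Dirichlet (\<phi> k) = 0"
    by (rule eigenbasis_eigenfunction[OF assms])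
  show "\<theta>\<^sup>2 \<le> ev k"
    by (rule eigenvalue_ge_Riccati[OF *(1-3), of _ "\<theta> / 2"]) (use * \<theta> in auto)
qed auto

lemma eigenvalue_DN:
  assumes "eigenbasis q Dirichlet Neumann \<phi> ev"
  shows "pi\<^sup>2 / 4 \<le> ev k"
proof -
  have "(pi / 2)\<^sup>2 \<le> ev k"
  proof (rule square_le_limit)
    fix \<theta> assume \<theta>: "0 < \<theta>" "\<theta> < pi / 2"
    obtain \<phi>' y0 where *: "ode_pair (- ev k) 0 1 (\<phi> k) \<phi>'" "y0 \<in> {0<..<1}" "\<phi> k y0 \<noteq> 0"
      "bottom_op q Dirichlet (\<phi> k) = 0" "top_op q Neumann (\<phi> k) = 0"
      "deriv_on 0 1 (\<phi> k) 1 = \<phi>' 1"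
      by (rule eigenbasis_eigenfunction[OF assms])
    show "\<theta>\<^sup>2 \<le> ev k"
      by (rule eigenvalue_ge_Riccati[OF *(1-3), of _ "\<theta>"]) (use * \<theta> in auto)
  qed auto
  then show ?thesis by (simp add: power_divide)
qed

lemma eigenvalue_NN:
  assumes "eigenbasis q Neumann Neumann \<phi> ev"
  shows "0 \<le> ev k"
proof -
  obtain \<phi>' y0 where *: "ode_pair (- ev k) 0 1 (\<phi> k) \<phi>'" "y0 \<in> {0<..<1}" "\<phi> k y0 \<noteq> 0"
    "bottom_op q Neumann (\<phi> k) = 0" "top_op q Neumann (\<phi> k) = 0"
    "deriv_on 0 1 (\<phi> k) 0 = \<phi>' 0" "deriv_on 0 1 (\<phi> k) 1 = \<phi>' 1"
    by (rule eigenbasis_eigenfunction[OF assms])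
  have "0\<^sup>2 \<le> ev k"
    by (rule eigenvalue_ge_Riccati[OF *(1-3), of _ 0]) (use * in auto)
  then show ?thesis by simp
qed

text \<open>Sign of a Robin boundary term in the hypothesis \<open>bd\<close> of the Riccati
  comparison: it is favourable as long as the comparison function satisfies a Robin condition whose
  constant \<open>z\<close> is at most \<open>q\<close>.\<close>

lemma Robin_top_le:
  fixes u :: real
  assumes "q * u + u' = 0" "z \<le> q"
  shows "u * u' + z * u\<^sup>2 \<le> 0"
proof -
  have "u' = - (q * u)" using assms by linarith
  then have "u * u' + z * u\<^sup>2 = (z - q) * u\<^sup>2" by (simp add: power2_eq_square algebra_simps)
  then show ?thesis using assms by (simp add: mult_nonpos_nonneg)
qed

lemma Robin_bottom_ge:
  fixes u :: real
  assumes "q * u - u' = 0" "z \<le> q"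
  shows "u * u' - z * u\<^sup>2 \<ge> 0"
proof -
  have "u * u' - z * u\<^sup>2 = (q - z) * u\<^sup>2" using assms(1) by (simp add: power2_eq_square algebra_simps)
  then show ?thesis using assms by simp
qed

lemma eigenvalue_NR:
  assumes "eigenbasis q Neumann Robin \<phi> ev" and q: "q > 0"
  shows "(nu1 q)\<^sup>2 \<le> ev k"
proof -
  have \<theta>: "0 < nu1 q" "nu1 q < pi / 2" "nu1 q * sin (nu1 q) - q * cos (nu1 q) = 0"
    using nu1[OF q] by (auto simp: is_nu1_def)
  have c: "cos (nu1 q) > 0" using \<theta> by (intro cos_gt_zero) auto
  have t: "nu1 q * tan (nu1 q) = q" using c \<theta>(3) by (simp add: tan_def field_simps)
  obtain \<phi>' y0 where *: "ode_pair (- ev k) 0 1 (\<phi> k) \<phi>'" "y0 \<in> {0<..<1}" "\<phi> k y0 \<noteq> 0"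
    "bottom_op q Neumann (\<phi> k) = 0" "top_op q Robin (\<phi> k) = 0"
    "deriv_on 0 1 (\<phi> k) 0 = \<phi>' 0" "deriv_on 0 1 (\<phi> k) 1 = \<phi>' 1"
    by (rule eigenbasis_eigenfunction[OF assms(1)])
  show ?thesis
    by (rule eigenvalue_ge_Riccati[OF *(1-3), of _ 0])
       (use * \<theta> t Robin_top_le[of q "\<phi> k 1" "\<phi>' 1" q] in auto)
qed

text \<open>The centred cosine satisfies a Robin condition with constant
  \<open>\<theta> tan (\<theta> / 2)\<close> at both ends; for \<open>\<theta> = tau1 q\<close> this
  constant is \<open>q\<close>, by the symmetric factor in \<open>is_tau1_iff\<close>.\<close>

lemma eigenvalue_RR:
  assumes "eigenbasis q Robin Robin \<phi> ev" and q: "q > 0"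
  shows "(tau1 q)\<^sup>2 \<le> ev k"
proof -
  define \<theta> where "\<theta> = tau1 q"
  have "is_nu1 (q / 2) (\<theta> / 2)" using tau1[OF q] is_tau1_iff[OF q] by (simp add: \<theta>_def)
  then have \<theta>: "0 < \<theta>" "\<theta> < pi" "\<theta> * sin (\<theta> / 2) = q * cos (\<theta> / 2)"
    by (auto simp: is_nu1_def)
  have c: "cos (\<theta> / 2) > 0" using \<theta> by (intro cos_gt_zero) auto
  have t: "\<theta> * tan (\<theta> / 2) = q" using c \<theta>(3) by (simp add: tan_def field_simps)
  have h: "\<theta> - \<theta> / 2 = \<theta> / 2" by simp
  obtain \<phi>' y0 where *: "ode_pair (- ev k) 0 1 (\<phi> k) \<phi>'" "y0 \<in> {0<..<1}" "\<phi> k y0 \<noteq> 0"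
    "bottom_op q Robin (\<phi> k) = 0" "top_op q Robin (\<phi> k) = 0"
    "deriv_on 0 1 (\<phi> k) 0 = \<phi>' 0" "deriv_on 0 1 (\<phi> k) 1 = \<phi>' 1"
    by (rule eigenbasis_eigenfunction[OF assms(1)])
  have "\<theta>\<^sup>2 \<le> ev k"
    by (rule eigenvalue_ge_Riccati[OF *(1-3), of _ "\<theta> / 2"])
       (use * \<theta> t Robin_top_le[of q "\<phi> k 1" "\<phi>' 1" q] Robin_bottom_ge[of q "\<phi> k 0" "\<phi>' 0" q]
         in \<open>auto simp: h\<close>)
  then show ?thesis by (simp add: \<theta>_def)
qed

lemma eigenvalue_DR:
  assumes "eigenbasis q Dirichlet Robin \<phi> ev" and q: "q > 0"
  shows "(mu1 q)\<^sup>2 \<le> ev k"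
proof (rule square_le_limit)
  have mu: "pi / 2 < mu1 q" "mu1 q < pi" "q * sin (mu1 q) + mu1 q * cos (mu1 q) = 0"
    using mu1[OF q] by (auto simp: is_mu1_def)
  then show "mu1 q > 0" using pi_gt_zero by linarith
  fix \<theta> assume \<theta>: "0 < \<theta>" "\<theta> < mu1 q"
  \<comment> \<open>The phase \<open>\<theta> - arctan (q / \<theta>)\<close> lets the comparison
    function satisfy the Robin condition at the top exactly. It has to stay below
    \<open>pi / 2\<close>, which holds for \<open>\<theta> < mu1 q\<close>; at the root itself the
    tangent reaches its pole at the bottom.\<close>
  have "\<theta> - pi / 2 < arctan (q / \<theta>)"
  proof (cases "\<theta> \<le> pi / 2")
    case True
    have "0 < arctan (q / \<theta>)" using \<theta> q by (simp add: zero_less_arctan_iff)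
    then show ?thesis using True by linarith
  next
    case False
    have "- (q * sin \<theta> + \<theta> * cos \<theta>) < - (q * sin (mu1 q) + mu1 q * cos (mu1 q))"
    proof (rule DERIV_pos_imp_increasing_open[OF \<theta>(2)])
      show "\<exists>y. ((\<lambda>x. - (q * sin x + x * cos x)) has_real_derivative y) (at x) \<and> 0 < y"
        if "\<theta> < x" "x < mu1 q" for x
        using DR_function(2,3)[OF q, of x] that False mu by auto
    qed (rule DR_function(1)[OF q])
    then have *: "q * sin \<theta> + \<theta> * cos \<theta> > 0" using mu by simp
    have s: "sin \<theta> > 0" using \<theta> mu by (intro sin_gt_zero) auto
    have "tan (\<theta> - pi / 2) = - cos \<theta> / sin \<theta>"
      by (simp add: tan_def sin_diff cos_diff)
    also have "\<dots> < q / \<theta>" using * s \<theta> by (simp add: field_simps)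
    finally have "arctan (tan (\<theta> - pi / 2)) < arctan (q / \<theta>)" by (simp only: arctan_less_iff)
    then show ?thesis using False \<theta> mu by (subst (asm) arctan_tan) auto
  qed
  moreover have "\<theta> * tan (arctan (q / \<theta>)) = q" using \<theta> by (simp add: tan_arctan)
  moreover obtain \<phi>' y0 where *: "ode_pair (- ev k) 0 1 (\<phi> k) \<phi>'" "y0 \<in> {0<..<1}" "\<phi> k y0 \<noteq> 0"
    "bottom_op q Dirichlet (\<phi> k) = 0" "top_op q Robin (\<phi> k) = 0"
    "deriv_on 0 1 (\<phi> k) 0 = \<phi>' 0" "deriv_on 0 1 (\<phi> k) 1 = \<phi>' 1"
    by (rule eigenbasis_eigenfunction[OF assms(1)])
  moreover have "\<theta> - (\<theta> - arctan (q / \<theta>)) = arctan (q / \<theta>)" by simp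
  moreover have "arctan (q / \<theta>) < pi / 2" by (rule arctan_ubound)
  ultimately show "\<theta>\<^sup>2 \<le> ev k"
    using Robin_top_le[of q "\<phi> k 1" "\<phi>' 1" q] \<theta>
    by (intro eigenvalue_ge_Riccati[OF *(1-3), of _ "\<theta> - arctan (q / \<theta>)"]) auto
qed

lemma roots_order:
  assumes "q > 0"
  shows "pi / 2 < mu1 q" "mu1 q < pi" "0 < nu1 q" "nu1 q < pi / 2" "0 < tau1 q" "tau1 q < pi"
  using mu1[OF assms] nu1[OF assms] tau1[OF assms] by (auto simp: is_mu1_def is_nu1_def is_tau1_def)

lemma rho_order:
  assumes "L > 0" "d > 0" "q > 0"
  shows "rho_DD L d < rho_DR L d q" "rho_DR L d q < rho_DN L d" "rho_DN L d < rho_NR L d q"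
    "rho_NR L d q < rho_NN L d" "rho_NN L d = 1"
    "rho_DD L d < rho_RR L d q" "rho_RR L d q < rho_NN L d"
proof -
  note r = roots_order[OF assms(3)]
  have *: "rho L (x\<^sup>2) d < rho L (y\<^sup>2) d" if "0 \<le> y" "y < x" for x y
    using that assms by (intro rho_strict_antimono power_strict_mono) auto
  have 2: "pi\<^sup>2 / 4 = (pi / 2)\<^sup>2" "0 = (0::real)\<^sup>2" by (simp_all add: power_divide)
  show "rho_DD L d < rho_DR L d q" "rho_DR L d q < rho_DN L d" "rho_DN L d < rho_NR L d q"
    "rho_NR L d q < rho_NN L d" "rho_NN L d = 1"
    "rho_DD L d < rho_RR L d q" "rho_RR L d q < rho_NN L d"
    unfolding rho_DD_def rho_DR_def rho_DN_def rho_NR_def rho_NN_def rho_RR_def 2(1)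
    using *[of "mu1 q" pi] *[of "pi / 2" "mu1 q"] *[of "nu1 q" "pi / 2"] *[of 0 "nu1 q"]
      *[of "tau1 q" pi] *[of 0 "tau1 q"] r by (auto simp: rho_eq Ch_def)
qed

section \<open>The one-dimensional iteration\<close>

lemma right_end_eq: "right_end L d j = left_end L j + 2 * (L / 2 + d)"
  by (simp add: right_end_def left_end_def algebra_simps)

text \<open>The difference is left unsimplified to match the points \<open>b - (h - t)\<close> and
  \<open>a + (h - t)\<close> of the local estimates; the two brackets differ by the overlap
  \<open>2 * d\<close>.\<close>

lemma left_end_Suc: "left_end L (Suc j) = right_end L d j - ((L / 2 + d) - (L / 2 - d))"
  by (simp add: right_end_def left_end_def algebra_simps)

lemma right_end_Suc: "right_end L d j = left_end L (Suc j) + ((L / 2 + d) - (L / 2 - d))"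
  by (simp add: right_end_def left_end_def algebra_simps)

lemma subdomain_nonempty: "L > 0 \<Longrightarrow> d > 0 \<Longrightarrow> left_end L j < right_end L d j"
  by (simp add: right_end_eq)

lemma left_end_Suc_mem: "L > 0 \<Longrightarrow> d > 0 \<Longrightarrow> left_end L (Suc j) \<in> {left_end L j<..<right_end L d j}"
  by (simp add: right_end_def left_end_def algebra_simps)

lemma right_end_mem_Suc:
  "L > 0 \<Longrightarrow> d > 0 \<Longrightarrow> right_end L d j \<in> {left_end L (Suc j)<..<right_end L d (Suc j)}"
  by (simp add: right_end_def left_end_def algebra_simps)

lemma subdomain_estimate:
  assumes Ld: "L > 0" "0 < d" "d < L / 2" and c: "c \<ge> 0" and P: "trans_val m > 0"
    and N: "N \<ge> 2" "j \<in> {1..N}"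
    and ode: "solves_ode c (left_end L j) (right_end L d j) w"
    and l: "\<bar>left_cond m L d j w\<bar> \<le> M" "j = 1 \<Longrightarrow> left_cond m L d j w = 0"
    and r: "\<bar>right_cond m L d N j w\<bar> \<le> M" "j = N \<Longrightarrow> right_cond m L d N j w = 0"
  shows "j < N \<Longrightarrow>
      \<bar>trans_left m (left_end L j) (right_end L d j) w (left_end L (Suc j))\<bar> \<le> rho L c d * M"
    and "1 < j \<Longrightarrow>
      \<bar>trans_right m (left_end L j) (right_end L d j) w (right_end L d (j - 1))\<bar> \<le> rho L c d * M"
    and "x \<in> {left_end L j..right_end L d j} \<Longrightarrow> \<bar>w x\<bar> \<le> 2 * M / trans_val m"
proof -
  obtain w' where w: "ode_pair c (left_end L j) (right_end L d j) w w'"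
    using ode by (auto simp: solves_ode_iff)
  have ab: "left_end L j < right_end L d j" using Ld by (simp add: subdomain_nonempty)
  have der: "(w has_real_derivative w' y) (at y within {left_end L j..right_end L d j})"
    if "y \<in> {left_end L j..right_end L d j}" for y
    using w that by (auto simp: ode_pair_def)
  note te = trans_eq[OF der ab, of _ m]
  have h: "0 \<le> L / 2 - d" "L / 2 - d < L / 2 + d" using Ld by auto
  note ij = interior_estimate[OF w c h right_end_eq P trans_der_nonneg, of m M]
  note lj = left_end_estimate[OF w c h right_end_eq P trans_der_nonneg, of m M]
  note rj = right_end_estimate[OF w c h right_end_eq P trans_der_nonneg, of m M]
  have mem: "left_end L (Suc j) \<in> {left_end L j..right_end L d j}"
    using left_end_Suc_mem[OF Ld(1,2), of j] by simp
  have mem': "right_end L d (j - 1) \<in> {left_end L j..right_end L d j}" if "1 < j"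
    using right_end_mem_Suc[OF Ld(1,2), of "j - 1"] that by simp
  have re: "right_end L d (j - 1) = left_end L j + (L / 2 + d - (L / 2 - d))" if "1 < j"
    using right_end_Suc[of L d "j - 1"] that by simp
  have l': "j = 1 \<Longrightarrow> w (left_end L j) = 0"
    "j \<noteq> 1 \<Longrightarrow> \<bar>trans_val m * w (left_end L j) - trans_der m * w' (left_end L j)\<bar> \<le> M"
    using l te(1)[of "left_end L j"] ab by (auto simp: left_cond_def)
  have r': "j = N \<Longrightarrow> w (right_end L d j) = 0"
    "j \<noteq> N \<Longrightarrow> \<bar>trans_val m * w (right_end L d j) + trans_der m * w' (right_end L d j)\<bar> \<le> M"
    using r te(2)[of "right_end L d j"] ab by (auto simp: right_cond_def)
  \<comment> \<open>As \<open>N \<ge> 2\<close>, no subdomain is first and last at once, so the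
    three local estimates cover all cases.\<close>
  consider "j = 1" "j \<noteq> N" | "j \<noteq> 1" "j = N" | "j \<noteq> 1" "j \<noteq> N" using N by linarith
  then have *: "(j < N \<longrightarrow> \<bar>trans_left m (left_end L j) (right_end L d j) w (left_end L (Suc j))\<bar> \<le> rho L c d * M)
    \<and> (1 < j \<longrightarrow> \<bar>trans_right m (left_end L j) (right_end L d j) w (right_end L d (j - 1))\<bar> \<le> rho L c d * M)
    \<and> (x \<in> {left_end L j..right_end L d j} \<longrightarrow> \<bar>w x\<bar> \<le> 2 * M / trans_val m)"
  proof cases
    case 1
    note e = lj[OF l'(1)[OF 1(1)] r'(2)[OF 1(2)]]
    show ?thesis using e(1) e(2)[of x] 1(1)
      unfolding te(1)[OF mem mem] rho_eq left_end_Suc[of L j d, symmetric] by auto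
  next
    case 2
    note e = rj[OF l'(2)[OF 2(1)] r'(1)[OF 2(2)]]
    show ?thesis using e(1) e(2)[of x] 2(2) mem' re te(2)[OF mem' mem']
      unfolding rho_eq by auto
  next
    case 3
    note e = ij[OF l'(2)[OF 3(1)] r'(2)[OF 3(2)]]
    show ?thesis using e(1,2) e(3)[of x] mem' re te(2)[OF mem' mem']
      unfolding te(1)[OF mem mem] rho_eq left_end_Suc[of L j d, symmetric] by auto
  qed
  show "j < N \<Longrightarrow>
      \<bar>trans_left m (left_end L j) (right_end L d j) w (left_end L (Suc j))\<bar> \<le> rho L c d * M"
    and "1 < j \<Longrightarrow>
      \<bar>trans_right m (left_end L j) (right_end L d j) w (right_end L d (j - 1))\<bar> \<le> rho L c d * M"
    and "x \<in> {left_end L j..right_end L d j} \<Longrightarrow> \<bar>w x\<bar> \<le> 2 * M / trans_val m"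
    using * by blast+
qed

text \<open>This contraction in the maximum norm is shared by the row sum bound for the matrix and
  by the L2 estimate. Each datum comes from a single neighbour, so no sum over subdomains arises; at
  the outer ends of the chain the datum is 0.\<close>

lemma datum_estimate:
  assumes Ld: "L > 0" "0 < d" "d < L / 2" and c: "c \<ge> 0" and P: "trans_val m > 0"
    and N: "N \<ge> 2" and M: "M \<ge> 0"
    and ode: "\<And>j. j \<in> {1..N} \<Longrightarrow> solves_ode c (left_end L j) (right_end L d j) (W j)"
    and l: "\<And>j. j \<in> {1..N} \<Longrightarrow> \<bar>left_cond m L d j (W j)\<bar> \<le> M" "left_cond m L d 1 (W 1) = 0"
    and r: "\<And>j. j \<in> {1..N} \<Longrightarrow> \<bar>right_cond m L d N j (W j)\<bar> \<le> M" "right_cond m L d N N (W N) = 0"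
    and j: "j \<in> {1..N}"
  shows "\<bar>left_datum m L d j W\<bar> \<le> rho L c d * M" "\<bar>right_datum m L d N j W\<bar> \<le> rho L c d * M"
proof -
  have nn: "rho L c d * M \<ge> 0" using M rho_pos[of L c d] by simp
  have l': "left_cond m L d i (W i) = 0" if "i = 1" for i using l(2) that by simp
  have r': "right_cond m L d N i (W i) = 0" if "i = N" for i using r(2) that by simp
  note est = subdomain_estimate[OF Ld c P N _ ode l(1) l' r(1) r']
  show "\<bar>left_datum m L d j W\<bar> \<le> rho L c d * M"
  proof (cases "j = 1")
    case False
    then have i: "j - 1 \<in> {1..N}" "j - 1 < N" and s: "Suc (j - 1) = j" using j by auto
    show ?thesis
      using est(1)[OF i(1) i(1) i(1) _ i(1) _ i(2)] False unfolding s left_datum_def by simp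
  qed (use nn in \<open>simp add: left_datum_def\<close>)
  show "\<bar>right_datum m L d N j W\<bar> \<le> rho L c d * M"
  proof (cases "j = N")
    case False
    then have i: "j + 1 \<in> {1..N}" "1 < j + 1" and s: "j + 1 - 1 = j" using j by auto
    show ?thesis
      using est(2)[OF i(1) i(1) i(1) _ i(1) _ i(2)] False unfolding s right_datum_def by simp
  qed (use nn in \<open>simp add: right_datum_def\<close>)
qed

section \<open>Solvability of the local problems and the iteration matrix\<close>

lemma local_problem_solvable:
  assumes Ld: "L > 0" "0 < d" "d < L / 2" and c: "c \<ge> 0" and P: "trans_val m > 0"
    and N: "N \<ge> 2" "j \<in> {1..N}"
    and g: "j = 1 \<Longrightarrow> gl = 0" "j = N \<Longrightarrow> gr = 0"
  shows "\<exists>w. solves_ode c (left_end L j) (right_end L d j) w \<and>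
    left_cond m L d j w = gl \<and> right_cond m L d N j w = gr"
proof -
  define a where "a = left_end L j"
  define h where "h = L / 2 + d"
  define b where "b = a + 2 * h"
  have b: "right_end L d j = b" unfolding b_def a_def h_def by (rule right_end_eq)
  have h: "h > 0" using Ld by (simp add: h_def)
  then have ab: "a < b" by (simp add: b_def)
  define p where "p = trans_val m"
  define k where "k = trans_der m"
  have p: "p > 0" "k \<ge> 0" using P trans_der_nonneg by (auto simp: p_def k_def)
  have S: "Sh c h > 0" "Sh c (2 * h) > 0" using Sh_pos c h by auto
  define E where "E = p * Ch c h + k * (c * Sh c h)"
  define F where "F = p * Sh c h + k * Ch c h"
  define G where "G = p * Sh c (2 * h) + k * Ch c (2 * h)"
  have pos: "E > 0" "F > 0" "G > 0"
    unfolding E_def F_def G_def using p c S less_imp_le[OF Ch_pos] by (auto intro!: add_pos_nonneg)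
  have te: "trans_left m a b w x = p * w x - k * w' x" "trans_right m a b w x = p * w x + k * w' x"
    if "ode_pair c a b w w'" "x \<in> {a..b}" for w w' x
    using trans_eq[OF _ ab that(2), of w "w' x" m] that by (auto simp: ode_pair_def p_def k_def)
  consider "j = 1" "j \<noteq> N" | "j \<noteq> 1" "j = N" | "j \<noteq> 1" "j \<noteq> N" using N by linarith
  then show ?thesis
  proof cases
    case 1
    define \<beta> where "\<beta> = gr / G"
    define w where "w x = 0 * Ch c (x - a) + \<beta> * Sh c (x - a)" for x
    define w' where "w' x = 0 * (c * Sh c (x - a)) + \<beta> * Ch c (x - a)" for x
    have o: "ode_pair c a b w w'" unfolding w_def w'_def by (rule ode_pair_Ch_Sh[OF c])
    have e: "b - a = 2 * h" by (simp add: b_def)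
    have "p * w b + k * w' b = \<beta> * G"
      unfolding w_def w'_def e G_def by (simp add: algebra_simps)
    also have "\<dots> = gr" using pos by (simp add: \<beta>_def)
    finally have r: "trans_right m a b w b = gr" using te(2)[OF o, of b] ab by simp
    have l: "w a = 0" by (simp add: w_def)
    show ?thesis
      unfolding a_def[symmetric] b left_cond_def right_cond_def solves_ode_iff
      using 1 g o l r by auto
  next
    case 2
    define \<beta> where "\<beta> = - gl / G"
    define w where "w x = 0 * Ch c (x - b) + \<beta> * Sh c (x - b)" for x
    define w' where "w' x = 0 * (c * Sh c (x - b)) + \<beta> * Ch c (x - b)" for x
    have o: "ode_pair c a b w w'" unfolding w_def w'_def by (rule ode_pair_Ch_Sh[OF c])
    have e: "a - b = - (2 * h)" by (simp add: b_def)
    have "p * w a - k * w' a = - \<beta> * G"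
      unfolding w_def w'_def e Ch_minus Sh_minus G_def by (simp add: algebra_simps)
    also have "\<dots> = gl" using pos by (simp add: \<beta>_def)
    finally have l: "trans_left m a b w a = gl" using te(1)[OF o, of a] ab by simp
    have r: "w b = 0" by (simp add: w_def)
    show ?thesis
      unfolding a_def[symmetric] b left_cond_def right_cond_def solves_ode_iff
      using 2 g o l r by auto
  next
    case 3
    \<comment> \<open>The data are \<open>A E - B F\<close> on the left and \<open>A E + B F\<close>
      on the right, so half their sum and half their difference determine the even and the odd
      part.\<close>
    define A where "A = (gl + gr) / (2 * E)"
    define B where "B = (gr - gl) / (2 * F)"
    note o = ode_pair_Ch_Sh[OF c, of a b A "a + h" B]
    have e: "a - (a + h) = - h" "b - (a + h) = h" by (simp_all add: b_def)
    have "p * (A * Ch c (- h) + B * Sh c (- h)) - k * (A * (c * Sh c (- h)) + B * Ch c (- h))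
        = A * E - B * F"
      by (simp add: E_def F_def algebra_simps)
    also have "\<dots> = gl" using pos by (simp add: A_def B_def field_simps)
    finally have l: "trans_left m a b (\<lambda>x. A * Ch c (x - (a + h)) + B * Sh c (x - (a + h))) a = gl"
      using te(1)[OF o, of a] ab by (simp only: e) simp
    have "p * (A * Ch c h + B * Sh c h) + k * (A * (c * Sh c h) + B * Ch c h)
        = A * E + B * F"
      by (simp add: E_def F_def algebra_simps)
    also have "\<dots> = gr" using pos by (simp add: A_def B_def field_simps)
    finally have r: "trans_right m a b (\<lambda>x. A * Ch c (x - (a + h)) + B * Sh c (x - (a + h))) b = gr"
      using te(2)[OF o, of b] ab by (simp only: e) simp
    show ?thesis
      unfolding a_def[symmetric] b left_cond_def right_cond_def solves_ode_iff
      using 3 o l r by auto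
  qed
qed

lemma local_solution:
  assumes Ld: "L > 0" "0 < d" "d < L / 2" and c: "c \<ge> 0" and P: "trans_val m > 0"
    and N: "N \<ge> 2" "j \<in> {1..N}"
  shows "solves_ode c (left_end L j) (right_end L d j) (local_solution m L d N c g j)"
    "left_cond m L d j (local_solution m L d N c g j) = left_entry g j"
    "right_cond m L d N j (local_solution m L d N c g j) = right_entry N g j"
  using someI_ex[OF local_problem_solvable[OF assms, of "left_entry g j" "right_entry N g j"]]
  unfolding local_solution_def by (auto simp: left_entry_def right_entry_def)

lemma trans_sum:
  assumes "\<And>l. l \<in> I \<Longrightarrow> solves_ode c a b (w l)" "a < b" "x \<in> {a..b}"
  shows "trans_left m a b (\<lambda>x. \<Sum>l\<in>I. g l * w l x) x = (\<Sum>l\<in>I. g l * trans_left m a b (w l) x)"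
    "trans_right m a b (\<lambda>x. \<Sum>l\<in>I. g l * w l x) x = (\<Sum>l\<in>I. g l * trans_right m a b (w l) x)"
    "solves_ode c a b (\<lambda>x. \<Sum>l\<in>I. g l * w l x)"
proof -
  obtain w' where w': "\<And>l. l \<in> I \<Longrightarrow> ode_pair c a b (w l) (w' l)"
    using assms(1) unfolding solves_ode_iff by metis
  note s = ode_pair_sum[OF w', where g = g]
  have s': "((\<lambda>x. \<Sum>l\<in>I. g l * w l x) has_real_derivative (\<Sum>l\<in>I. g l * w' l x)) (at x within {a..b})"
    using s assms(3) by (simp add: ode_pair_def)
  have d: "(w l has_real_derivative w' l x) (at x within {a..b})" if "l \<in> I" for l
    using w'[OF that] assms(3) by (simp add: ode_pair_def)
  show "trans_left m a b (\<lambda>x. \<Sum>l\<in>I. g l * w l x) x = (\<Sum>l\<in>I. g l * trans_left m a b (w l) x)"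
    unfolding trans_eq(1)[OF s' assms(2,3)]
    by (simp add: trans_eq(1)[OF d assms(2,3)] sum_distrib_left sum_subtractf right_diff_distrib mult_ac)
  show "trans_right m a b (\<lambda>x. \<Sum>l\<in>I. g l * w l x) x = (\<Sum>l\<in>I. g l * trans_right m a b (w l) x)"
    unfolding trans_eq(2)[OF s' assms(2,3)]
    by (simp add: trans_eq(2)[OF d assms(2,3)] sum_distrib_left sum.distrib distrib_left mult_ac)
  show "solves_ode c a b (\<lambda>x. \<Sum>l\<in>I. g l * w l x)"
    unfolding solves_ode_iff by (rule exI, rule s)
qed

text \<open>Take an eigenvector for an eigenvalue of largest modulus and compare the two sides of
  the eigenvalue equation at its entry of largest modulus.\<close>

lemma spectral_radius_le_row_sum:
  fixes A :: "complex mat"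
  assumes A: "A \<in> carrier_mat n n" "n > 0"
    and row: "\<And>i. i < n \<Longrightarrow> (\<Sum>l<n. norm (A $$ (i, l))) \<le> r"
  shows "spectral_radius A \<le> r"
proof -
  obtain \<mu> where \<mu>: "spectral_radius A = norm \<mu>" "\<mu> \<in> spectrum A"
    using spectral_radius_mem_max(1)[OF A] by auto
  then obtain v where "eigenvector A v \<mu>"
    by (auto simp: spectrum_def eigenvalue_def)
  then have v: "v \<in> carrier_vec n" "v \<noteq> 0\<^sub>v n" "A *\<^sub>v v = \<mu> \<cdot>\<^sub>v v"
    using A by (auto simp: eigenvector_def)
  define M where "M = Max ((\<lambda>i. norm (vec_index v i)) ` {..<n})"
  have le: "norm (vec_index v i) \<le> M" if "i < n" for i
    unfolding M_def using that by (intro Max_ge) auto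
  have "M \<in> (\<lambda>i. norm (vec_index v i)) ` {..<n}"
    unfolding M_def using A by (intro Max_in) auto
  then obtain i where i: "i < n" "norm (vec_index v i) = M" by auto
  have "M > 0"
  proof (rule ccontr)
    assume "\<not> M > 0"
    then have "vec_index v l = 0" if "l < n" for l
      using order_trans[OF le[OF that], of 0] by (simp only: norm_le_zero_iff not_less)
    then have "v = 0\<^sub>v n" using v(1) by (intro eq_vecI) simp_all
    then show False using v by simp
  qed
  have "\<mu> * vec_index v i = vec_index (A *\<^sub>v v) i"
    unfolding v(3) using v(1) i(1) by simp
  also have "\<dots> = row A i \<bullet> v"
    using A(1) i(1) by simp
  also have "\<dots> = (\<Sum>l<n. A $$ (i, l) * vec_index v l)"
    using A(1) v(1) i(1) unfolding scalar_prod_def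
    by (intro sum.cong) (auto simp: atLeast0LessThan)
  finally have "norm \<mu> * M = norm (\<Sum>l<n. A $$ (i, l) * vec_index v l)"
    using norm_mult[of \<mu> "vec_index v i"] i(2) by simp
  also have "\<dots> \<le> (\<Sum>l<n. norm (A $$ (i, l)) * M)"
  proof (rule sum_norm_le)
    show "norm (A $$ (i, l) * vec_index v l) \<le> norm (A $$ (i, l)) * M" if "l \<in> {..<n}" for l
      unfolding norm_mult using le that by (intro mult_left_mono) simp_all
  qed
  also have "\<dots> \<le> r * M"
    unfolding sum_distrib_right[symmetric]
    using row[OF i(1)] less_imp_le[OF \<open>M > 0\<close>] by (rule mult_right_mono)
  finally have "norm \<mu> \<le> r" using \<open>M > 0\<close> by (rule mult_right_le_imp_le)
  then show ?thesis unfolding \<mu>(1) .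
qed

lemma frequency_factor_le:
  assumes Ld: "L > 0" "0 < d" "d < L / 2" and c: "c \<ge> 0" and P: "trans_val m > 0" and N: "N \<ge> 2"
  shows "frequency_factor m L d N c \<le> rho L c d"
  unfolding frequency_factor_def
proof (rule spectral_radius_le_row_sum)
  define n where "n = 2 * (N - 1)"
  define A where "A = iteration_matrix m L d N c"
  show "map_mat complex_of_real A \<in> carrier_mat n n" "n > 0"
    using N by (auto simp: A_def iteration_matrix_def n_def)
  fix i assume i: "i < n"
  define W where "W l = local_solution m L d N c (\<lambda>i'. if i' = l then 1 else 0)" for l
  note W = local_solution[OF Ld c P N, where g = "\<lambda>i'. if i' = l then 1 else 0" for l, folded W_def]
  \<comment> \<open>The absolute row sum of row \<open>i\<close> is the \<open>i\<close>-th new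
    datum when the old data are the signs of that row. These have modulus at most 1, so
    \<open>datum_estimate\<close> applies with bound 1 to the superposition
    \<open>V\<close>.\<close>
  define g where "g l = sgn (A $$ (i, l))" for l
  define V where "V j x = (\<Sum>l<n. g l * W l j x)" for j x
  have ab: "left_end L j < right_end L d j" for j using subdomain_nonempty Ld by blast
  have s: "trans_left m (left_end L j) (right_end L d j) (V j) x =
        (\<Sum>l<n. g l * trans_left m (left_end L j) (right_end L d j) (W l j) x)"
    "trans_right m (left_end L j) (right_end L d j) (V j) x =
        (\<Sum>l<n. g l * trans_right m (left_end L j) (right_end L d j) (W l j) x)"
    "solves_ode c (left_end L j) (right_end L d j) (V j)"
    if "j \<in> {1..N}" "x \<in> {left_end L j..right_end L d j}" for j x
    using trans_sum(1,2)[where I = "{..<n}" and w = "\<lambda>l. W l j" and g = g and m = m, OF W(1)[OF that(1)] ab that(2)]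
      trans_sum(3)[where I = "{..<n}" and w = "\<lambda>l. W l j" and g = g, OF W(1)[OF that(1)] ab that(2)]
    unfolding V_def[abs_def] by blast+
  have V_ode: "solves_ode c (left_end L j) (right_end L d j) (V j)" if "j \<in> {1..N}" for j
    using s(3)[OF that, of "left_end L j"] ab[of j] by simp
  have l: "left_cond m L d j (V j) = left_entry g j" if j: "j \<in> {1..N}" for j
  proof -
    have "left_cond m L d j (V j) = (\<Sum>l<n. g l * left_cond m L d j (W l j))"
      unfolding left_cond_def using s(1)[OF j, of "left_end L j"] ab[of j] by (simp add: V_def)
    also have "\<dots> = (\<Sum>l<n. g l * left_entry (\<lambda>i'. if i' = l then 1 else 0) j)"
      using W(2)[OF j] by simp
    also have "\<dots> = left_entry g j"
      using j N unfolding left_entry_def n_def by (auto simp: if_distrib cong: if_cong)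
    finally show ?thesis .
  qed
  have r: "right_cond m L d N j (V j) = right_entry N g j" if j: "j \<in> {1..N}" for j
  proof -
    have "right_cond m L d N j (V j) = (\<Sum>l<n. g l * right_cond m L d N j (W l j))"
      unfolding right_cond_def using s(2)[OF j, of "right_end L d j"] ab[of j] by (simp add: V_def)
    also have "\<dots> = (\<Sum>l<n. g l * right_entry N (\<lambda>i'. if i' = l then 1 else 0) j)"
      using W(3)[OF j] by simp
    also have "\<dots> = right_entry N g j"
      using j N unfolding right_entry_def n_def by (auto simp: if_distrib cong: if_cong)
    finally show ?thesis .
  qed
  have g1: "\<bar>g l\<bar> \<le> 1" for l unfolding g_def by (simp add: abs_sgn_eq)
  have N1: "1 \<in> {1..N}" "N \<in> {1..N}" using N by auto
  have lb: "\<bar>left_cond m L d j (V j)\<bar> \<le> 1" if "j \<in> {1..N}" for j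
    unfolding l[OF that] left_entry_def using g1 by simp
  have rb: "\<bar>right_cond m L d N j (V j)\<bar> \<le> 1" if "j \<in> {1..N}" for j
    unfolding r[OF that] right_entry_def using g1 by simp
  have l1: "left_cond m L d 1 (V 1) = 0" unfolding l[OF N1(1)] by (simp add: left_entry_def)
  have rN: "right_cond m L d N N (V N) = 0" unfolding r[OF N1(2)] by (simp add: right_entry_def)
  have est: "\<bar>left_datum m L d j V\<bar> \<le> rho L c d" "\<bar>right_datum m L d N j V\<bar> \<le> rho L c d"
    if "j \<in> {1..N}" for j
    using datum_estimate[OF Ld c P N zero_le_one V_ode lb l1 rb rN that] by simp_all
  have entry: "A $$ (i, k) = (if i < N - 1 then left_datum m L d (i + 2) (W k)
      else right_datum m L d N (i - (N - 1) + 1) (W k))" if "k < n" for k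
    unfolding A_def iteration_matrix_def n_def[symmetric] using i that by (simp add: W_def Let_def)
  have dim: "dim_row A = n" "dim_col A = n"
    by (simp_all add: A_def iteration_matrix_def n_def)
  have sg: "\<bar>A $$ (i, l)\<bar> = g l * A $$ (i, l)" for l
    by (simp add: g_def sgn_if abs_if)
  have "(\<Sum>l<n. norm (map_mat complex_of_real A $$ (i, l))) = (\<Sum>l<n. g l * A $$ (i, l))"
    using i dim by (intro sum.cong) (simp_all add: sg)
  also have "\<dots> \<le> rho L c d"
  proof (cases "i < N - 1")
    case True
    \<comment> \<open>Row \<open>i\<close> is the datum at the left end of subdomain
      \<open>i + 2\<close>, read from subdomain \<open>i + 1\<close>; linearity is used in the
      latter, the estimate for the former.\<close>
    then have j: "i + 1 \<in> {1..N}" "i + 2 \<in> {1..N}" by auto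
    have "(\<Sum>l<n. g l * A $$ (i, l)) = (\<Sum>l<n. g l * left_datum m L d (i + 2) (W l))"
      using True by (intro sum.cong) (simp_all add: entry)
    also have "\<dots> = left_datum m L d (i + 2) V"
      unfolding left_datum_def using s(1)[OF j(1), of "left_end L (i + 2)"]
        left_end_Suc_mem[OF Ld(1,2), of "i + 1"] by simp
    finally show ?thesis using est(1)[OF j(2)] by simp
  next
    case False
    \<comment> \<open>Row \<open>N - 1 + i'\<close> belongs to the right end of subdomain
      \<open>i' + 1\<close> and is read from the subdomain after it.\<close>
    define j where "j = i - (N - 1) + 1"
    have j: "j \<in> {1..N}" "j + 1 \<in> {1..N}" "j \<noteq> N" using False i by (auto simp: j_def n_def)
    have "(\<Sum>l<n. g l * A $$ (i, l)) = (\<Sum>l<n. g l * right_datum m L d N j (W l))"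
      using False by (intro sum.cong) (simp_all add: entry j_def)
    also have "\<dots> = right_datum m L d N j V"
      unfolding right_datum_def using s(2)[OF j(2), of "right_end L d j"] j
        right_end_mem_Suc[OF Ld(1,2), of j] by simp
    finally show ?thesis using est(2)[OF j(1)] by simp
  qed
  finally show "(\<Sum>l<n. norm (map_mat complex_of_real A $$ (i, l))) \<le> rho L c d" .
qed

section \<open>Fourier coefficients in the transverse direction\<close>

text \<open>The definitions use Lebesgue integrals over the open interval, whereas the Leibniz rule
  and the fundamental theorem of calculus below work with the gauge integral over the closed
  one.\<close>

lemma LINT_Ioo_eq_integral:
  fixes f :: "real \<Rightarrow> real"
  assumes "continuous_on {0..1} f"
  shows "set_integrable lborel {0<..<1} f"
    and "(LINT y:{0<..<1}|lborel. f y) = integral {0..1} f"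
proof -
  have "set_integrable lborel {0..1} f"
    using borel_integrable_atLeastAtMost'[OF assms] .
  then show 1: "set_integrable lborel {0<..<1} f"
    by (rule set_integrable_subset) auto
  show "(LINT y:{0<..<1}|lborel. f y) = integral {0..1} f"
    using set_borel_integral_eq_integral(2)[OF 1] by (simp add: integral_open_interval_real)
qed

definition fourier_coeff :: "(real \<Rightarrow> real) \<Rightarrow> (real \<Rightarrow> real) \<Rightarrow> real" where
  "fourier_coeff \<phi> f = integral {0..1} (\<lambda>y. f y * \<phi> y)"

text \<open>End points do not count for the integral. This matters because the interface conditions
  are imposed only for \<open>y\<close> in the open interval.\<close>

lemma fourier_coeff_cong: "(\<And>y. y \<in> {0<..<1} \<Longrightarrow> f y = g y) \<Longrightarrow> fourier_coeff \<phi> f = fourier_coeff \<phi> g"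
  unfolding fourier_coeff_def integral_open_interval_real by (rule integral_cong) simp

lemma has_integral_fourier_coeff:
  "continuous_on {0..1} f \<Longrightarrow> continuous_on {0..1} \<phi> \<Longrightarrow>
    ((\<lambda>y. f y * \<phi> y) has_integral fourier_coeff \<phi> f) {0..1}"
  unfolding fourier_coeff_def by (intro integrable_integral integrable_continuous_real continuous_intros)

lemma eigenbasis_continuous: "eigenbasis q bb bt \<phi> ev \<Longrightarrow> continuous_on {0..1} (\<phi> k)"
  unfolding eigenbasis_def solves_ode_iff by (blast intro: ode_pair_continuous)

text \<open>When the square is expanded, orthonormality collapses the double sum to its diagonal.
  Nonnegativity of the residual is Bessel's inequality, its convergence to 0 is Parseval's
  identity.\<close>

lemma eigenbasis_residual:
  assumes eb: "eigenbasis q bb bt \<phi> ev" and f: "continuous_on {0..1} f"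
  shows "((\<lambda>y. (f y - (\<Sum>k<n. fourier_coeff (\<phi> k) f * \<phi> k y))\<^sup>2) has_integral
    (integral {0..1} (\<lambda>y. (f y)\<^sup>2) - (\<Sum>k<n. (fourier_coeff (\<phi> k) f)\<^sup>2))) {0..1}"
proof -
  define c where "c k = fourier_coeff (\<phi> k) f" for k
  note cont = eigenbasis_continuous[OF eb]
  have o: "((\<lambda>y. \<phi> i y * \<phi> k y) has_integral (if i = k then 1 else 0)) {0..1}" for i k
  proof -
    have "(LINT y:{0<..<1}|lborel. \<phi> i y * \<phi> k y) = integral {0..1} (\<lambda>y. \<phi> i y * \<phi> k y)"
      by (intro LINT_Ioo_eq_integral continuous_intros cont)
    then have "integral {0..1} (\<lambda>y. \<phi> i y * \<phi> k y) = (if i = k then 1 else 0)"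
      using eb unfolding eigenbasis_def by simp
    then show ?thesis
      using integrable_integral[OF integrable_continuous_real[OF continuous_on_mult[OF cont cont]], of i k]
      by simp
  qed
  have ff: "((\<lambda>y. (f y)\<^sup>2) has_integral integral {0..1} (\<lambda>y. (f y)\<^sup>2)) {0..1}"
    by (intro integrable_integral integrable_continuous_real continuous_intros f)
  have "((\<lambda>y. (f y)\<^sup>2 - (\<Sum>k<n. (2 * c k) * (f y * \<phi> k y)) + (\<Sum>i<n. \<Sum>k<n. (c i * c k) * (\<phi> i y * \<phi> k y)))
      has_integral (integral {0..1} (\<lambda>y. (f y)\<^sup>2) - (\<Sum>k<n. (2 * c k) * c k)
        + (\<Sum>i<n. \<Sum>k<n. (c i * c k) * (if i = k then 1 else 0)))) {0..1}"
    by (intro has_integral_add has_integral_diff has_integral_sum has_integral_mult_right ff o)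
       (auto simp: c_def intro!: has_integral_fourier_coeff f cont)
  moreover have "(f y)\<^sup>2 - (\<Sum>k<n. (2 * c k) * (f y * \<phi> k y)) + (\<Sum>i<n. \<Sum>k<n. (c i * c k) * (\<phi> i y * \<phi> k y))
      = (f y - (\<Sum>k<n. c k * \<phi> k y))\<^sup>2" for y
  proof -
    have "(\<Sum>i<n. \<Sum>k<n. (c i * c k) * (\<phi> i y * \<phi> k y)) = (\<Sum>k<n. c k * \<phi> k y)\<^sup>2"
      unfolding power2_eq_square sum_product by (simp add: mult_ac)
    moreover have "(\<Sum>k<n. (2 * c k) * (f y * \<phi> k y)) = 2 * f y * (\<Sum>k<n. c k * \<phi> k y)"
      unfolding sum_distrib_left by (simp add: mult_ac)
    ultimately show ?thesis by (simp add: power2_diff)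
  qed
  moreover have "integral {0..1} (\<lambda>y. (f y)\<^sup>2) - (\<Sum>k<n. (2 * c k) * c k)
        + (\<Sum>i<n. \<Sum>k<n. (c i * c k) * (if i = k then 1 else 0))
      = integral {0..1} (\<lambda>y. (f y)\<^sup>2) - (\<Sum>k<n. (c k)\<^sup>2)"
    by (simp add: if_distrib power2_eq_square sum_distrib_left[symmetric] mult.assoc cong: if_cong)
  ultimately show ?thesis unfolding c_def by simp
qed

lemma Bessel:
  assumes "eigenbasis q bb bt \<phi> ev" "continuous_on {0..1} f"
  shows "(\<Sum>k<n. (fourier_coeff (\<phi> k) f)\<^sup>2) \<le> integral {0..1} (\<lambda>y. (f y)\<^sup>2)"
  using has_integral_nonneg[OF eigenbasis_residual[OF assms, of n]] by simp

lemma Parseval: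
  assumes eb: "eigenbasis q bb bt \<phi> ev" and f: "continuous_on {0..1} f"
  shows "(\<lambda>n. \<Sum>k<n. (fourier_coeff (\<phi> k) f)\<^sup>2) \<longlonglongrightarrow> integral {0..1} (\<lambda>y. (f y)\<^sup>2)"
proof -
  \<comment> \<open>Completeness is formulated for Borel functions on the whole line, while
    \<open>f\<close> is controlled only on \<open>{0..1}\<close>; the cut-off function is Borel
    measurable and has the same integrals.\<close>
  define g where "g y = (if y \<in> {0..1} then f y else 0)" for y
  have "set_integrable lborel {0..1} f"
    using borel_integrable_atLeastAtMost'[OF f] .
  then have "(\<lambda>y. indicat_real {0..1} y *\<^sub>R f y) \<in> borel_measurable lborel"
    unfolding set_integrable_def by (rule borel_measurable_integrable)
  moreover have "(\<lambda>y. indicat_real {0..1} y *\<^sub>R f y) = g" by (auto simp: g_def indicator_def)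
  ultimately have "g \<in> borel_measurable borel" by simp
  moreover have cont: "continuous_on {0..1} g"
    using f by (rule continuous_on_eq) (simp add: g_def)
  moreover have "set_integrable lborel {0<..<1} (\<lambda>y. (g y)\<^sup>2)"
    by (intro LINT_Ioo_eq_integral continuous_intros cont)
  ultimately have "(\<lambda>n. LINT y:{0<..<1}|lborel.
      (g y - (\<Sum>k<n. (LINT t:{0<..<1}|lborel. g t * \<phi> k t) * \<phi> k y))\<^sup>2) \<longlonglongrightarrow> 0"
    using eb unfolding eigenbasis_def by blast
  moreover have c: "(LINT t:{0<..<1}|lborel. g t * \<phi> k t) = fourier_coeff (\<phi> k) f" for k
    using LINT_Ioo_eq_integral(2)[OF continuous_on_mult[OF cont eigenbasis_continuous[OF eb]], of k]
    by (simp add: fourier_coeff_cong[of g f] flip: fourier_coeff_def) (rule fourier_coeff_cong, simp add: g_def)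
  moreover have "(LINT y:{0<..<1}|lborel. (g y - (\<Sum>k<n. fourier_coeff (\<phi> k) f * \<phi> k y))\<^sup>2)
      = integral {0..1} (\<lambda>y. (f y)\<^sup>2) - (\<Sum>k<n. (fourier_coeff (\<phi> k) f)\<^sup>2)" for n
  proof -
    have "(LINT y:{0<..<1}|lborel. (g y - (\<Sum>k<n. fourier_coeff (\<phi> k) f * \<phi> k y))\<^sup>2)
        = integral {0..1} (\<lambda>y. (g y - (\<Sum>k<n. fourier_coeff (\<phi> k) f * \<phi> k y))\<^sup>2)"
      by (intro LINT_Ioo_eq_integral continuous_intros cont eigenbasis_continuous[OF eb])
    also have "\<dots> = integral {0..1} (\<lambda>y. (f y - (\<Sum>k<n. fourier_coeff (\<phi> k) f * \<phi> k y))\<^sup>2)"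
      by (rule integral_cong) (simp add: g_def)
    finally show ?thesis using integral_unique[OF eigenbasis_residual[OF eb f, of n]] by simp
  qed
  ultimately have "(\<lambda>n. integral {0..1} (\<lambda>y. (f y)\<^sup>2) - (\<Sum>k<n. (fourier_coeff (\<phi> k) f)\<^sup>2)) \<longlonglongrightarrow> 0"
    by simp
  from tendsto_diff[OF tendsto_const[of "integral {0..1} (\<lambda>y. (f y)\<^sup>2)"] this] show ?thesis by simp
qed

section \<open>Fourier coefficients as solutions of the one-dimensional equation\<close>

definition C1_grad ::
  "real \<Rightarrow> real \<Rightarrow> (real \<Rightarrow> real \<Rightarrow> real) \<Rightarrow> (real \<Rightarrow> real \<Rightarrow> real) \<Rightarrow> (real \<Rightarrow> real \<Rightarrow> real) \<Rightarrow> bool" where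
  "C1_grad a b u ux uy \<longleftrightarrow>
     continuous_on ({a..b} \<times> {0..1}) (\<lambda>(x, y). u x y) \<and>
     continuous_on ({a..b} \<times> {0..1}) (\<lambda>(x, y). ux x y) \<and>
     continuous_on ({a..b} \<times> {0..1}) (\<lambda>(x, y). uy x y) \<and>
     (\<forall>x\<in>{a..b}. \<forall>y\<in>{0..1}.
        ((\<lambda>t. u t y) has_real_derivative ux x y) (at x within {a..b}) \<and>
        ((\<lambda>t. u x t) has_real_derivative uy x y) (at y within {0..1}))"

lemma C1_rect_iff: "C1_rect a b u \<longleftrightarrow> (\<exists>ux uy. C1_grad a b u ux uy)"
  by (auto simp: C1_rect_def C1_grad_def)

lemma C1_grad_subset:
  assumes "C1_grad a b u ux uy" "a \<le> a'" "b' \<le> b"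
  shows "C1_grad a' b' u ux uy"
proof -
  have sub: "{a'..b'} \<subseteq> {a..b}" using assms by auto
  then have "{a'..b'} \<times> {0..1} \<subseteq> {a..b} \<times> {0..1 :: real}" by auto
  then show ?thesis
    using assms(1) sub unfolding C1_grad_def
    by (meson continuous_on_subset has_field_derivative_subset subsetD)
qed

lemma C1_grad_diff:
  assumes "C1_grad a b u ux uy" "C1_grad a b v vx vy"
  shows "C1_grad a b (\<lambda>x y. u x y - v x y) (\<lambda>x y. ux x y - vx x y) (\<lambda>x y. uy x y - vy x y)"
  using assms unfolding C1_grad_def case_prod_unfold
  by (auto intro!: continuous_on_diff DERIV_diff)

lemma continuous_on_slice:
  assumes "continuous_on (S \<times> T) (\<lambda>(x, y). f x y)" "x \<in> S"
  shows "continuous_on T (f x)"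
proof -
  have "continuous_on T (\<lambda>y. case (x, y) of (x, y) \<Rightarrow> f x y)"
    using assms(2) by (intro continuous_on_compose2[OF assms(1)] continuous_intros) auto
  then show ?thesis by simp
qed

lemma fourier_coeff_DERIV:
  assumes C1: "C1_grad a b u ux uy" and \<phi>: "continuous_on {0..1} \<phi>"
  shows "continuous_on {a..b} (\<lambda>x. fourier_coeff \<phi> (ux x))"
    and "x \<in> {a..b} \<Longrightarrow>
      ((\<lambda>x. fourier_coeff \<phi> (u x)) has_real_derivative fourier_coeff \<phi> (ux x)) (at x within {a..b})"
proof -
  have c: "continuous_on ({a..b} \<times> {0..1}) (\<lambda>(x, y). u x y)"
    "continuous_on ({a..b} \<times> {0..1}) (\<lambda>(x, y). ux x y)"
    using C1 by (auto simp: C1_grad_def)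
  have c\<phi>: "continuous_on ({a..b} \<times> {0..1}) (\<lambda>z. \<phi> (snd z))"
    by (rule continuous_on_compose2[OF \<phi>]) (auto intro!: continuous_intros)
  have c2: "continuous_on ({a..b} \<times> cbox 0 1) (\<lambda>(x, y). ux x y * \<phi> y)"
    using continuous_on_mult[OF c(2) c\<phi>] by (simp add: case_prod_unfold)
  show "continuous_on {a..b} (\<lambda>x. fourier_coeff \<phi> (ux x))"
    using integral_continuous_on_param[OF c2] by (simp add: fourier_coeff_def)
  assume x: "x \<in> {a..b}"
  have "((\<lambda>x. integral (cbox 0 1) (\<lambda>y. u x y * \<phi> y)) has_field_derivative
      integral (cbox 0 1) (\<lambda>y. ux x y * \<phi> y)) (at x within {a..b})"
  proof (rule leibniz_rule_field_derivative[OF _ _ c2 x])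
    show "((\<lambda>x. u x t * \<phi> t) has_real_derivative ux z t * \<phi> t) (at z within {a..b})"
      if "z \<in> {a..b}" "t \<in> cbox 0 1" for z t
      using C1 that by (intro DERIV_cmult_right) (auto simp: C1_grad_def)
    show "(\<lambda>y. u z y * \<phi> y) integrable_on cbox 0 1" if "z \<in> {a..b}" for z
      unfolding cbox_interval
      by (intro integrable_continuous_real continuous_intros \<phi> continuous_on_slice[OF c(1) that])
  qed simp
  then show "((\<lambda>x. fourier_coeff \<phi> (u x)) has_real_derivative fourier_coeff \<phi> (ux x)) (at x within {a..b})"
    by (simp add: fourier_coeff_def)
qed

lemma integral_cut_le:
  fixes f :: "real \<Rightarrow> real"
  assumes f: "continuous_on {0..1} f" and M: "\<And>y. y \<in> {0..1} \<Longrightarrow> \<bar>f y\<bar> \<le> M"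
    and e: "0 \<le> e" "e \<le> 1 / 2"
  shows "\<bar>integral {e..1 - e} f - integral {0..1} f\<bar> \<le> 2 * e * M"
proof -
  have i: "f integrable_on {0..1}" by (rule integrable_continuous_real[OF f])
  have i': "f integrable_on {e..1}"
    by (rule integrable_continuous_real[OF continuous_on_subset[OF f]]) (use e in auto)
  have "integral {0..1} f = integral {0..e} f + integral {e..1} f"
    using e by (intro Henstock_Kurzweil_Integration.integral_combine[symmetric] i) auto
  moreover have "integral {e..1} f = integral {e..1 - e} f + integral {1 - e..1} f"
    using e by (intro Henstock_Kurzweil_Integration.integral_combine[symmetric] i') auto
  moreover have "norm (integral {0..e} f) \<le> M * (e - 0)"
    using e by (intro integral_bound continuous_on_subset[OF f]) (auto simp: M)
  moreover have "norm (integral {1 - e..1} f) \<le> M * (1 - (1 - e))"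
    using e by (intro integral_bound continuous_on_subset[OF f]) (auto simp: M)
  ultimately show ?thesis by (simp add: abs_le_iff algebra_simps)
qed

text \<open>Two functions with the same homogeneous condition have zero Wronskian at that end. This
  is the self-adjointness of the external conditions, which removes the boundary terms of the
  integration by parts.\<close>

lemma boundary_cancel:
  assumes "bottom_op q bb f = 0" "bottom_op q bb g = 0"
  shows "deriv_on 0 1 f 0 * g 0 - f 0 * deriv_on 0 1 g 0 = 0"
proof (cases bb)
  case Robin
  then have "deriv_on 0 1 f 0 = q * f 0" "deriv_on 0 1 g 0 = q * g 0" using assms by auto
  then show ?thesis by simp
qed (use assms in auto)

lemma boundary_cancel_top:
  assumes "top_op q bt f = 0" "top_op q bt g = 0"
  shows "deriv_on 0 1 f 1 * g 1 - f 1 * deriv_on 0 1 g 1 = 0"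
proof (cases bt)
  case Robin
  then have "deriv_on 0 1 f 1 = - (q * f 1)" "deriv_on 0 1 g 1 = - (q * g 1)" using assms by auto
  then show ?thesis by simp
qed (use assms in auto)

text \<open>The second derivatives of \<open>u\<close> may blow up at \<open>y = 0\<close> and \<open>y = 1\<close>, so one integrates
  by parts over \<open>{\<epsilon>..1 - \<epsilon>}\<close> and lets \<open>\<epsilon>\<close> tend to 0, locally uniformly in \<open>x\<close>.\<close>

lemma fourier_coeff_ode:
  assumes C1: "C1_grad a b u ux uy" and pois: "solves_poisson a b (\<lambda>_ _. 0) u"
    and bc: "\<And>x. x \<in> {a<..<b} \<Longrightarrow> bottom_op q bb (u x) = 0 \<and> top_op q bt (u x) = 0"
    and ode: "ode_pair (- e) 0 1 \<phi> \<phi>'"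
    and bc\<phi>: "bottom_op q bb \<phi> = 0" "top_op q bt \<phi> = 0"
  shows "ode_pair e a b (\<lambda>x. fourier_coeff \<phi> (u x)) (\<lambda>x. fourier_coeff \<phi> (ux x))"
proof -
  note c\<phi> = ode_pair_continuous[OF ode]
  have c\<phi>': "continuous_on {0..1} \<phi>'" using ode by (simp add: ode_pair_def)
  have cu: "continuous_on ({a..b} \<times> {0..1}) (\<lambda>(x, y). u x y)"
    and cux: "continuous_on ({a..b} \<times> {0..1}) (\<lambda>(x, y). ux x y)"
    and cuy: "continuous_on ({a..b} \<times> {0..1}) (\<lambda>(x, y). uy x y)"
    and dux: "\<And>x y. x \<in> {a..b} \<Longrightarrow> y \<in> {0..1} \<Longrightarrow> ((\<lambda>t. u t y) has_real_derivative ux x y) (at x within {a..b})"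
    and duy: "\<And>x y. x \<in> {a..b} \<Longrightarrow> y \<in> {0..1} \<Longrightarrow> ((\<lambda>t. u x t) has_real_derivative uy x y) (at y within {0..1})"
    using C1 by (auto simp: C1_grad_def)
  obtain vx vy vxx vyy where
    cvxx: "continuous_on ({a<..<b} \<times> {0<..<1}) (\<lambda>(x, y). vxx x y)"
    and v: "\<And>x y. x \<in> {a<..<b} \<Longrightarrow> y \<in> {0<..<1} \<Longrightarrow>
           ((\<lambda>t. u t y) has_real_derivative vx x y) (at x) \<and>
           ((\<lambda>t. vx t y) has_real_derivative vxx x y) (at x) \<and>
           ((\<lambda>t. u x t) has_real_derivative vy x y) (at y) \<and>
           ((\<lambda>t. vy x t) has_real_derivative vyy x y) (at y) \<and>
           - (vxx x y + vyy x y) = 0"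
    using pois unfolding solves_poisson_def by blast
  \<comment> \<open>\<open>solves_poisson\<close> brings its own first derivatives. In the interior
    they agree with those of \<open>C1_grad\<close>, so \<open>ux\<close> and \<open>uy\<close> can
    be differentiated once more there.\<close>
  have vx: "vx x y = ux x y" and vy: "vy x y = uy x y"
    if "x \<in> {a<..<b}" "y \<in> {0<..<1}" for x y
  proof -
    have "((\<lambda>t. u t y) has_real_derivative ux x y) (at x)"
      using dux[of x y] that by (metis at_within_Icc_at atLeastAtMost_iff greaterThanLessThan_iff less_imp_le)
    then show "vx x y = ux x y" using v[OF that] DERIV_unique by blast
    have "((\<lambda>t. u x t) has_real_derivative uy x y) (at y)"
      using duy[of x y] that by (metis at_within_Icc_at atLeastAtMost_iff greaterThanLessThan_iff less_imp_le)
    then show "vy x y = uy x y" using v[OF that] DERIV_unique by blast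
  qed
  have duxx: "((\<lambda>t. ux t y) has_real_derivative vxx x y) (at x)"
    if "x \<in> {a<..<b}" "y \<in> {0<..<1}" for x y
  proof (rule has_field_derivative_transform_within_open)
    show "((\<lambda>t. vx t y) has_real_derivative vxx x y) (at x)" using v[OF that] by blast
    show "vx t y = ux t y" if "t \<in> {a<..<b}" for t by (rule vx[OF that \<open>y \<in> _\<close>])
  qed (use that in auto)
  have duyy: "((\<lambda>t. uy x t) has_real_derivative vyy x y) (at y)"
    if "x \<in> {a<..<b}" "y \<in> {0<..<1}" for x y
  proof (rule has_field_derivative_transform_within_open)
    show "((\<lambda>t. vy x t) has_real_derivative vyy x y) (at y)" using v[OF that] by blast
    show "vy x t = uy x t" if "t \<in> {0<..<1}" for t by (rule vy[OF \<open>x \<in> _\<close> that])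
  qed (use that in auto)
  \<comment> \<open>The Wronskian of \<open>u x\<close> and \<phi> in \<open>y\<close>. Since
    \<open>u\<close> is harmonic and \<phi> an eigenfunction, its \<open>y\<close>-derivative is
    \<open>e\<close> times \<open>u \<phi>\<close> minus \<open>vxx \<phi>\<close>. It is continuous
    up to \<open>y = 0\<close> and \<open>y = 1\<close> and vanishes there by the external
    conditions, whatever the second derivatives do.\<close>
  define B where "B x y = uy x y * \<phi> y - u x y * \<phi>' y" for x y
  have pair\<phi>: "continuous_on ({a..b} \<times> {0..1}) (\<lambda>z. \<phi> (snd z))"
    "continuous_on ({a..b} \<times> {0..1}) (\<lambda>z. \<phi>' (snd z))"
    by (auto intro!: continuous_on_compose2[OF c\<phi>] continuous_on_compose2[OF c\<phi>'] continuous_intros)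
  have cB: "continuous_on ({a..b} \<times> {0..1}) (\<lambda>(x, y). B x y)"
    using continuous_on_diff[OF continuous_on_mult[OF cuy pair\<phi>(1)] continuous_on_mult[OF cu pair\<phi>(2)]]
    by (simp add: B_def case_prod_unfold)
  have B0: "B x 0 = 0" "B x 1 = 0" if x: "x \<in> {a<..<b}" for x
  proof -
    have "deriv_on 0 1 (u x) 0 = uy x 0" "deriv_on 0 1 (u x) 1 = uy x 1"
      using x duy by (auto intro!: deriv_on_eq)
    moreover have "deriv_on 0 1 \<phi> 0 = \<phi>' 0" "deriv_on 0 1 \<phi> 1 = \<phi>' 1"
      using ode by (auto intro!: deriv_on_eq simp: ode_pair_def)
    ultimately show "B x 0 = 0" "B x 1 = 0"
      using boundary_cancel[OF _ bc\<phi>(1), of "u x"] boundary_cancel_top[OF _ bc\<phi>(2), of "u x"] bc[OF x]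
      by (auto simp: B_def)
  qed
  have cut: "integral {\<epsilon>..1 - \<epsilon>} (\<lambda>y. vxx x y * \<phi> y)
      = e * integral {\<epsilon>..1 - \<epsilon>} (\<lambda>y. u x y * \<phi> y) - (B x (1 - \<epsilon>) - B x \<epsilon>)"
    if x: "x \<in> {a<..<b}" and \<epsilon>: "0 < \<epsilon>" "\<epsilon> < 1 / 2" for x \<epsilon>
  proof -
    have "((\<lambda>y. - (vxx x y * \<phi> y) + e * (u x y * \<phi> y)) has_integral (B x (1 - \<epsilon>) - B x \<epsilon>)) {\<epsilon>..1 - \<epsilon>}"
    proof (rule fundamental_theorem_of_calculus)
      fix y assume y: "y \<in> {\<epsilon>..1 - \<epsilon>}"
      then have y': "y \<in> {0<..<1}" using \<epsilon> by auto
      have d: "(\<phi> has_real_derivative \<phi>' y) (at y)" "(\<phi>' has_real_derivative - e * \<phi> y) (at y)"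
        using ode_pair_DERIV[OF ode y'] ode y' by (auto simp: ode_pair_def)
      have "(u x has_real_derivative uy x y) (at y)" using v[OF x y'] vy[OF x y'] by simp
      from DERIV_diff[OF DERIV_mult[OF duyy[OF x y'] d(1)] DERIV_mult[OF this d(2)]]
      have "(B x has_real_derivative (vyy x y * \<phi> y + \<phi>' y * uy x y - (uy x y * \<phi>' y + (- e * \<phi> y) * u x y))) (at y)"
        unfolding B_def .
      moreover have "vyy x y * \<phi> y + \<phi>' y * uy x y - (uy x y * \<phi>' y + (- e * \<phi> y) * u x y)
          = - (vxx x y * \<phi> y) + e * (u x y * \<phi> y)"
      proof -
        have "vyy x y = - vxx x y" using v[OF x y'] by linarith
        then show ?thesis by (simp add: algebra_simps)
      qed
      ultimately have "(B x has_real_derivative - (vxx x y * \<phi> y) + e * (u x y * \<phi> y)) (at y)"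
        by (simp only:)
      then show "(B x has_vector_derivative - (vxx x y * \<phi> y) + e * (u x y * \<phi> y)) (at y within {\<epsilon>..1 - \<epsilon>})"
        unfolding has_real_derivative_iff_has_vector_derivative[symmetric]
        by (rule has_field_derivative_at_within)
    qed (use \<epsilon> in auto)
    moreover have "continuous_on {\<epsilon>..1 - \<epsilon>} (\<lambda>y. vxx x y * \<phi> y)" "continuous_on {\<epsilon>..1 - \<epsilon>} (\<lambda>y. u x y * \<phi> y)"
      using \<epsilon> x by (auto intro!: continuous_intros continuous_on_subset[OF c\<phi>]
          continuous_on_subset[OF continuous_on_slice[OF cvxx x]]
          continuous_on_subset[OF continuous_on_slice[OF cu, of x]])
    then have "((\<lambda>y. - (vxx x y * \<phi> y) + e * (u x y * \<phi> y)) has_integral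
        (- integral {\<epsilon>..1 - \<epsilon>} (\<lambda>y. vxx x y * \<phi> y) + e * integral {\<epsilon>..1 - \<epsilon>} (\<lambda>y. u x y * \<phi> y))) {\<epsilon>..1 - \<epsilon>}"
      by (intro has_integral_add has_integral_neg has_integral_mult_right integrable_integral
          integrable_continuous_real)
    ultimately have "B x (1 - \<epsilon>) - B x \<epsilon>
        = - integral {\<epsilon>..1 - \<epsilon>} (\<lambda>y. vxx x y * \<phi> y) + e * integral {\<epsilon>..1 - \<epsilon>} (\<lambda>y. u x y * \<phi> y)"
      by (rule has_integral_unique)
    then show ?thesis by simp
  qed
  define \<epsilon> where "\<epsilon> n = 1 / (real n + 3)" for n
  have \<epsilon>: "0 < \<epsilon> n" "\<epsilon> n < 1 / 2" for n by (auto simp: \<epsilon>_def field_simps)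
  have \<epsilon>0: "\<epsilon> \<longlonglongrightarrow> 0" unfolding \<epsilon>_def by real_asymp
  have "((\<lambda>x. fourier_coeff \<phi> (ux x)) has_real_derivative e * fourier_coeff \<phi> (u x0)) (at x0)"
    if x0: "x0 \<in> {a<..<b}" for x0
  proof -
    \<comment> \<open>A compact interval around \<open>x0\<close> inside the open one:
      \<open>vxx\<close> is continuous only in the open rectangle, and the external conditions hold
      only for \<open>x\<close> strictly between \<open>a\<close> and \<open>b\<close>.\<close>
    obtain \<alpha> \<beta> where \<alpha>\<beta>: "a < \<alpha>" "\<alpha> < x0" "x0 < \<beta>" "\<beta> < b"
      using x0 dense by (metis greaterThanLessThan_iff)
    define S where "S = {\<alpha>..\<beta>}"
    have S: "S \<subseteq> {a<..<b}" "S \<subseteq> {a..b}" "x0 \<in> S" using \<alpha>\<beta> by (auto simp: S_def)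
    define f where "f n x = integral {\<epsilon> n..1 - \<epsilon> n} (\<lambda>y. ux x y * \<phi> y)" for n x
    define f' where "f' n x = integral {\<epsilon> n..1 - \<epsilon> n} (\<lambda>y. vxx x y * \<phi> y)" for n x
    have der: "(f n has_real_derivative f' n x) (at x within S)" if x: "x \<in> S" for n x
    proof -
      have sub: "S \<times> cbox (\<epsilon> n) (1 - \<epsilon> n) \<subseteq> {a<..<b} \<times> {0<..<1}" using S \<epsilon>[of n] by auto
      have "((\<lambda>x. integral (cbox (\<epsilon> n) (1 - \<epsilon> n)) (\<lambda>y. ux x y * \<phi> y)) has_field_derivative
        integral (cbox (\<epsilon> n) (1 - \<epsilon> n)) (\<lambda>y. vxx x y * \<phi> y)) (at x within S)"
      proof (rule leibniz_rule_field_derivative[OF _ _ _ x])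
        fix z t assume z: "z \<in> S" "t \<in> cbox (\<epsilon> n) (1 - \<epsilon> n)"
        then have "z \<in> {a<..<b}" "t \<in> {0<..<1}" using S(1) \<epsilon>[of n] by (blast, auto)
        then show "((\<lambda>x. ux x t * \<phi> t) has_real_derivative vxx z t * \<phi> t) (at z within S)"
          by (intro DERIV_cmult_right has_field_derivative_at_within[OF duxx])
      next
        fix z assume "z \<in> S"
        then have "z \<in> {a..b}" using S by auto
        then show "(\<lambda>y. ux z y * \<phi> y) integrable_on cbox (\<epsilon> n) (1 - \<epsilon> n)"
          unfolding cbox_interval using \<epsilon>[of n]
          by (intro integrable_continuous_real continuous_intros continuous_on_subset[OF c\<phi>]
              continuous_on_subset[OF continuous_on_slice[OF cux]]) auto
      next
        have "continuous_on ({a<..<b} \<times> {0<..<1}) (\<lambda>z. \<phi> (snd z))"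
          by (rule continuous_on_subset[OF pair\<phi>(1)]) auto
        from continuous_on_mult[OF cvxx this]
        have "continuous_on ({a<..<b} \<times> {0<..<1}) (\<lambda>(x, y). vxx x y * \<phi> y)"
          by (simp add: case_prod_unfold)
        then show "continuous_on (S \<times> cbox (\<epsilon> n) (1 - \<epsilon> n)) (\<lambda>(x, y). vxx x y * \<phi> y)"
          using sub by (rule continuous_on_subset)
      qed (simp add: S_def)
      then show ?thesis unfolding f_def f'_def cbox_interval .
    qed
    have bounded: "\<exists>M. \<forall>x\<in>S. \<forall>y\<in>{0..1}. \<bar>w x y * \<phi> y\<bar> \<le> M"
      if w: "continuous_on ({a..b} \<times> {0..1}) (\<lambda>(x, y). w x y)" for w
    proof -
      have "continuous_on (S \<times> {0..1}) (\<lambda>z. w (fst z) (snd z) * \<phi> (snd z))"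
        using continuous_on_mult[OF w pair\<phi>(1)] S
        by (auto simp: case_prod_unfold elim!: continuous_on_subset)
      then have "compact ((\<lambda>z. w (fst z) (snd z) * \<phi> (snd z)) ` (S \<times> {0..1}))"
        by (rule compact_continuous_image) (auto simp: S_def intro!: compact_Times)
      then obtain M where "\<forall>z\<in>S \<times> {0..1}. norm (w (fst z) (snd z) * \<phi> (snd z)) \<le> M"
        using compact_imp_bounded bounded_iff by (metis (no_types, lifting) imageI)
      then show ?thesis by (intro exI[of _ M]) auto
    qed
    obtain M where M: "\<And>x y. x \<in> S \<Longrightarrow> y \<in> {0..1} \<Longrightarrow> \<bar>u x y * \<phi> y\<bar> \<le> M" using bounded[OF cu] by blast
    obtain M' where M': "\<And>x y. x \<in> S \<Longrightarrow> y \<in> {0..1} \<Longrightarrow> \<bar>ux x y * \<phi> y\<bar> \<le> M'" using bounded[OF cux] by blast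
    have cut_u: "\<bar>integral {\<epsilon> n..1 - \<epsilon> n} (\<lambda>y. u x y * \<phi> y) - fourier_coeff \<phi> (u x)\<bar> \<le> 2 * \<epsilon> n * M"
      if "x \<in> S" for x n
      unfolding fourier_coeff_def using \<epsilon>[of n] that S M
      by (intro integral_cut_le continuous_intros c\<phi> continuous_on_slice[OF cu]) auto
    have lim: "(\<lambda>n. f n x) \<longlonglongrightarrow> fourier_coeff \<phi> (ux x)" if "x \<in> S" for x
    proof -
      have "\<bar>f n x - fourier_coeff \<phi> (ux x)\<bar> \<le> 2 * \<epsilon> n * M'" for n
        unfolding fourier_coeff_def f_def using \<epsilon>[of n] that S M'
        by (intro integral_cut_le continuous_intros c\<phi> continuous_on_slice[OF cux]) auto
      moreover have "(\<lambda>n. 2 * \<epsilon> n * M') \<longlonglongrightarrow> 0"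
        using tendsto_mult_right[OF tendsto_mult_left[OF \<epsilon>0, of 2], of M'] by simp
      ultimately have "(\<lambda>n. f n x - fourier_coeff \<phi> (ux x)) \<longlonglongrightarrow> 0"
        by (intro Lim_null_comparison[of "\<lambda>n. f n x - fourier_coeff \<phi> (ux x)" "\<lambda>n. 2 * \<epsilon> n * M'"]) auto
      then show ?thesis by (simp add: LIM_zero_iff)
    qed
    \<comment> \<open>By \<open>cut\<close>, the error consists of \<open>B\<close> at
      \<open>\<epsilon> n\<close> and \<open>1 - \<epsilon> n\<close> and of the parts cut off from
      the integral of \<open>u \<phi>\<close>. The former are small uniformly in \<open>x\<close>
      because \<open>B\<close> is uniformly continuous and vanishes at \<open>y = 0\<close> and
      \<open>y = 1\<close>, the latter because \<open>u \<phi>\<close> is bounded.\<close>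
    have unif: "\<forall>\<^sub>F n in sequentially. \<forall>x\<in>S. \<bar>f' n x - e * fourier_coeff \<phi> (u x)\<bar> \<le> \<eta>" if \<eta>: "\<eta> > 0" for \<eta>
    proof -
      have "uniformly_continuous_on ({a..b} \<times> {0..1}) (\<lambda>(x, y). B x y)"
        by (intro compact_uniformly_continuous cB compact_Times compact_Icc)
      then obtain \<kappa> where \<kappa>: "\<kappa> > 0"
        "\<And>z z'. z \<in> {a..b} \<times> {0..1} \<Longrightarrow> z' \<in> {a..b} \<times> {0..1} \<Longrightarrow> dist z' z < \<kappa> \<Longrightarrow>
          dist (B (fst z') (snd z')) (B (fst z) (snd z)) < \<eta> / 3"
        unfolding uniformly_continuous_on_def case_prod_unfold using \<eta> by (metis zero_less_divide_iff zero_less_numeral)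
      have "\<forall>\<^sub>F n in sequentially. \<epsilon> n < \<kappa>"
        using order_tendstoD(2)[OF \<epsilon>0] \<kappa>(1) by blast
      moreover have "(\<lambda>n. \<bar>e\<bar> * (2 * \<epsilon> n * M)) \<longlonglongrightarrow> 0"
        using tendsto_mult_left[OF tendsto_mult_right[OF tendsto_mult_left[OF \<epsilon>0, of 2], of M], of "\<bar>e\<bar>"] by simp
      then have "\<forall>\<^sub>F n in sequentially. \<bar>e\<bar> * (2 * \<epsilon> n * M) < \<eta> / 3"
        by (rule order_tendstoD(2)) (use \<eta> in auto)
      ultimately show ?thesis
      proof eventually_elim
        case (elim n)
        show ?case
        proof
          fix x assume x: "x \<in> S"
          then have xab: "x \<in> {a<..<b}" "x \<in> {a..b}" using S by auto
          have "\<bar>B x (\<epsilon> n)\<bar> < \<eta> / 3"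
            using \<kappa>(2)[of "(x, 0)" "(x, \<epsilon> n)"] xab \<epsilon>[of n] elim(1) B0[OF xab(1)]
            by (simp add: dist_Pair_Pair dist_real_def)
          moreover have "\<bar>B x (1 - \<epsilon> n)\<bar> < \<eta> / 3"
            using \<kappa>(2)[of "(x, 1)" "(x, 1 - \<epsilon> n)"] xab \<epsilon>[of n] elim(1) B0[OF xab(1)]
            by (simp add: dist_Pair_Pair dist_real_def)
          moreover have "\<bar>e * integral {\<epsilon> n..1 - \<epsilon> n} (\<lambda>y. u x y * \<phi> y) - e * fourier_coeff \<phi> (u x)\<bar> \<le> \<bar>e\<bar> * (2 * \<epsilon> n * M)"
            using mult_left_mono[OF cut_u[OF x, of n], of "\<bar>e\<bar>"] by (simp flip: abs_mult right_diff_distrib)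
          ultimately show "\<bar>f' n x - e * fourier_coeff \<phi> (u x)\<bar> \<le> \<eta>"
            unfolding f'_def cut[OF xab(1) \<epsilon>] using elim(2) by linarith
        qed
      qed
    qed
    \<comment> \<open>Convergence at one point and uniform convergence of the derivatives allow the
      limit to be differentiated; \<open>lim\<close> identifies that limit.\<close>
    have "\<exists>g. \<forall>x\<in>S. (\<lambda>n. f n x) \<longlonglongrightarrow> g x \<and> (g has_derivative (*) (e * fourier_coeff \<phi> (u x))) (at x within S)"
    proof (rule has_derivative_sequence[where f = f and f' = "\<lambda>n x. (*) (f' n x)"
          and g' = "\<lambda>x. (*) (e * fourier_coeff \<phi> (u x))"])
      show "x0 \<in> S" "(\<lambda>n. f n x0) \<longlonglongrightarrow> fourier_coeff \<phi> (ux x0)" using S(3) lim by auto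
      show "(f n has_derivative (*) (f' n x)) (at x within S)" if "x \<in> S" for n x
        using der[OF that] by (simp add: has_field_derivative_def)
      show "\<forall>\<^sub>F n in sequentially. \<forall>x\<in>S. \<forall>h. norm (f' n x * h - e * fourier_coeff \<phi> (u x) * h) \<le> \<eta> * norm h"
        if "\<eta> > 0" for \<eta>
        using unif[OF that]
        by eventually_elim (auto simp: abs_mult mult_right_mono simp flip: left_diff_distrib)
    qed (simp add: S_def)
    then obtain g where g: "\<And>x. x \<in> S \<Longrightarrow> (\<lambda>n. f n x) \<longlonglongrightarrow> g x"
      "\<And>x. x \<in> S \<Longrightarrow> (g has_real_derivative (e * fourier_coeff \<phi> (u x))) (at x within S)"
      by (auto simp: has_field_derivative_def)
    have eq: "g x = fourier_coeff \<phi> (ux x)" if "x \<in> S" for x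
      using LIMSEQ_unique[OF g(1)[OF that] lim[OF that]] .
    show ?thesis
    proof (rule has_field_derivative_transform_within_open)
      show "(g has_real_derivative (e * fourier_coeff \<phi> (u x0))) (at x0)"
        using g(2)[OF S(3)] at_within_Icc_at[of \<alpha> x0 \<beta>] \<alpha>\<beta> by (simp add: S_def)
      show "g x = fourier_coeff \<phi> (ux x)" if "x \<in> {\<alpha><..<\<beta>}" for x
        using that by (intro eq) (simp add: S_def)
    qed (use \<alpha>\<beta> in auto)
  qed
  then show ?thesis
    unfolding ode_pair_def using fourier_coeff_DERIV[OF C1 c\<phi>] by blast
qed

section \<open>The two-dimensional iteration\<close>

lemma fourier_coeff_linear:
  assumes "continuous_on {0..1} f" "continuous_on {0..1} g" "continuous_on {0..1} \<phi>"
  shows "fourier_coeff \<phi> (\<lambda>y. a * f y + b * g y) = a * fourier_coeff \<phi> f + b * fourier_coeff \<phi> g"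
proof -
  have "((\<lambda>y. a * (f y * \<phi> y) + b * (g y * \<phi> y)) has_integral
      (a * fourier_coeff \<phi> f + b * fourier_coeff \<phi> g)) {0..1}"
    by (intro has_integral_add has_integral_mult_right has_integral_fourier_coeff assms)
  then show ?thesis
    unfolding fourier_coeff_def by (intro integral_unique) (simp add: algebra_simps)
qed

lemma trans_slice:
  assumes "C1_grad a b u ux uy" "a < b" "x \<in> {a..b}" "y \<in> {0..1}"
  shows "trans_left m a b (\<lambda>t. u t y) x = trans_val m * u x y - trans_der m * ux x y"
    and "trans_right m a b (\<lambda>t. u t y) x = trans_val m * u x y + trans_der m * ux x y"
  using assms by (auto intro!: trans_eq simp: C1_grad_def)

text \<open>Differentiation in \<open>x\<close> passes under the integral in \<open>y\<close>, so
  the interface conditions hold for each Fourier coefficient separately and the frequencies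
  decouple.\<close>

lemma trans_fourier_coeff:
  assumes C1: "C1_grad a b u ux uy" and \<phi>: "continuous_on {0..1} \<phi>" and ab: "a < b" and x: "x \<in> {a..b}"
  shows "trans_left m a b (\<lambda>x. fourier_coeff \<phi> (u x)) x
      = fourier_coeff \<phi> (\<lambda>y. trans_left m a b (\<lambda>t. u t y) x)"
    and "trans_right m a b (\<lambda>x. fourier_coeff \<phi> (u x)) x
      = fourier_coeff \<phi> (\<lambda>y. trans_right m a b (\<lambda>t. u t y) x)"
    and "continuous_on {0..1} (\<lambda>y. trans_left m a b (\<lambda>t. u t y) x)"
    and "continuous_on {0..1} (\<lambda>y. trans_right m a b (\<lambda>t. u t y) x)"
proof -
  have c: "continuous_on {0..1} (u x)" "continuous_on {0..1} (ux x)"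
    using C1 x by (auto simp: C1_grad_def intro: continuous_on_slice)
  note t = trans_eq[OF fourier_coeff_DERIV(2)[OF C1 \<phi> x] ab x, of m]
  have "fourier_coeff \<phi> (\<lambda>y. trans_left m a b (\<lambda>t. u t y) x)
      = fourier_coeff \<phi> (\<lambda>y. trans_val m * u x y + - trans_der m * ux x y)"
    by (rule fourier_coeff_cong) (use trans_slice(1)[OF C1 ab x] in simp)
  then show "trans_left m a b (\<lambda>x. fourier_coeff \<phi> (u x)) x
      = fourier_coeff \<phi> (\<lambda>y. trans_left m a b (\<lambda>t. u t y) x)"
    unfolding t(1) fourier_coeff_linear[OF c \<phi>] by simp
  have "fourier_coeff \<phi> (\<lambda>y. trans_right m a b (\<lambda>t. u t y) x)
      = fourier_coeff \<phi> (\<lambda>y. trans_val m * u x y + trans_der m * ux x y)"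
    by (rule fourier_coeff_cong) (use trans_slice(2)[OF C1 ab x] in simp)
  then show "trans_right m a b (\<lambda>x. fourier_coeff \<phi> (u x)) x
      = fourier_coeff \<phi> (\<lambda>y. trans_right m a b (\<lambda>t. u t y) x)"
    unfolding t(2) fourier_coeff_linear[OF c \<phi>] by simp
  show "continuous_on {0..1} (\<lambda>y. trans_left m a b (\<lambda>t. u t y) x)"
    by (rule continuous_on_eq[of _ "\<lambda>y. trans_val m * u x y - trans_der m * ux x y"])
       (use trans_slice(1)[OF C1 ab x] c in \<open>auto intro!: continuous_intros\<close>)
  show "continuous_on {0..1} (\<lambda>y. trans_right m a b (\<lambda>t. u t y) x)"
    by (rule continuous_on_eq[of _ "\<lambda>y. trans_val m * u x y + trans_der m * ux x y"])
       (use trans_slice(2)[OF C1 ab x] c in \<open>auto intro!: continuous_intros\<close>)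
qed

text \<open>\<open>V 0\<close> solves no equation and is measured by its data \<open>G\<close>
  alone; the data imposed at step \<open>Suc n\<close> have therefore contracted \<open>n\<close>
  times. Stating the bound with \<rho> in place of rho at \<open>c\<close> lets one rate serve all
  frequencies.\<close>

lemma iteration_bound:
  assumes Ld: "L > 0" "0 < d" "d < L / 2" and c: "c \<ge> 0" and P: "trans_val m > 0" and N: "N \<ge> 2"
    and ode: "\<And>n j. j \<in> {1..N} \<Longrightarrow> solves_ode c (left_end L j) (right_end L d j) (V (Suc n) j)"
    and l: "\<And>n j. j \<in> {1..N} \<Longrightarrow> left_cond m L d j (V (Suc n) j) = left_datum m L d j (V n)"
    and r: "\<And>n j. j \<in> {1..N} \<Longrightarrow> right_cond m L d N j (V (Suc n) j) = right_datum m L d N j (V n)"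
    and G: "\<And>j. j \<in> {1..N} \<Longrightarrow> \<bar>left_datum m L d j (V 0)\<bar> \<le> G"
      "\<And>j. j \<in> {1..N} \<Longrightarrow> \<bar>right_datum m L d N j (V 0)\<bar> \<le> G"
    and \<rho>: "rho L c d \<le> \<rho>"
    and j: "j \<in> {1..N}" and x: "x \<in> {left_end L j..right_end L d j}"
  shows "\<bar>V (Suc n) j x\<bar> \<le> 2 * (\<rho> ^ n * G) / trans_val m"
proof -
  have \<rho>0: "\<rho> > 0" using \<rho> rho_pos[of L c d] by linarith
  have G0: "G \<ge> 0" using G(1)[OF j] by linarith
  have l1: "left_cond m L d j (V (Suc n) j) = 0" if "j = 1" for n j
    using l[of j n] that N by (simp add: left_datum_def)
  have rN: "right_cond m L d N j (V (Suc n) j) = 0" if "j = N" for n j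
    using r[of j n] that N by (simp add: right_datum_def)
  have data: "\<forall>j\<in>{1..N}. \<bar>left_datum m L d j (V n)\<bar> \<le> \<rho> ^ n * G \<and> \<bar>right_datum m L d N j (V n)\<bar> \<le> \<rho> ^ n * G" for n
  proof (induction n)
    case 0
    then show ?case using G by simp
  next
    case (Suc n)
    have nn: "\<rho> ^ n * G \<ge> 0" using \<rho>0 G0 by simp
    have cl: "\<bar>left_cond m L d j (V (Suc n) j)\<bar> \<le> \<rho> ^ n * G" if "j \<in> {1..N}" for j
      unfolding l[OF that] using Suc that by blast
    have cr: "\<bar>right_cond m L d N j (V (Suc n) j)\<bar> \<le> \<rho> ^ n * G" if "j \<in> {1..N}" for j
      unfolding r[OF that] using Suc that by blast
    have "rho L c d * (\<rho> ^ n * G) \<le> \<rho> ^ Suc n * G"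
      using mult_right_mono[OF \<rho> nn] by simp
    then show ?case
      using datum_estimate[OF Ld c P N nn ode cl l1[OF refl] cr rN[OF refl]] by fastforce
  qed
  show ?thesis
    by (rule subdomain_estimate(3)[OF Ld c P N j ode[OF j] _ l1 _ rN x]) (use data[of n] l[OF j] r[OF j] j in auto)
qed

section \<open>The error equation\<close>

lemma solves_poisson_subset:
  assumes "solves_poisson a b f u" "a \<le> a'" "b' \<le> b"
  shows "solves_poisson a' b' f u"
proof -
  have sub: "{a'<..<b'} \<subseteq> {a<..<b}" using assms by auto
  then have "{a'<..<b'} \<times> {0<..<1} \<subseteq> {a<..<b} \<times> {0<..<1 :: real}" by auto
  note sub2 = this
  obtain ux uy uxx uyy where u:
    "continuous_on ({a<..<b} \<times> {0<..<1}) (\<lambda>(x, y). uxx x y)"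
    "continuous_on ({a<..<b} \<times> {0<..<1}) (\<lambda>(x, y). uyy x y)"
    "\<And>x y. x \<in> {a<..<b} \<Longrightarrow> y \<in> {0<..<1} \<Longrightarrow>
           ((\<lambda>t. u t y) has_real_derivative ux x y) (at x) \<and>
           ((\<lambda>t. ux t y) has_real_derivative uxx x y) (at x) \<and>
           ((\<lambda>t. u x t) has_real_derivative uy x y) (at y) \<and>
           ((\<lambda>t. uy x t) has_real_derivative uyy x y) (at y) \<and>
           - (uxx x y + uyy x y) = f x y"
    using assms(1) unfolding solves_poisson_def by blast
  show ?thesis
    unfolding solves_poisson_def
  proof (rule exI[of _ ux], rule exI[of _ uy], rule exI[of _ uxx], rule exI[of _ uyy],
      intro conjI[OF continuous_on_subset[OF u(1) sub2] conjI[OF continuous_on_subset[OF u(2) sub2]]] ballI)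
    fix x y assume "x \<in> {a'<..<b'}" and y: "y \<in> {0<..<(1::real)}"
    then have "x \<in> {a<..<b}" using sub by blast
    from u(3)[OF this y] show "((\<lambda>t. u t y) has_real_derivative ux x y) (at x) \<and>
           ((\<lambda>t. ux t y) has_real_derivative uxx x y) (at x) \<and>
           ((\<lambda>t. u x t) has_real_derivative uy x y) (at y) \<and>
           ((\<lambda>t. uy x t) has_real_derivative uyy x y) (at y) \<and>
           - (uxx x y + uyy x y) = f x y" .
  qed
qed

lemma solves_poisson_diff:
  assumes "solves_poisson a b f u" "solves_poisson a b f v"
  shows "solves_poisson a b (\<lambda>_ _. 0) (\<lambda>x y. u x y - v x y)"
proof -
  obtain ux uy uxx uyy where u:
    "continuous_on ({a<..<b} \<times> {0<..<1}) (\<lambda>(x, y). uxx x y)"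
    "continuous_on ({a<..<b} \<times> {0<..<1}) (\<lambda>(x, y). uyy x y)"
    "\<And>x y. x \<in> {a<..<b} \<Longrightarrow> y \<in> {0<..<1} \<Longrightarrow>
           ((\<lambda>t. u t y) has_real_derivative ux x y) (at x) \<and>
           ((\<lambda>t. ux t y) has_real_derivative uxx x y) (at x) \<and>
           ((\<lambda>t. u x t) has_real_derivative uy x y) (at y) \<and>
           ((\<lambda>t. uy x t) has_real_derivative uyy x y) (at y) \<and>
           - (uxx x y + uyy x y) = f x y"
    using assms(1) unfolding solves_poisson_def by blast
  obtain vx vy vxx vyy where v:
    "continuous_on ({a<..<b} \<times> {0<..<1}) (\<lambda>(x, y). vxx x y)"
    "continuous_on ({a<..<b} \<times> {0<..<1}) (\<lambda>(x, y). vyy x y)"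
    "\<And>x y. x \<in> {a<..<b} \<Longrightarrow> y \<in> {0<..<1} \<Longrightarrow>
           ((\<lambda>t. v t y) has_real_derivative vx x y) (at x) \<and>
           ((\<lambda>t. vx t y) has_real_derivative vxx x y) (at x) \<and>
           ((\<lambda>t. v x t) has_real_derivative vy x y) (at y) \<and>
           ((\<lambda>t. vy x t) has_real_derivative vyy x y) (at y) \<and>
           - (vxx x y + vyy x y) = f x y"
    using assms(2) unfolding solves_poisson_def by blast
  show ?thesis
    unfolding solves_poisson_def
  proof (rule exI[of _ "\<lambda>x y. ux x y - vx x y"], rule exI[of _ "\<lambda>x y. uy x y - vy x y"],
      rule exI[of _ "\<lambda>x y. uxx x y - vxx x y"], rule exI[of _ "\<lambda>x y. uyy x y - vyy x y"],
      intro conjI ballI)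
    show "continuous_on ({a<..<b} \<times> {0<..<1}) (\<lambda>(x, y). uxx x y - vxx x y)"
      using continuous_on_diff[OF u(1) v(1)] by (simp add: case_prod_unfold)
    show "continuous_on ({a<..<b} \<times> {0<..<1}) (\<lambda>(x, y). uyy x y - vyy x y)"
      using continuous_on_diff[OF u(2) v(2)] by (simp add: case_prod_unfold)
    fix x y assume xy: "x \<in> {a<..<b}" "y \<in> {0<..<(1::real)}"
    note u' = u(3)[OF xy] and v' = v(3)[OF xy]
    show "((\<lambda>t. u t y - v t y) has_real_derivative ux x y - vx x y) (at x)"
      "((\<lambda>t. ux t y - vx t y) has_real_derivative uxx x y - vxx x y) (at x)"
      "((\<lambda>t. u x t - v x t) has_real_derivative uy x y - vy x y) (at y)"
      "((\<lambda>t. uy x t - vy x t) has_real_derivative uyy x y - vyy x y) (at y)"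
      using u' v' by (simp_all add: DERIV_diff)
    show "- (uxx x y - vxx x y + (uyy x y - vyy x y)) = 0"
      using u' v' by linarith
  qed
qed

lemma external_op_diff:
  assumes "\<And>y. y \<in> {0..1} \<Longrightarrow> (f has_real_derivative f' y) (at y within {0..1})"
    and "\<And>y. y \<in> {0..1} \<Longrightarrow> (g has_real_derivative g' y) (at y within {0..1})"
  shows "bottom_op q bb (\<lambda>y. f y - g y) = bottom_op q bb f - bottom_op q bb g"
    and "top_op q bt (\<lambda>y. f y - g y) = top_op q bt f - top_op q bt g"
proof -
  have "deriv_on 0 1 (\<lambda>y. f y - g y) y = f' y - g' y" "deriv_on 0 1 f y = f' y" "deriv_on 0 1 g y = g' y"
    if "y \<in> {0..1}" for y
    using that assms by (auto intro!: deriv_on_eq DERIV_diff)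
  then show "bottom_op q bb (\<lambda>y. f y - g y) = bottom_op q bb f - bottom_op q bb g"
    "top_op q bt (\<lambda>y. f y - g y) = top_op q bt f - top_op q bt g"
    by (cases bb; cases bt; simp add: algebra_simps)+
qed

text \<open>At an interface \<open>deriv_on\<close> refers to two different intervals: the point is
  an end of one subdomain and lies inside the other. The exact solution is C1 across it, so both
  give the same derivative and its contributions cancel; at the outer ends they vanish by its
  Dirichlet condition.\<close>

lemma error_problem:
  assumes Ld: "L > 0" "0 < d"
    and ex: "exact_solution L d N q bb bt f u"
    and it: "schwarz_iterates m L d N q bb bt f U"
  obtains X Y where
    "\<And>n j. j \<in> {1..N} \<Longrightarrow> C1_grad (left_end L j) (right_end L d j) (\<lambda>x y. U n j x y - u x y) (X n j) (Y n j)"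
    "\<And>n j. j \<in> {1..N} \<Longrightarrow>
      solves_poisson (left_end L j) (right_end L d j) (\<lambda>_ _. 0) (\<lambda>x y. U (Suc n) j x y - u x y)"
    "\<And>n j x. j \<in> {1..N} \<Longrightarrow> x \<in> {left_end L j<..<right_end L d j} \<Longrightarrow>
      bottom_op q bb (\<lambda>y. U (Suc n) j x y - u x y) = 0 \<and> top_op q bt (\<lambda>y. U (Suc n) j x y - u x y) = 0"
    "\<And>n j y. j \<in> {1..N} \<Longrightarrow> y \<in> {0<..<1} \<Longrightarrow>
      left_cond m L d j (\<lambda>x. U (Suc n) j x y - u x y) = left_datum m L d j (\<lambda>i x. U n i x y - u x y)"
    "\<And>n j y. j \<in> {1..N} \<Longrightarrow> y \<in> {0<..<1} \<Longrightarrow>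
      right_cond m L d N j (\<lambda>x. U (Suc n) j x y - u x y) = right_datum m L d N j (\<lambda>i x. U n i x y - u x y)"
proof -
  have ab: "left_end L j < right_end L d j" for j using subdomain_nonempty[OF Ld] .
  have sub: "left_end L 1 \<le> left_end L j" "right_end L d j \<le> right_end L d N" if "j \<in> {1..N}" for j
    using that Ld by (auto simp: left_end_def right_end_def mult_right_mono)
  obtain ux uy where "C1_grad (left_end L 1) (right_end L d N) u ux uy"
    using ex unfolding exact_solution_def solves_strip_def C1_rect_iff by blast
  then have u: "C1_grad (left_end L j) (right_end L d j) u ux uy" if "j \<in> {1..N}" for j
    using C1_grad_subset sub[OF that] by blast
  have "\<exists>X Y. C1_grad (left_end L j) (right_end L d j) (U n j) X Y" if "j \<in> {1..N}" for n j
    using it that unfolding schwarz_iterates_def solves_strip_def C1_rect_iff by (cases n) blast+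
  note exU = this
  define Ux where "Ux n j = (SOME X. \<exists>Y. C1_grad (left_end L j) (right_end L d j) (U n j) X Y)" for n j
  define Uy where "Uy n j = (SOME Y. C1_grad (left_end L j) (right_end L d j) (U n j) (Ux n j) Y)" for n j
  have U: "C1_grad (left_end L j) (right_end L d j) (U n j) (Ux n j) (Uy n j)" if "j \<in> {1..N}" for n j
  proof -
    have "\<exists>Y. C1_grad (left_end L j) (right_end L d j) (U n j) (Ux n j) Y"
      unfolding Ux_def by (rule someI_ex[OF exU[OF that, of n]])
    from someI_ex[OF this] show ?thesis unfolding Uy_def .
  qed
  have E: "C1_grad (left_end L j) (right_end L d j) (\<lambda>x y. U n j x y - u x y)
      (\<lambda>x y. Ux n j x y - ux x y) (\<lambda>x y. Uy n j x y - uy x y)" if "j \<in> {1..N}" for n j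
    using C1_grad_diff[OF U[OF that] u[OF that]] .
  have pois: "solves_poisson (left_end L j) (right_end L d j) (\<lambda>_ _. 0) (\<lambda>x y. U (Suc n) j x y - u x y)"
    if "j \<in> {1..N}" for n j
  proof (rule solves_poisson_diff)
    show "solves_poisson (left_end L j) (right_end L d j) f (U (Suc n) j)"
      using it that unfolding schwarz_iterates_def solves_strip_def by blast
    show "solves_poisson (left_end L j) (right_end L d j) f u"
      using ex sub[OF that] solves_poisson_subset unfolding exact_solution_def solves_strip_def by blast
  qed
  have bc: "bottom_op q bb (\<lambda>y. U (Suc n) j x y - u x y) = 0 \<and> top_op q bt (\<lambda>y. U (Suc n) j x y - u x y) = 0"
    if j: "j \<in> {1..N}" and x: "x \<in> {left_end L j<..<right_end L d j}" for n j x
  proof -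
    have d: "(U (Suc n) j x has_real_derivative Uy (Suc n) j x y) (at y within {0..1})"
      "(u x has_real_derivative uy x y) (at y within {0..1})" if "y \<in> {0..1}" for y
      using U[OF j, of "Suc n"] u[OF j] x that by (auto simp: C1_grad_def)
    have diff: "bottom_op q bb (\<lambda>y. U (Suc n) j x y - u x y) = bottom_op q bb (U (Suc n) j x) - bottom_op q bb (u x)"
      "top_op q bt (\<lambda>y. U (Suc n) j x y - u x y) = top_op q bt (U (Suc n) j x) - top_op q bt (u x)"
      by (rule external_op_diff[OF d]; assumption)+
    have "x \<in> {left_end L 1<..<right_end L d N}" using x sub[OF j] by auto
    then have "bottom_op q bb (u x) = 0" "top_op q bt (u x) = 0"
      using ex unfolding exact_solution_def solves_strip_def by blast+
    moreover have "bottom_op q bb (U (Suc n) j x) = 0" "top_op q bt (U (Suc n) j x) = 0"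
      using it j x unfolding schwarz_iterates_def solves_strip_def by blast+
    ultimately show ?thesis unfolding diff by simp
  qed
  have bnd: "u (left_end L 1) y = 0" "u (right_end L d N) y = 0" if "y \<in> {0<..<1}" for y
    using ex that unfolding exact_solution_def by blast+
  have cond: "left_cond m L d j (\<lambda>x. U (Suc n) j x y) = left_datum m L d j (\<lambda>i x. U n i x y)"
      "right_cond m L d N j (\<lambda>x. U (Suc n) j x y) = right_datum m L d N j (\<lambda>i x. U n i x y)"
    if "j \<in> {1..N}" "y \<in> {0<..<1}" for n j y
    using it that unfolding schwarz_iterates_def by blast+
  note ts = trans_slice[OF _ ab]
  show ?thesis
  proof (rule that[OF E pois bc])
    fix n j y assume j: "j \<in> {1..N}" and y: "y \<in> {0<..<(1::real)}"
    have y': "y \<in> {0..1}" using y by auto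
    show "left_cond m L d j (\<lambda>x. U (Suc n) j x y - u x y) = left_datum m L d j (\<lambda>i x. U n i x y - u x y)"
    proof (cases "j = 1")
      case True
      then show ?thesis using cond(1)[OF j y, of n] bnd(1)[OF y] by (simp add: left_cond_def left_datum_def)
    next
      case False
      then obtain i where i: "j = Suc i" "i \<in> {1..N}" "i \<noteq> 0"
        using j by (cases j) auto
      have x: "left_end L j \<in> {left_end L j..right_end L d j}"
        "left_end L j \<in> {left_end L i..right_end L d i}"
        using left_end_Suc_mem[OF Ld, of i] ab[of j] unfolding i(1) by auto
      have "j - 1 = i" using i by simp
      then show ?thesis
        using cond(1)[OF j y, of n] False
        unfolding left_cond_def left_datum_def ts(1)[OF E[OF j] x(1) y'] ts(1)[OF U[OF j] x(1) y']
        by (simp add: ts(1)[OF E[OF i(2)] x(2) y'] ts(1)[OF U[OF i(2)] x(2) y'] algebra_simps)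
    qed
    show "right_cond m L d N j (\<lambda>x. U (Suc n) j x y - u x y) = right_datum m L d N j (\<lambda>i x. U n i x y - u x y)"
    proof (cases "j = N")
      case True
      then show ?thesis using cond(2)[OF j y, of n] bnd(2)[OF y] by (simp add: right_cond_def right_datum_def)
    next
      case False
      then have i: "Suc j \<in> {1..N}" using j by auto
      have x: "right_end L d j \<in> {left_end L j..right_end L d j}"
        "right_end L d j \<in> {left_end L (Suc j)..right_end L d (Suc j)}"
        using right_end_mem_Suc[OF Ld, of j] ab[of j] by auto
      show ?thesis
        using cond(2)[OF j y, of n] False
        by (simp add: right_cond_def right_datum_def ts(2)[OF E[OF j] x(1) y'] ts(2)[OF E[OF i] x(2) y']
            ts(2)[OF U[OF j] x(1) y'] ts(2)[OF U[OF i] x(2) y'] algebra_simps)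
    qed
  qed
qed

section \<open>Passage to the L2 norm\<close>

lemma rectangle_LINT_le:
  fixes g :: "real \<Rightarrow> real \<Rightarrow> real"
  assumes g: "continuous_on ({a..b} \<times> {0..1}) (\<lambda>(x, y). g x y)" and "a < b"
    and K: "\<And>x. x \<in> {a..b} \<Longrightarrow> integral {0..1} (g x) \<le> K"
  shows "(LINT z:{a<..<b} \<times> {0<..<1}|lborel. g (fst z) (snd z)) \<le> (b - a) * K"
proof -
  define G where "G z = g (fst z) (snd z)" for z
  have cG: "continuous_on (cbox (a, 0) (b, 1)) G"
    using g by (simp add: G_def cbox_Pair_eq case_prod_unfold)
  have box: "{a<..<b} \<times> {0<..<1::real} = box (a, 0) (b, 1)"
    by (auto simp: box_def Basis_prod_def inner_Pair)
  have "set_integrable lborel (cbox (a, 0) (b, 1)) G"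
    unfolding set_integrable_def by (rule borel_integrable_compact[OF compact_cbox cG])
  then have "set_integrable lborel (box (a, 0) (b, 1)) G"
    by (rule set_integrable_subset) (auto simp: box_subset_cbox)
  from set_borel_integral_eq_integral(2)[OF this]
  have "(LINT z:{a<..<b} \<times> {0<..<1}|lborel. G z) = integral (cbox (a, 0) (b, 1)) G"
    unfolding box by (simp add: integral_open_interval)
  also have "\<dots> = integral {a..b} (\<lambda>x. integral {0..1} (g x))"
    using integral_prod_continuous[OF cG] by (simp add: G_def)
  also have "\<dots> \<le> integral {a..b} (\<lambda>x. K)"
  proof (rule integral_le)
    have "continuous_on {a..b} (\<lambda>x. integral (cbox 0 1) (g x))"
      by (rule integral_continuous_on_param) (use g in simp)
    then show "(\<lambda>x. integral {0..1} (g x)) integrable_on {a..b}"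
      by (intro integrable_continuous_real) simp
  qed (use K in auto)
  also have "\<dots> = (b - a) * K" using \<open>a < b\<close> by simp
  finally show ?thesis by (simp add: G_def)
qed

lemma limsup_root_le:
  fixes e :: "nat \<Rightarrow> real"
  assumes r: "r > 0" and e: "\<And>n. e (Suc n) \<le> C * r ^ n" "\<And>n. e n \<ge> 0"
  shows "limsup (\<lambda>n. ereal (root n (e n))) \<le> ereal r"
proof -
  \<comment> \<open>\<open>C / r\<close> absorbs the shift from \<open>Suc n\<close> to
    \<open>n\<close>; the added 1 keeps \<open>K\<close> positive, so that its n-th root tends to
    1.\<close>
  define K where "K = C / r + 1"
  have "0 \<le> C" using e(1)[of 0] e(2)[of 1] by simp
  then have K: "K > 0" using r by (auto simp: K_def intro!: add_nonneg_pos)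
  have "root n (e n) \<le> root n K * r" if n: "n > 0" for n
  proof -
    obtain k where k: "n = Suc k" using n by (cases n) auto
    have "e n \<le> C / r * r ^ n" using e(1)[of k] r by (simp add: k)
    also have "\<dots> \<le> K * r ^ n" using r by (intro mult_right_mono) (auto simp: K_def)
    finally have "root n (e n) \<le> root n (K * r ^ n)" using n by simp
    also have "\<dots> = root n K * r"
      using n r by (simp add: real_root_mult real_root_power_cancel)
    finally show ?thesis .
  qed
  then have ev: "\<forall>\<^sub>F n in sequentially. ereal (root n (e n)) \<le> ereal (root n K * r)"
    unfolding eventually_sequentially by (intro exI[of _ 1]) auto
  have "(\<lambda>n. root n K * r) \<longlonglongrightarrow> 1 * r"
    by (intro tendsto_mult LIMSEQ_root_const K tendsto_const)
  then have "(\<lambda>n. ereal (root n K * r)) \<longlonglongrightarrow> ereal r" by simp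
  then have "limsup (\<lambda>n. ereal (root n K * r)) = ereal r"
    by (intro lim_imp_Limsup) auto
  then show ?thesis using Limsup_mono[OF ev] by simp
qed

text \<open>Passes from the maximum of the data over the subdomains to their Euclidean norm, whose
  squares can be summed over the frequencies.\<close>

lemma abs_le_sqrt_sum:
  fixes a b :: "nat \<Rightarrow> real"
  assumes "finite J" "j \<in> J"
  shows "\<bar>a j\<bar> \<le> sqrt (\<Sum>i\<in>J. (a i)\<^sup>2 + (b i)\<^sup>2)" "\<bar>b j\<bar> \<le> sqrt (\<Sum>i\<in>J. (a i)\<^sup>2 + (b i)\<^sup>2)"
proof -
  have "(a j)\<^sup>2 + (b j)\<^sup>2 \<le> (\<Sum>i\<in>J. (a i)\<^sup>2 + (b i)\<^sup>2)"
    by (rule member_le_sum[OF assms(2) _ assms(1)]) auto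
  then have "(a j)\<^sup>2 \<le> (\<Sum>i\<in>J. (a i)\<^sup>2 + (b i)\<^sup>2)" "(b j)\<^sup>2 \<le> (\<Sum>i\<in>J. (a i)\<^sup>2 + (b i)\<^sup>2)"
    using zero_le_power2[of "a j"] zero_le_power2[of "b j"] by linarith+
  then show "\<bar>a j\<bar> \<le> sqrt (\<Sum>i\<in>J. (a i)\<^sup>2 + (b i)\<^sup>2)" "\<bar>b j\<bar> \<le> sqrt (\<Sum>i\<in>J. (a i)\<^sup>2 + (b i)\<^sup>2)"
    using real_sqrt_le_mono[of "(a j)\<^sup>2"] real_sqrt_le_mono[of "(b j)\<^sup>2"] by simp_all
qed

lemma L2_contraction_factor_le:
  assumes Ld: "L > 0" "0 < d" "d < L / 2" and P: "trans_val m > 0" and N: "N \<ge> 2"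
    and eb: "eigenbasis q bb bt \<phi> ev" and e0: "0 \<le> e0" "\<And>k. e0 \<le> ev k"
  shows "L2_contraction_factor m L d N q bb bt \<le> ereal (rho L e0 d)"
  unfolding L2_contraction_factor_def
proof (rule Sup_least, clarify)
  fix f u U
  assume ex: "exact_solution L d N q bb bt f u" and it: "schwarz_iterates m L d N q bb bt f U"
  define E where "E n j x y = U n j x y - u x y" for n j x y
  obtain X Y where
    C1: "\<And>n j. j \<in> {1..N} \<Longrightarrow> C1_grad (left_end L j) (right_end L d j) (E n j) (X n j) (Y n j)"
    and pois: "\<And>n j. j \<in> {1..N} \<Longrightarrow>
      solves_poisson (left_end L j) (right_end L d j) (\<lambda>_ _. 0) (E (Suc n) j)"
    and bc: "\<And>n j x. j \<in> {1..N} \<Longrightarrow> x \<in> {left_end L j<..<right_end L d j} \<Longrightarrow>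
      bottom_op q bb (E (Suc n) j x) = 0 \<and> top_op q bt (E (Suc n) j x) = 0"
    and lc: "\<And>n j y. j \<in> {1..N} \<Longrightarrow> y \<in> {0<..<1} \<Longrightarrow>
      left_cond m L d j (\<lambda>x. E (Suc n) j x y) = left_datum m L d j (\<lambda>i x. E n i x y)"
    and rc: "\<And>n j y. j \<in> {1..N} \<Longrightarrow> y \<in> {0<..<1} \<Longrightarrow>
      right_cond m L d N j (\<lambda>x. E (Suc n) j x y) = right_datum m L d N j (\<lambda>i x. E n i x y)"
    by (rule error_problem[OF Ld(1,2) ex it], unfold E_def[abs_def], blast)
  define r where "r = rho L e0 d"
  have r: "r > 0" "rho L (ev k) d \<le> r" for k
    unfolding r_def using rho_pos rho_antimono[OF Ld(1,2) e0(1) e0(2)] by auto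
  note c\<phi> = eigenbasis_continuous[OF eb]
  note ab = subdomain_nonempty[OF Ld(1,2)]
  define V where "V k n j x = fourier_coeff (\<phi> k) (E n j x)" for k n j x
  define LD where "LD j y = left_datum m L d j (\<lambda>i x. E 0 i x y)" for j y
  define RD where "RD j y = right_datum m L d N j (\<lambda>i x. E 0 i x y)" for j y
  note tf = trans_fourier_coeff[OF C1 c\<phi> ab]
  have zero: "fourier_coeff \<psi> (\<lambda>y. 0) = 0" for \<psi> by (simp add: fourier_coeff_def)
  have datum: "left_datum m L d j (V k n) = fourier_coeff (\<phi> k) (\<lambda>y. left_datum m L d j (\<lambda>i x. E n i x y))"
      "continuous_on {0..1} (\<lambda>y. left_datum m L d j (\<lambda>i x. E n i x y))"
      "right_datum m L d N j (V k n) = fourier_coeff (\<phi> k) (\<lambda>y. right_datum m L d N j (\<lambda>i x. E n i x y))"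
      "continuous_on {0..1} (\<lambda>y. right_datum m L d N j (\<lambda>i x. E n i x y))"
    if j: "j \<in> {1..N}" for j k n
  proof -
    show "left_datum m L d j (V k n) = fourier_coeff (\<phi> k) (\<lambda>y. left_datum m L d j (\<lambda>i x. E n i x y))"
      "continuous_on {0..1} (\<lambda>y. left_datum m L d j (\<lambda>i x. E n i x y))"
    proof (atomize (full), cases "j = 1")
      case False
      then obtain i where i: "j = Suc i" "i \<in> {1..N}" "i \<noteq> 0" using j by (cases j) auto
      have "j - 1 = i" using i by simp
      moreover have "left_end L j \<in> {left_end L i..right_end L d i}"
        using left_end_Suc_mem[OF Ld(1,2), of i] unfolding i(1) by auto
      ultimately show "left_datum m L d j (V k n) = fourier_coeff (\<phi> k) (\<lambda>y. left_datum m L d j (\<lambda>i x. E n i x y)) \<and>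
          continuous_on {0..1} (\<lambda>y. left_datum m L d j (\<lambda>i x. E n i x y))"
        using tf(1)[OF i(2), of "left_end L j" m k n] tf(3)[OF i(2), of "left_end L j" m n] False
        unfolding left_datum_def V_def[abs_def] by simp
    qed (simp add: left_datum_def zero)
    show "right_datum m L d N j (V k n) = fourier_coeff (\<phi> k) (\<lambda>y. right_datum m L d N j (\<lambda>i x. E n i x y))"
      "continuous_on {0..1} (\<lambda>y. right_datum m L d N j (\<lambda>i x. E n i x y))"
    proof (atomize (full), cases "j = N")
      case False
      then have i: "j + 1 \<in> {1..N}" using j by auto
      have "right_end L d j \<in> {left_end L (j + 1)..right_end L d (j + 1)}"
        using right_end_mem_Suc[OF Ld(1,2), of j] by auto
      then show "right_datum m L d N j (V k n) = fourier_coeff (\<phi> k) (\<lambda>y. right_datum m L d N j (\<lambda>i x. E n i x y)) \<and>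
          continuous_on {0..1} (\<lambda>y. right_datum m L d N j (\<lambda>i x. E n i x y))"
        using tf(2)[OF i, of "right_end L d j" m k n] tf(4)[OF i, of "right_end L d j" m n] False
        unfolding right_datum_def V_def[abs_def] by simp
    qed (simp add: right_datum_def zero)
  qed
  have ode: "solves_ode (ev k) (left_end L j) (right_end L d j) (V k (Suc n) j)" if j: "j \<in> {1..N}" for j k n
  proof -
    obtain \<phi>' y0 where *: "ode_pair (- ev k) 0 1 (\<phi> k) \<phi>'"
      "bottom_op q bb (\<phi> k) = 0" "top_op q bt (\<phi> k) = 0"
      by (rule eigenbasis_eigenfunction[OF eb])
    show ?thesis
      unfolding solves_ode_iff V_def[abs_def]
      by (rule exI, rule fourier_coeff_ode[OF C1[OF j] pois[OF j] bc[OF j] *])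
  qed
  have L: "left_cond m L d j (V k (Suc n) j) = left_datum m L d j (V k n)" if j: "j \<in> {1..N}" for j k n
  proof -
    have x: "left_end L j \<in> {left_end L j..right_end L d j}" using ab[of j] by simp
    have "left_cond m L d j (V k (Suc n) j) = fourier_coeff (\<phi> k) (\<lambda>y. left_cond m L d j (\<lambda>x. E (Suc n) j x y))"
      unfolding left_cond_def V_def[abs_def] using tf(1)[OF j x] by simp
    also have "\<dots> = left_datum m L d j (V k n)"
      unfolding datum(1)[OF j] by (rule fourier_coeff_cong) (rule lc[OF j])
    finally show ?thesis .
  qed
  have R: "right_cond m L d N j (V k (Suc n) j) = right_datum m L d N j (V k n)" if j: "j \<in> {1..N}" for j k n
  proof -
    have x: "right_end L d j \<in> {left_end L j..right_end L d j}" using ab[of j] by simp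
    have "right_cond m L d N j (V k (Suc n) j) = fourier_coeff (\<phi> k) (\<lambda>y. right_cond m L d N j (\<lambda>x. E (Suc n) j x y))"
      unfolding right_cond_def V_def[abs_def] using tf(2)[OF j x] by simp
    also have "\<dots> = right_datum m L d N j (V k n)"
      unfolding datum(3)[OF j] by (rule fourier_coeff_cong) (rule rc[OF j])
    finally show ?thesis .
  qed
  \<comment> \<open>\<open>sqrt (G2 k)\<close> bounds the initial data of the \<open>k\<close>-th
    component, and Bessel's inequality makes the squares summable over \<open>k\<close>, with the
    bound \<open>Gt\<close>.\<close>
  define G2 where "G2 k = (\<Sum>j=1..N. (fourier_coeff (\<phi> k) (LD j))\<^sup>2 + (fourier_coeff (\<phi> k) (RD j))\<^sup>2)" for k
  define Gt where "Gt = (\<Sum>j=1..N. integral {0..1} (\<lambda>y. (LD j y)\<^sup>2) + integral {0..1} (\<lambda>y. (RD j y)\<^sup>2))"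
  have G2: "G2 k \<ge> 0" for k unfolding G2_def by (intro sum_nonneg) auto
  have Gt: "(\<Sum>k<M. G2 k) \<le> Gt" for M
  proof -
    have "(\<Sum>k<M. G2 k) = (\<Sum>j=1..N. (\<Sum>k<M. (fourier_coeff (\<phi> k) (LD j))\<^sup>2) + (\<Sum>k<M. (fourier_coeff (\<phi> k) (RD j))\<^sup>2))"
      unfolding G2_def by (subst sum.swap) (simp add: sum.distrib)
    also have "\<dots> \<le> Gt"
      unfolding Gt_def LD_def[abs_def] RD_def[abs_def]
      by (intro sum_mono add_mono Bessel[OF eb] datum(2,4))
    finally show ?thesis .
  qed
  have V_le: "\<bar>V k (Suc n) j x\<bar> \<le> 2 * (r ^ n * sqrt (G2 k)) / trans_val m"
    if j: "j \<in> {1..N}" and x: "x \<in> {left_end L j..right_end L d j}" for k n j x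
  proof (rule iteration_bound[OF Ld order_trans[OF e0] P N, where V = "V k"])
    show "\<bar>left_datum m L d j (V k 0)\<bar> \<le> sqrt (G2 k)" if "j \<in> {1..N}" for j
      using abs_le_sqrt_sum(1)[of "{1..N}" j "\<lambda>j. fourier_coeff (\<phi> k) (LD j)" "\<lambda>j. fourier_coeff (\<phi> k) (RD j)"] that
      unfolding datum(1)[OF that] G2_def LD_def[abs_def] by simp
    show "\<bar>right_datum m L d N j (V k 0)\<bar> \<le> sqrt (G2 k)" if "j \<in> {1..N}" for j
      using abs_le_sqrt_sum(2)[of "{1..N}" j "\<lambda>j. fourier_coeff (\<phi> k) (RD j)" "\<lambda>j. fourier_coeff (\<phi> k) (LD j)"] that
      unfolding datum(3)[OF that] G2_def RD_def[abs_def] by simp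
  qed (use ode L R r(2) j x in auto)
  define C where "C = (2 / trans_val m)\<^sup>2 * Gt"
  \<comment> \<open>Squaring \<open>V_le\<close>, summing over \<open>k\<close> and passing to the
    limit by Parseval's identity controls a whole slice. As \<open>C\<close> depends neither on
    \<open>x\<close> nor on \<open>n\<close>, integration over \<open>x\<close> costs only the
    length of the subdomain.\<close>
  have slice: "integral {0..1} (\<lambda>y. (E (Suc n) j x y)\<^sup>2) \<le> (r ^ n)\<^sup>2 * C"
    if j: "j \<in> {1..N}" and x: "x \<in> {left_end L j..right_end L d j}" for n j x
  proof (rule LIMSEQ_le_const2)
    have "continuous_on {0..1} (E (Suc n) j x)"
      using C1[OF j, of "Suc n"] x by (auto simp: C1_grad_def intro: continuous_on_slice)
    from Parseval[OF eb this] show "(\<lambda>M. \<Sum>k<M. (V k (Suc n) j x)\<^sup>2) \<longlonglongrightarrow> integral {0..1} (\<lambda>y. (E (Suc n) j x y)\<^sup>2)"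
      unfolding V_def .
    have "(\<Sum>k<M. (V k (Suc n) j x)\<^sup>2) \<le> (r ^ n)\<^sup>2 * C" for M
    proof -
      have "(V k (Suc n) j x)\<^sup>2 \<le> ((r ^ n)\<^sup>2 * (2 / trans_val m)\<^sup>2) * G2 k" for k
      proof -
        have "(V k (Suc n) j x)\<^sup>2 \<le> (2 * (r ^ n * sqrt (G2 k)) / trans_val m)\<^sup>2"
          using power_mono[OF V_le[OF j x, of k n], of 2] by simp
        also have "\<dots> = ((r ^ n)\<^sup>2 * (2 / trans_val m)\<^sup>2) * G2 k"
          using G2[of k] by (simp add: power_mult_distrib power_divide)
        finally show ?thesis .
      qed
      then have "(\<Sum>k<M. (V k (Suc n) j x)\<^sup>2) \<le> ((r ^ n)\<^sup>2 * (2 / trans_val m)\<^sup>2) * (\<Sum>k<M. G2 k)"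
        unfolding sum_distrib_left by (rule sum_mono)
      also have "\<dots> \<le> ((r ^ n)\<^sup>2 * (2 / trans_val m)\<^sup>2) * Gt"
        by (intro mult_left_mono Gt) auto
      finally show ?thesis by (simp add: C_def mult_ac)
    qed
    then show "\<exists>M0. \<forall>M\<ge>M0. (\<Sum>k<M. (V k (Suc n) j x)\<^sup>2) \<le> (r ^ n)\<^sup>2 * C" by blast
  qed
  define D where "D = (\<Sum>j=1..N. (right_end L d j - left_end L j) * C)"
  have norm_le: "error_norm L d N u (U (Suc n)) \<le> sqrt D * r ^ n" for n
  proof -
    have "(\<Sum>j=1..N. LINT z:{left_end L j<..<right_end L d j} \<times> {0<..<1}|lborel.
             (U (Suc n) j (fst z) (snd z) - u (fst z) (snd z))\<^sup>2)
        \<le> (\<Sum>j=1..N. (right_end L d j - left_end L j) * ((r ^ n)\<^sup>2 * C))"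
    proof (rule sum_mono)
      fix j assume j: "j \<in> {1..N}"
      have "continuous_on ({left_end L j..right_end L d j} \<times> {0..1}) (\<lambda>(x, y). (E (Suc n) j x y)\<^sup>2)"
        using continuous_on_power[of _ _ 2] C1[OF j, of "Suc n"] by (auto simp: C1_grad_def case_prod_unfold)
      from rectangle_LINT_le[OF this ab slice[OF j]]
      show "(LINT z:{left_end L j<..<right_end L d j} \<times> {0<..<1}|lborel.
             (U (Suc n) j (fst z) (snd z) - u (fst z) (snd z))\<^sup>2)
        \<le> (right_end L d j - left_end L j) * ((r ^ n)\<^sup>2 * C)"
        unfolding E_def .
    qed
    also have "\<dots> = D * (r ^ n)\<^sup>2" unfolding D_def sum_distrib_right by (simp only: mult_ac)
    finally have "error_norm L d N u (U (Suc n)) \<le> sqrt (D * (r ^ n)\<^sup>2)"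
      unfolding error_norm_def by (rule real_sqrt_le_mono)
    then show ?thesis using r(1) by (simp add: real_sqrt_mult)
  qed
  have nonneg: "error_norm L d N u (U n) \<ge> 0" for n
    unfolding error_norm_def set_lebesgue_integral_def
    by (intro real_sqrt_ge_zero sum_nonneg integral_nonneg_AE) auto
  show "limsup (\<lambda>n. ereal (root n (error_norm L d N u (U n)))) \<le> ereal (rho L e0 d)"
    using limsup_root_le[OF r(1) norm_le nonneg] unfolding r_def .
qed

theorem theorem3:
  fixes L \<delta> q p :: real and N :: nat and m :: schwarz_method
  assumes "L > 0" and "0 < \<delta>" and "\<delta> < L / 2" and "q > 0" and "N \<ge> 2"
    and "p > 0" and "m \<in> {PSM, OSM p}"
  shows "(\<exists>!x. is_mu1 q x) \<and> (\<exists>!x. is_tau1 q x) \<and> (\<exists>!x. is_nu1 q x) \<and>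
    (\<forall>(bb, bt, r) \<in> {(Dirichlet, Dirichlet, rho_DD L \<delta>),
                     (Dirichlet, Robin, rho_DR L \<delta> q),
                     (Dirichlet, Neumann, rho_DN L \<delta>),
                     (Robin, Robin, rho_RR L \<delta> q),
                     (Neumann, Robin, rho_NR L \<delta> q),
                     (Neumann, Neumann, rho_NN L \<delta>)}.
       \<forall>\<phi> ev. eigenbasis q bb bt \<phi> ev \<longrightarrow>
         (SUP k. ereal (frequency_factor m L \<delta> N (ev k))) \<le> ereal r \<and>
         L2_contraction_factor m L \<delta> N q bb bt \<le> ereal r) \<and>
    (\<forall>d>0. rho_DD L d < rho_DR L d q \<and> rho_DR L d q < rho_DN L d \<and>
           rho_DN L d < rho_NR L d q \<and> rho_NR L d q < rho_NN L d \<and> rho_NN L d = 1) \<and>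
    (\<forall>d>0. rho_DD L d < rho_RR L d q \<and> rho_RR L d q < rho_NN L d \<and> rho_NN L d = 1)"
proof -
  have P: "trans_val m > 0" using assms by auto
  \<comment> \<open>The external conditions influence the rate only through a lower bound
    \<open>e0\<close> for the eigenvalues, so each of the six cases is left with one of the
    eigenvalue lemmas.\<close>
  have bound: "(SUP k. ereal (frequency_factor m L \<delta> N (ev k))) \<le> ereal (rho L e0 \<delta>) \<and>
      L2_contraction_factor m L \<delta> N q bb bt \<le> ereal (rho L e0 \<delta>)"
    if eb: "eigenbasis q bb bt \<phi> ev" and e0: "0 \<le> e0" "\<And>k. e0 \<le> ev k" for bb bt \<phi> ev e0
  proof
    show "(SUP k. ereal (frequency_factor m L \<delta> N (ev k))) \<le> ereal (rho L e0 \<delta>)"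
    proof (rule SUP_least)
      fix k
      have "frequency_factor m L \<delta> N (ev k) \<le> rho L (ev k) \<delta>"
        using order_trans[OF e0] by (intro frequency_factor_le assms P)
      also have "\<dots> \<le> rho L e0 \<delta>"
        using e0 by (intro rho_antimono assms)
      finally show "ereal (frequency_factor m L \<delta> N (ev k)) \<le> ereal (rho L e0 \<delta>)" by simp
    qed
    show "L2_contraction_factor m L \<delta> N q bb bt \<le> ereal (rho L e0 \<delta>)"
      by (rule L2_contraction_factor_le[OF assms(1-3) P assms(5) eb e0])
  qed
  define B where "B bb bt r \<longleftrightarrow> (\<forall>\<phi> ev. eigenbasis q bb bt \<phi> ev \<longrightarrow>
      (SUP k. ereal (frequency_factor m L \<delta> N (ev k))) \<le> ereal r \<and>
      L2_contraction_factor m L \<delta> N q bb bt \<le> ereal r)" for bb bt r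
  have "B Dirichlet Dirichlet (rho_DD L \<delta>)"
    unfolding B_def rho_DD_def by (intro allI impI, rule bound, assumption, simp, erule eigenvalue_DD)
  moreover have "B Dirichlet Robin (rho_DR L \<delta> q)"
    unfolding B_def rho_DR_def
    by (intro allI impI, rule bound, assumption, simp, erule eigenvalue_DR[OF _ assms(4)])
  moreover have "B Dirichlet Neumann (rho_DN L \<delta>)"
    unfolding B_def rho_DN_def by (intro allI impI, rule bound, assumption, simp, erule eigenvalue_DN)
  moreover have "B Robin Robin (rho_RR L \<delta> q)"
    unfolding B_def rho_RR_def
    by (intro allI impI, rule bound, assumption, simp, erule eigenvalue_RR[OF _ assms(4)])
  moreover have "B Neumann Robin (rho_NR L \<delta> q)"
    unfolding B_def rho_NR_def
    by (intro allI impI, rule bound, assumption, simp, erule eigenvalue_NR[OF _ assms(4)])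
  moreover have "B Neumann Neumann (rho_NN L \<delta>)"
    unfolding B_def rho_NN_def by (intro allI impI, rule bound, assumption, simp, erule eigenvalue_NN)
  ultimately show ?thesis
    unfolding B_def[symmetric]
    using ex1_mu1 ex1_tau1 ex1_nu1 rho_order[OF assms(1) _ assms(4)] assms(4) by simp
qed

end
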